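(* Let $\Phi:\mathcal{L}(\mathcal{H})\to\mathcal{L}(\mathcal{K})$ be a quantum channel with operator system $S_\Phi$. A $*$-algebra $\mathscr{A}\cong\bigoplus_{k=1}^K\mathbb{M}_{d_k}(\mathbb{C})$ is transmittable via $\Phi$ if and only if there exist subspaces $C_1,\ldots,C_K\subseteq\mathcal{H}$ with $\dim C_k=d_k$ that are quantum codes for $\Phi$ and pairwise $S_\Phi$-orthogonal, i.e. whose orthogonal projections $P_k$ onto $C_k$ satisfy $$P_kS_\Phi P_k=\mathbb{C}P_k\quad\text{for all }k,\qquad P_kS_\Phi P_j=0\quad\text{for all }k\neq j.$$
   Context: All Hilbert spaces are finite-dimensional and complex; all $C^*$-algebras are finite-dimensional and nonzero. $\mathcal{L}(\mathcal{H})$ is the algebra of linear operators on $\mathcal{H}$. A quantum channel is a linear, completely positive, trace-preserving map $\Phi:\mathcal{L}(\mathcal{H})\to\mathcal{L}(\mathcal{K})$; its adjoint $\Phi^*$ is defined by $\mathrm{Tr}(Y\Phi(X))=\mathrm{Tr}(\Phi^*(Y)X)$. For a Kraus representation $\Phi(X)=\sum_{i=1}^nK_iXK_i^*$, the operator system of $\Phi$ is $S_\Phi=\mathrm{span}\{K_i^*K_j:1\le i,j\le n\}\subseteq\mathcal{L}(\mathcal{H})$ (independent of the Kraus representation). Correctability: a $*$-subalgebra $\mathscr{A}\subseteq\mathcal{L}(\mathcal{H})$ with unit projection $P$ (possibly $P\neq 1_{\mathcal{H}}$) is correctable for $\Phi$ if, with $C=P\mathcal{H}$, $V:C\to\mathcal{H}$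 the inclusion and $\Phi|_C(Y)=\Phi(VYV^* )$, there is a channel $\mathcal{D}:\mathcal{L}(\mathcal{K})\to\mathcal{L}(C)$ with $(\mathcal{D}\circ\Phi|_C)^*(X)=X$ for all $X\in V^*\mathscr{A}V$. Transmittability: a $C^*$-algebra $\mathscr{A}$ is transmittable via $\Phi$ if there is an injective (not necessarily unital) $*$-homomorphism $\pi:\mathscr{A}\to\mathcal{L}(\mathcal{H})$ whose image is correctable for $\Phi$. *)

theory Defs
  imports "Jordan_Normal_Form.Schur_Decomposition" "Jordan_Normal_Form.VS_Connect"
    "HOL-Library.FuncSet"
begin

hide_const (open) Multiset.mult Polynomial.smult

text \<open>A finite-dimensional Hilbert space is \<open>\<complex>\<^sup>n\<close> (the set \<open>carrier_vec n\<close>, inner product \<open>\<bullet>c\<close>), with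
  \<open>n = 0\<close> allowed; its operators are the elements of \<open>carrier_mat n n\<close>. A map
  from \<open>\<L>(\<complex>\<^sup>n)\<close> to \<open>\<L>(\<complex>\<^sup>m)\<close> is a function on \<^typ>\<open>complex mat\<close>, and only its values on
  \<open>carrier_mat n n\<close> matter.\<close>

abbreviation cvec_space :: "nat \<Rightarrow> (complex, complex vec) module" where
  "cvec_space n \<equiv> module_vec TYPE(complex) n"

abbreviation cmat_space :: "nat \<Rightarrow> (complex, complex mat) module" where
  "cmat_space n \<equiv> module_mat TYPE(complex) n n"


section \<open>Quantum channels\<close>

definition mat_trace :: "complex mat \<Rightarrow> complex" where
  "mat_trace X = (\<Sum>i<dim_row X. X $$ (i, i))"

text \<open>The inequality is in the order on the complex numbers of \<^theory>\<open>HOL-Library.Complex_Order\<close>: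
  it says that the left-hand side is real and nonnegative.\<close>

definition positive_operator :: "nat \<Rightarrow> complex mat \<Rightarrow> bool" where
  "positive_operator n X \<longleftrightarrow>
     X \<in> carrier_mat n n \<and> (\<forall>v \<in> carrier_vec n. (X *\<^sub>v v) \<bullet>c v \<ge> 0)"

text \<open>\<open>\<complex>\<^sup>r \<otimes> \<complex>\<^sup>n\<close> is \<open>\<complex>\<^sup>r\<^sup>n\<close>, its basis vector \<open>e\<^sub>i \<otimes> e\<^sub>a\<close> having index \<open>i * n + a\<close>. An operator on it is an
  \<open>r \<times> r\<close> matrix of \<open>n \<times> n\<close> blocks, and \<open>id\<^sub>r \<otimes> \<Phi>\<close> applies \<open>\<Phi>\<close> to each block.\<close>

definition block :: "nat \<Rightarrow> complex mat \<Rightarrow> nat \<Rightarrow> nat \<Rightarrow> complex mat" where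
  "block n X i j = mat n n (\<lambda>(a, b). X $$ (i * n + a, j * n + b))"

definition ampliation ::
  "nat \<Rightarrow> nat \<Rightarrow> nat \<Rightarrow> (complex mat \<Rightarrow> complex mat) \<Rightarrow> complex mat \<Rightarrow> complex mat" where
  "ampliation r n m \<Phi> X = mat (r * m) (r * m)
     (\<lambda>(p, q). \<Phi> (block n X (p div m) (q div m)) $$ (p mod m, q mod m))"

definition completely_positive :: "nat \<Rightarrow> nat \<Rightarrow> (complex mat \<Rightarrow> complex mat) \<Rightarrow> bool" where
  "completely_positive n m \<Phi> \<longleftrightarrow>
     (\<forall>r X. positive_operator (r * n) X \<longrightarrow> positive_operator (r * m) (ampliation r n m \<Phi> X))"

definition quantum_channel :: "nat \<Rightarrow> nat \<Rightarrow> (complex mat \<Rightarrow> complex mat) \<Rightarrow> bool" where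
  "quantum_channel n m \<Phi> \<longleftrightarrow>
     \<Phi> \<in> LinearCombinations.module_hom class_ring (cmat_space n) (cmat_space m) \<and>
     completely_positive n m \<Phi> \<and>
     (\<forall>X \<in> carrier_mat n n. mat_trace (\<Phi> X) = mat_trace X)"

text \<open>For linear \<open>\<Phi>\<close> the description is proper, as the trace form is nondegenerate.\<close>

definition adjoint_map ::
  "nat \<Rightarrow> nat \<Rightarrow> (complex mat \<Rightarrow> complex mat) \<Rightarrow> complex mat \<Rightarrow> complex mat" where
  "adjoint_map n m \<Phi> Y =
     (THE Z. Z \<in> carrier_mat n n \<and>
        (\<forall>X \<in> carrier_mat n n. mat_trace (Y * \<Phi> X) = mat_trace (Z * X)))"

definition kraus_representation ::
  "nat \<Rightarrow> nat \<Rightarrow> (complex mat \<Rightarrow> complex mat) \<Rightarrow> complex mat list \<Rightarrow> bool" where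
  "kraus_representation n m \<Phi> Ks \<longleftrightarrow>
     set Ks \<subseteq> carrier_mat m n \<and>
     (\<forall>X \<in> carrier_mat n n.
        \<Phi> X = (\<Oplus>\<^bsub>cmat_space m\<^esub> i \<in> {..<length Ks}. Ks ! i * X * mat_adjoint (Ks ! i)))"

text \<open>The span is the same for every Kraus representation of \<open>\<Phi>\<close>, and every channel has one, so the
  choice is immaterial.\<close>

definition operator_system :: "nat \<Rightarrow> nat \<Rightarrow> (complex mat \<Rightarrow> complex mat) \<Rightarrow> complex mat set" where
  "operator_system n m \<Phi> =
     (let Ks = (SOME Ks. kraus_representation n m \<Phi> Ks)
      in LinearCombinations.module.span class_ring (cmat_space n)
           {mat_adjoint K * L | K L. K \<in> set Ks \<and> L \<in> set Ks})"


section \<open>Subspaces\<close>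

abbreviation hilbert_subspace :: "nat \<Rightarrow> complex vec set \<Rightarrow> bool" where
  "hilbert_subspace n C \<equiv> VectorSpace.subspace class_ring C (cvec_space n)"

abbreviation hilbert_dim :: "nat \<Rightarrow> complex vec set \<Rightarrow> nat" where
  "hilbert_dim n C \<equiv> vectorspace.dim class_ring ((cvec_space n)\<lparr>carrier := C\<rparr>)"

definition mat_range :: "complex mat \<Rightarrow> complex vec set" where
  "mat_range X = (\<lambda>v. X *\<^sub>v v) ` carrier_vec (dim_col X)"

definition orthogonal_projection :: "nat \<Rightarrow> complex vec set \<Rightarrow> complex mat \<Rightarrow> bool" where
  "orthogonal_projection n C P \<longleftrightarrow>
     P \<in> carrier_mat n n \<and> P * P = P \<and> mat_adjoint P = P \<and> mat_range P = C"

definition isometry_onto :: "nat \<Rightarrow> nat \<Rightarrow> complex vec set \<Rightarrow> complex mat \<Rightarrow> bool" where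
  "isometry_onto n d C V \<longleftrightarrow>
     V \<in> carrier_mat n d \<and> mat_adjoint V * V = 1\<^sub>m d \<and> mat_range V = C"


section \<open>Complex *-algebras\<close>

record 'a star_algebra = "(complex, 'a) module" +
  star :: "'a \<Rightarrow> 'a"

locale star_algebra =
  ring A + vectorspace "class_ring :: complex ring" A
  for A :: "('a, 'm) star_algebra_scheme" (structure) +
  assumes smult_mult_left:
      "x \<in> carrier A \<Longrightarrow> y \<in> carrier A \<Longrightarrow> c \<odot>\<^bsub>A\<^esub> (x \<otimes>\<^bsub>A\<^esub> y) = (c \<odot>\<^bsub>A\<^esub> x) \<otimes>\<^bsub>A\<^esub> y"
    and smult_mult_right:
      "x \<in> carrier A \<Longrightarrow> y \<in> carrier A \<Longrightarrow> c \<odot>\<^bsub>A\<^esub> (x \<otimes>\<^bsub>A\<^esub> y) = x \<otimes>\<^bsub>A\<^esub> (c \<odot>\<^bsub>A\<^esub> y)"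
    and star_closed: "x \<in> carrier A \<Longrightarrow> star A x \<in> carrier A"
    and star_star: "x \<in> carrier A \<Longrightarrow> star A (star A x) = x"
    and star_add:
      "x \<in> carrier A \<Longrightarrow> y \<in> carrier A \<Longrightarrow> star A (x \<oplus>\<^bsub>A\<^esub> y) = star A x \<oplus>\<^bsub>A\<^esub> star A y"
    and star_smult: "x \<in> carrier A \<Longrightarrow> star A (c \<odot>\<^bsub>A\<^esub> x) = cnj c \<odot>\<^bsub>A\<^esub> star A x"
    and star_mult:
      "x \<in> carrier A \<Longrightarrow> y \<in> carrier A \<Longrightarrow> star A (x \<otimes>\<^bsub>A\<^esub> y) = star A y \<otimes>\<^bsub>A\<^esub> star A x"

text \<open>Preservation of the unit is deliberately not required.\<close>

definition star_hom ::
  "('a, 'm) star_algebra_scheme \<Rightarrow> ('b, 'l) star_algebra_scheme \<Rightarrow> ('a \<Rightarrow> 'b) set" where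
  "star_hom A B =
     {f \<in> LinearCombinations.module_hom (class_ring :: complex ring) A B.
        (\<forall>x \<in> carrier A. \<forall>y \<in> carrier A. f (x \<otimes>\<^bsub>A\<^esub> y) = f x \<otimes>\<^bsub>B\<^esub> f y) \<and>
        (\<forall>x \<in> carrier A. f (star A x) = star B (f x))}"

definition star_isomorphic ::
  "('a, 'm) star_algebra_scheme \<Rightarrow> ('b, 'l) star_algebra_scheme \<Rightarrow> bool" where
  "star_isomorphic A B \<longleftrightarrow> (\<exists>f \<in> star_hom A B. bij_betw f (carrier A) (carrier B))"

definition mat_star_algebra :: "nat \<Rightarrow> complex mat star_algebra" where
  "mat_star_algebra n =
     \<lparr>carrier = carrier_mat n n, mult = (*), one = 1\<^sub>m n, zero = 0\<^sub>m n n, add = (+),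
      smult = (\<cdot>\<^sub>m), star = mat_adjoint\<rparr>"

definition direct_sum_mat_star_algebra ::
  "nat \<Rightarrow> (nat \<Rightarrow> nat) \<Rightarrow> (nat \<Rightarrow> complex mat) star_algebra" where
  "direct_sum_mat_star_algebra N d =
     \<lparr>carrier = (\<Pi>\<^sub>E k \<in> {1..N}. carrier_mat (d k) (d k)),
      mult = (\<lambda>x y. \<lambda>k \<in> {1..N}. x k * y k),
      one = (\<lambda>k \<in> {1..N}. 1\<^sub>m (d k)),
      zero = (\<lambda>k \<in> {1..N}. 0\<^sub>m (d k) (d k)),
      add = (\<lambda>x y. \<lambda>k \<in> {1..N}. x k + y k),
      smult = (\<lambda>c x. \<lambda>k \<in> {1..N}. c \<cdot>\<^sub>m x k),
      star = (\<lambda>x. \<lambda>k \<in> {1..N}. mat_adjoint (x k))\<rparr>"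


section \<open>Correctable and transmittable algebras\<close>

definition star_subalgebra :: "nat \<Rightarrow> complex mat set \<Rightarrow> bool" where
  "star_subalgebra n A \<longleftrightarrow>
     submodule class_ring A (cmat_space n) \<and>
     (\<forall>X \<in> A. \<forall>Y \<in> A. X * Y \<in> A) \<and> (\<forall>X \<in> A. mat_adjoint X \<in> A)"

definition unit_projection :: "complex mat set \<Rightarrow> complex mat \<Rightarrow> bool" where
  "unit_projection A P \<longleftrightarrow> P \<in> A \<and> (\<forall>X \<in> A. P * X = X \<and> X * P = X)"

definition restrict_channel :: "complex mat \<Rightarrow> (complex mat \<Rightarrow> complex mat) \<Rightarrow> complex mat \<Rightarrow> complex mat" where
  "restrict_channel V \<Phi> Y = \<Phi> (V * Y * mat_adjoint V)"

text \<open>The Hilbert space \<open>C = P \<complex>\<^sup>n\<close> is identified with \<open>\<complex>\<^sup>d\<close> by an orthonormal basis, so that the inclusion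
  \<open>C \<rightarrow> \<complex>\<^sup>n\<close> becomes an isometry \<open>V\<close> of \<open>\<complex>\<^sup>d\<close> onto \<open>C\<close>. Another choice of basis multiplies \<open>V\<close> on the
  right by a unitary, which the decoding channel \<open>D\<close> can absorb.\<close>

definition correctable :: "nat \<Rightarrow> nat \<Rightarrow> (complex mat \<Rightarrow> complex mat) \<Rightarrow> complex mat set \<Rightarrow> bool" where
  "correctable n m \<Phi> A \<longleftrightarrow>
     star_subalgebra n A \<and>
     (\<exists>P d V D.
        unit_projection A P \<and> isometry_onto n d (mat_range P) V \<and> quantum_channel m d D \<and>
        (\<forall>X \<in> A. adjoint_map d d (D \<circ> restrict_channel V \<Phi>) (mat_adjoint V * X * V)
                  = mat_adjoint V * X * V))"

definition transmittable ::
  "nat \<Rightarrow> nat \<Rightarrow> (complex mat \<Rightarrow> complex mat) \<Rightarrow> ('a, 'm) star_algebra_scheme \<Rightarrow> bool" where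
  "transmittable n m \<Phi> A \<longleftrightarrow>
     (\<exists>\<pi> \<in> star_hom A (mat_star_algebra n).
        inj_on \<pi> (carrier A) \<and> correctable n m \<Phi> (\<pi> ` carrier A))"

end

theory Submission
  imports Defs
begin

text \<open>Write \<open>K\<^sub>i\<close> for Kraus operators of \<open>\<Phi>\<close>, and let \<open>S\<close> be its operator system.

  If an algebra with unit projection \<open>P\<close> is correctable, every Kraus operator of the corrected channel commutes
  with the compressed algebra. Summing over the Kraus operators of the decoder, which is trace preserving,
  shows that \<open>P S P\<close> commutes with the algebra. For matrix units \<open>E k a b\<close> and a unit vector
  \<open>u k\<close> in the range of \<open>E k 0 0\<close>, the orthonormal vectors \<open>E k a 0 (u k)\<close> then span the code \<open>C k\<close>.

  Conversely, let \<open>W k\<close> be isometries onto the codes. The operators \<open>K\<^sub>i W k\<close> have scalar Gram matrices, so a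
  Gram--Schmidt procedure turns them into isometries \<open>G k l\<close> with mutually orthogonal ranges, and the
  operators \<open>W k (G k l)\<^sup>*\<close> are the Kraus operators of a decoder, up to a completion to a trace-preserving
  map. Each \<open>W k (G k l)\<^sup>* K\<^sub>i\<close> is on the codes a multiple of the projection onto \<open>C k\<close>, hence commutes with
  the embedded algebra \<open>\<Oplus>\<^sub>k W k M (W k)\<^sup>*\<close>, which is therefore fixed.\<close>


section \<open>Matrices\<close>

text \<open>One orthonormalisation replaces spectral theory throughout. It runs for a possibly
  degenerate positive form \<open>adj A * (X * B)\<close>, and its result is recorded not as a basis
  but as a reproducing identity: \<open>T\<close>, the sum of the \<open>G l * adj (G l)\<close>,
  satisfies \<open>X * (T * (X * F)) = X * F\<close>. With \<open>X\<close> the Choi matrix this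
  yields Kraus operators; with \<open>X\<close> the identity it yields an isometry onto the range of
  a projection, and the decoder.

  The embedded algebra may have a unit \<open>P\<close> smaller than the identity, and correction
  only concerns the compression to the range of \<open>P\<close>. Hence the isometry
  \<open>V\<close> with \<open>V * adj V = P\<close>, and hence commutation in the form
  \<open>P * (T * X) = X * (T * P)\<close>.\<close>

abbreviation adj :: "complex mat \<Rightarrow> complex mat" where "adj \<equiv> mat_adjoint"

lemma dim_row_adj [simp]: "dim_row (adj A) = dim_col A"
  by (simp add: mat_adjoint_def)

lemma dim_col_adj [simp]: "dim_col (adj A) = dim_row A"
  by (simp add: mat_adjoint_def)

lemma index_adj [simp]:
  "i < dim_col A \<Longrightarrow> j < dim_row A \<Longrightarrow> adj A $$ (i, j) = cnj (A $$ (j, i))"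
  by (simp add: mat_adjoint_def mat_of_rows_index)

lemma adj_carrier [simp]: "A \<in> carrier_mat r c \<Longrightarrow> adj A \<in> carrier_mat c r"
  by (rule carrier_matI) simp_all

lemma index_mult_sum:
  "i < dim_row A \<Longrightarrow> j < dim_col B \<Longrightarrow> dim_col A = dim_row B \<Longrightarrow>
    (A * B) $$ (i, j) = (\<Sum>k<dim_row B. A $$ (i, k) * B $$ (k, j))"
  by (simp add: scalar_prod_def atLeast0LessThan)

declare index_mult_mat(1) [simp del]

text \<open>The side conditions are equations between dimensions, which the simplifier can
  discharge; carrier memberships would leave the sizes to be guessed.\<close>

lemma mult_assoc_dim:
  fixes A B C :: "complex mat"
  shows "dim_col A = dim_row B \<Longrightarrow> dim_col B = dim_row C \<Longrightarrow> A * B * C = A * (B * C)"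
  by (rule assoc_mult_mat[of _ "dim_row A" "dim_col A" _ "dim_col B" _ "dim_col C"]) auto

lemma adj_adj [simp]: "adj (adj A) = A"
  by (rule eq_matI) auto

lemma adj_mult: "dim_col A = dim_row B \<Longrightarrow> adj (A * B) = adj B * adj A"
  by (rule eq_matI) (auto simp: index_mult_sum intro!: sum.cong)

lemma adj_one [simp]: "adj (1\<^sub>m n) = 1\<^sub>m n"
  by (rule eq_matI) auto

lemma adj_zero [simp]: "adj (0\<^sub>m r c) = 0\<^sub>m c r"
  by (rule eq_matI) auto

lemma adj_smult: "adj (a \<cdot>\<^sub>m A) = cnj a \<cdot>\<^sub>m adj A"
  by (rule eq_matI) auto

lemma adj_minus: "dim_row A = dim_row B \<Longrightarrow> dim_col A = dim_col B \<Longrightarrow> adj (A - B) = adj A - adj B"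
  by (rule eq_matI) auto

lemma mult_one_left [simp]: "dim_row (A :: complex mat) = n \<Longrightarrow> 1\<^sub>m n * A = A"
  by (rule left_mult_one_mat'[of _ n]) 

lemma mult_one_right [simp]: "dim_col (A :: complex mat) = n \<Longrightarrow> A * 1\<^sub>m n = A"
  by (rule right_mult_one_mat'[of _ n]) 

lemma mult_zero_left [simp]: "dim_row (A :: complex mat) = n \<Longrightarrow> 0\<^sub>m r n * A = 0\<^sub>m r (dim_col A)"
  by (rule eq_matI) (auto simp: index_mult_sum)

lemma mult_zero_right [simp]: "dim_col (A :: complex mat) = n \<Longrightarrow> A * 0\<^sub>m n c = 0\<^sub>m (dim_row A) c"
  by (rule eq_matI) (auto simp: index_mult_sum)

lemma add_zero_right [simp]: "dim_row (A :: complex mat) = r \<Longrightarrow> dim_col A = c \<Longrightarrow> A + 0\<^sub>m r c = A"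
  by (rule eq_matI) auto

lemma add_zero_left [simp]: "dim_row (A :: complex mat) = r \<Longrightarrow> dim_col A = c \<Longrightarrow> 0\<^sub>m r c + A = A"
  by (rule eq_matI) auto

lemma mult_smult_left:
  "dim_col (A :: complex mat) = dim_row B \<Longrightarrow> (a \<cdot>\<^sub>m A) * B = a \<cdot>\<^sub>m (A * B)"
  by (rule eq_matI) (auto simp: index_mult_sum sum_distrib_left mult.assoc)

lemma mult_smult_right:
  "dim_col (A :: complex mat) = dim_row B \<Longrightarrow> A * (a \<cdot>\<^sub>m B) = a \<cdot>\<^sub>m (A * B)"
  by (rule eq_matI) (auto simp: index_mult_sum sum_distrib_left mult_ac)

lemma mult_minus_right:
  "dim_col (A :: complex mat) = dim_row B \<Longrightarrow> dim_row B = dim_row C \<Longrightarrow> dim_col B = dim_col C \<Longrightarrow>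
    A * (B - C) = A * B - A * C"
  by (rule eq_matI) (auto simp: index_mult_sum sum_subtractf algebra_simps)

lemma mult_minus_left:
  "dim_col B = dim_row (A :: complex mat) \<Longrightarrow> dim_row B = dim_row C \<Longrightarrow> dim_col B = dim_col C \<Longrightarrow>
    (B - C) * A = B * A - C * A"
  by (rule eq_matI) (auto simp: index_mult_sum sum_subtractf algebra_simps)

lemma smult_smult_mat: "a \<cdot>\<^sub>m (b \<cdot>\<^sub>m (A :: complex mat)) = (a * b) \<cdot>\<^sub>m A"
  by (rule eq_matI) auto

lemma smult_one_mat [simp]: "1 \<cdot>\<^sub>m (A :: complex mat) = A"
  by (rule eq_matI) auto

lemma smult_zero_mat [simp]: "a \<cdot>\<^sub>m 0\<^sub>m r c = (0\<^sub>m r c :: complex mat)"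
  by (rule eq_matI) auto

lemma zero_smult_mat [simp]: "0 \<cdot>\<^sub>m (A :: complex mat) = 0\<^sub>m (dim_row A) (dim_col A)"
  by (rule eq_matI) auto

section \<open>Finite sums of matrices of a fixed format\<close>

text \<open>The format is an argument because matrices of all sizes share one type without a common
  zero, so that an empty sum would have no size. The entrywise form reduces identities to sums of
  complex numbers.\<close>

definition msum :: "nat \<Rightarrow> nat \<Rightarrow> ('i \<Rightarrow> complex mat) \<Rightarrow> 'i set \<Rightarrow> complex mat" where
  "msum r c f I = mat r c (\<lambda>p. \<Sum>i\<in>I. f i $$ p)"

lemma dim_msum [simp]: "dim_row (msum r c f I) = r" "dim_col (msum r c f I) = c"
  by (simp_all add: msum_def)

lemma msum_carrier [simp]: "msum r c f I \<in> carrier_mat r c"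
  by (simp add: msum_def)

lemma index_msum [simp]: "i < r \<Longrightarrow> j < c \<Longrightarrow> msum r c f I $$ (i, j) = (\<Sum>k\<in>I. f k $$ (i, j))"
  by (simp add: msum_def)

lemma msum_cong: "I = J \<Longrightarrow> (\<And>i. i \<in> J \<Longrightarrow> f i = g i) \<Longrightarrow> msum r c f I = msum r c g J"
  by (simp add: msum_def)

lemma msum_empty [simp]: "msum r c f {} = 0\<^sub>m r c"
  by (rule eq_matI) auto

lemma msum_insert:
  "finite I \<Longrightarrow> x \<notin> I \<Longrightarrow> f x \<in> carrier_mat r c \<Longrightarrow> msum r c f (insert x I) = f x + msum r c f I"
  by (rule eq_matI) auto

lemma msum_zero [simp]: "msum r c (\<lambda>i. 0\<^sub>m r c) I = 0\<^sub>m r c"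
  by (rule eq_matI) auto

lemma mult_msum_right:
  assumes "dim_col A = r" and f: "f \<in> I \<rightarrow> carrier_mat r c"
  shows "A * msum r c f I = msum (dim_row A) c (\<lambda>i. A * f i) I"
proof (rule eq_matI, goal_cases)
  case (1 i j)
  with assms show ?case
    by (simp add: index_mult_sum sum_distrib_left carrier_matD[OF funcset_mem[OF f]] cong: sum.cong_simp) (rule sum.swap)
qed auto

lemma mult_msum_left:
  assumes "dim_row A = c" and f: "f \<in> I \<rightarrow> carrier_mat r c"
  shows "msum r c f I * A = msum r (dim_col A) (\<lambda>i. f i * A) I"
proof (rule eq_matI, goal_cases)
  case (1 i j)
  with assms show ?case
    by (simp add: index_mult_sum sum_distrib_right carrier_matD[OF funcset_mem[OF f]] cong: sum.cong_simp) (rule sum.swap)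
qed auto

lemma adj_msum:
  assumes f: "f \<in> I \<rightarrow> carrier_mat r c"
  shows "adj (msum r c f I) = msum c r (\<lambda>i. adj (f i)) I"
  by (rule eq_matI) (simp_all add: carrier_matD[OF funcset_mem[OF f]] cong: sum.cong_simp)

lemma smult_msum:
  assumes f: "f \<in> I \<rightarrow> carrier_mat r c"
  shows "a \<cdot>\<^sub>m msum r c f I = msum r c (\<lambda>i. a \<cdot>\<^sub>m f i) I"
  by (rule eq_matI) (simp_all add: sum_distrib_left carrier_matD[OF funcset_mem[OF f]] cong: sum.cong_simp)

lemma msum_add:
  assumes f: "f \<in> I \<rightarrow> carrier_mat r c"
    and g: "g \<in> I \<rightarrow> carrier_mat r c"
  shows "msum r c (\<lambda>i. f i + g i) I = msum r c f I + msum r c g I"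
  by (rule eq_matI) (simp_all add: sum.distrib carrier_matD[OF funcset_mem[OF f]] carrier_matD[OF funcset_mem[OF g]] cong: sum.cong_simp)

lemma msum_minus:
  assumes f: "f \<in> I \<rightarrow> carrier_mat r c"
    and g: "g \<in> I \<rightarrow> carrier_mat r c"
  shows "msum r c (\<lambda>i. f i - g i) I = msum r c f I - msum r c g I"
  by (rule eq_matI) (simp_all add: sum_subtractf carrier_matD[OF funcset_mem[OF f]] carrier_matD[OF funcset_mem[OF g]] cong: sum.cong_simp)

lemma msum_delta:
  "finite I \<Longrightarrow> j \<in> I \<Longrightarrow> f j \<in> carrier_mat r c \<Longrightarrow> (\<And>i. i \<in> I \<Longrightarrow> i \<noteq> j \<Longrightarrow> f i = 0\<^sub>m r c) \<Longrightarrow>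
    msum r c f I = f j"
proof (rule eq_matI, goal_cases)
  case (1 a b)
  then have "(\<Sum>i\<in>I. f i $$ (a, b)) = (\<Sum>i\<in>I. if i = j then f j $$ (a, b) else 0)"
    by (intro sum.cong) auto
  with 1 show ?case by auto
qed auto

lemma msum_Sigma:
  "finite I \<Longrightarrow> (\<And>i. i \<in> I \<Longrightarrow> finite (J i)) \<Longrightarrow>
    msum r c (\<lambda>i. msum r c (f i) (J i)) I = msum r c (\<lambda>(i, j). f i j) (Sigma I J)"
  by (rule eq_matI) (auto simp: sum.Sigma case_prod_unfold)

text \<open>Connects the sum in the definition of a Kraus representation with
  \<open>msum\<close>.\<close>

lemma finsum_cmat_space:
  "finite I \<Longrightarrow> (\<And>i. i \<in> I \<Longrightarrow> f i \<in> carrier_mat n n) \<Longrightarrow>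
    (\<Oplus>\<^bsub>cmat_space n\<^esub> i \<in> I. f i) = msum n n f I"
proof (induction I rule: finite_induct)
  interpret abelian_group "cmat_space n" by (rule abelian_group_mat)
  case empty
  show ?case by (simp add: module_mat_simps)
next
  interpret abelian_group "cmat_space n" by (rule abelian_group_mat)
  case (insert x F)
  have "finsum (cmat_space n) f (insert x F) = f x \<oplus>\<^bsub>cmat_space n\<^esub> finsum (cmat_space n) f F"
    using insert by (intro finsum_insert) (auto simp: module_mat_simps)
  with insert show ?case by (simp add: module_mat_simps msum_insert)
qed

section \<open>The trace form and matrix units\<close>

lemma mat_trace_mult_commute:
  "A \<in> carrier_mat r c \<Longrightarrow> B \<in> carrier_mat c r \<Longrightarrow> mat_trace (A * B) = mat_trace (B * A)"
  by (simp add: mat_trace_def index_mult_sum carrier_matD mult.commute) (rule sum.swap)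

lemma mat_trace_msum: "mat_trace (msum n n f I) = (\<Sum>i\<in>I. \<Sum>j<n. f i $$ (j, j))"
  by (auto simp: mat_trace_def intro: sum.swap)

definition munit :: "nat \<Rightarrow> nat \<Rightarrow> nat \<Rightarrow> complex mat" where
  "munit n i j = mat n n (\<lambda>(a, b). if a = i \<and> b = j then 1 else 0)"

lemma munit_simps [simp]: "munit n i j \<in> carrier_mat n n" "dim_row (munit n i j) = n"
  "dim_col (munit n i j) = n"
  "a < n \<Longrightarrow> b < n \<Longrightarrow> munit n i j $$ (a, b) = (if a = i \<and> b = j then 1 else 0)"
  by (auto simp: munit_def)

lemma munit_mult:
  "j < n \<Longrightarrow> munit n i j * munit n k l = (if j = k then munit n i l else 0\<^sub>m n n)"
  by (rule eq_matI) (auto simp: index_mult_sum if_distrib[of "\<lambda>x. x * _"] sum.delta cong: if_cong)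

lemma adj_munit: "adj (munit n i j) = munit n j i"
  by (rule eq_matI) auto

lemma mat_munit_expansion:
  assumes "X \<in> carrier_mat n n"
  shows "X = msum n n (\<lambda>(i, j). X $$ (i, j) \<cdot>\<^sub>m munit n i j) ({..<n} \<times> {..<n})"
proof (rule eq_matI, goal_cases)
  case (1 a b)
  have "(\<Sum>p\<in>{..<n} \<times> {..<n}. (case p of (i, j) \<Rightarrow> X $$ (i, j) \<cdot>\<^sub>m munit n i j) $$ (a, b)) =
    (\<Sum>p\<in>{..<n} \<times> {..<n}. if p = (a, b) then X $$ (a, b) else 0)"
    using 1 by (intro sum.cong) (auto split: if_splits)
  with 1 show ?case by simp
qed (use assms in auto)

lemma mat_trace_mult_munit:
  assumes "Z \<in> carrier_mat n n" "i < n" "j < n"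
  shows "mat_trace (Z * munit n i j) = Z $$ (j, i)"
proof -
  have "mat_trace (Z * munit n i j) = (\<Sum>a<n. if a = j then Z $$ (a, i) else 0)"
    using assms unfolding mat_trace_def
  proof (intro sum.cong)
    fix a assume "a \<in> {..<n}"
    moreover have "(\<Sum>k<n. Z $$ (a, k) * (if k = i \<and> a = j then 1 else 0)) =
        (\<Sum>k<n. if k = i then if a = j then Z $$ (a, k) else 0 else 0)"
      by (rule sum.cong) auto
    ultimately show "(Z * munit n i j) $$ (a, a) = (if a = j then Z $$ (a, i) else 0)"
      using assms by (simp add: index_mult_sum cong: sum.cong_simp)
  qed auto
  with assms show ?thesis by simp
qed

text \<open>Testing against \<open>munit n j i\<close> reads off the entry \<open>(i, j)\<close>.
  This makes adjoint maps unique and turns trace preservation into an operator equation.\<close>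

lemma mat_eqI_trace:
  assumes "Z \<in> carrier_mat n n" "Z' \<in> carrier_mat n n"
    and "\<And>X. X \<in> carrier_mat n n \<Longrightarrow> mat_trace (Z * X) = mat_trace (Z' * X)"
  shows "Z = Z'"
proof (rule eq_matI)
  fix i j assume "i < dim_row Z'" "j < dim_col Z'"
  then have ij: "i < n" "j < n" using assms by auto
  show "Z $$ (i, j) = Z' $$ (i, j)"
    using assms(3)[of "munit n j i"] mat_trace_mult_munit[OF assms(1) ij(2,1)]
      mat_trace_mult_munit[OF assms(2) ij(2,1)] by simp
qed (use assms in auto)

text \<open>A diagonal entry of the sum adds up squared moduli over one column of all
  \<open>f i\<close> at once, so it vanishes only if all these entries do.\<close>

lemma sum_adj_mult_self_zero:
  assumes f: "f \<in> I \<rightarrow> carrier_mat r c" and "finite I"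
    and zero: "msum c c (\<lambda>i. adj (f i) * f i) I = 0\<^sub>m c c" and i: "i \<in> I"
  shows "f i = 0\<^sub>m r c"
proof (rule eq_matI)
  fix a b assume "a < dim_row (0\<^sub>m r c :: complex mat)" "b < dim_col (0\<^sub>m r c :: complex mat)"
  then have ab: "a < r" "b < c" by auto
  have "0 = msum c c (\<lambda>i. adj (f i) * f i) I $$ (b, b)" using ab zero by simp
  also have "\<dots> = (\<Sum>i\<in>I. \<Sum>k<r. cnj (f i $$ (k, b)) * f i $$ (k, b))"
    using ab f by (simp add: index_mult_sum carrier_matD[OF funcset_mem[OF f]] cong: sum.cong_simp)
  also have "\<dots> = of_real (\<Sum>i\<in>I. \<Sum>k<r. (cmod (f i $$ (k, b)))\<^sup>2)"
    by (simp only: of_real_sum complex_norm_square mult.commute)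
  finally have "complex_of_real (\<Sum>i\<in>I. \<Sum>k<r. (cmod (f i $$ (k, b)))\<^sup>2) = 0"
    by (rule sym)
  then have "(\<Sum>i\<in>I. \<Sum>k<r. (cmod (f i $$ (k, b)))\<^sup>2) = 0"
    by (simp only: of_real_eq_0_iff)
  then have "\<forall>i\<in>I. (\<Sum>k<r. (cmod (f i $$ (k, b)))\<^sup>2) = 0"
    using \<open>finite I\<close> by (subst (asm) sum_nonneg_eq_0_iff) (auto intro: sum_nonneg)
  with i have "(\<Sum>k<r. (cmod (f i $$ (k, b)))\<^sup>2) = 0" by blast
  with ab have "cmod (f i $$ (a, b)) = 0"
    by (subst (asm) sum_nonneg_eq_0_iff) auto
  with ab show "f i $$ (a, b) = 0\<^sub>m r c $$ (a, b)" by simp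
qed (use funcset_mem[OF f i] in auto)

section \<open>Positive operators\<close>

lemma complex_nonneg_iff: "(0 :: complex) \<le> z \<longleftrightarrow> 0 \<le> Re z \<and> Im z = 0"
  by (auto simp: less_eq_complex_def)

text \<open>That the values at \<open>t = 1\<close> and \<open>t = \<i>\<close> are real forces the
  symmetry. For \<open>p = 0\<close> the expression is real-affine in \<open>t\<close>, hence
  bounded below only if its linear part vanishes.\<close>

lemma nonneg_quadratic_form:
  fixes a b p q :: complex
  assumes nonneg: "\<And>t. 0 \<le> q + t * a + cnj t * b + t * cnj t * p"
    and p: "0 \<le> p" and q: "0 \<le> q"
  shows "b = cnj a" and "p = 0 \<Longrightarrow> a = 0"
proof -
  show b: "b = cnj a"
    using nonneg[of 1] nonneg[of \<i>] p q by (simp add: complex_nonneg_iff complex_eq_iff)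
  show "a = 0" if "p = 0"
  proof (rule ccontr)
    assume "a \<noteq> 0"
    then have pos: "0 < (cmod a)\<^sup>2" by simp
    \<comment> \<open>Chosen so that at \<open>t = - s * cnj a\<close> the real part is
      \<open>Re q - 2 * (Re q + 1)\<close>, which is negative.\<close>
    define s where "s = (Re q + 1) / (cmod a)\<^sup>2"
    have "0 \<le> Re (q + complex_of_real (- s) * cnj a * a + cnj (complex_of_real (- s) * cnj a) * b)"
      using nonneg[of "complex_of_real (- s) * cnj a"] that by (simp add: complex_nonneg_iff mult.assoc)
    also have "\<dots> = Re q - 2 * (s * (cmod a)\<^sup>2)"
      unfolding b by (subst cmod_power2) (simp add: power2_eq_square algebra_simps)
    also have "s * (cmod a)\<^sup>2 = Re q + 1" using pos by (simp add: s_def)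
    finally show False using q by (simp add: complex_nonneg_iff)
  qed
qed

lemma positive_operator_dims [simp]:
  assumes "positive_operator n X" shows "X \<in> carrier_mat n n"
  using assms by (simp add: positive_operator_def)

lemma sesquilinear_expand:
  fixes X :: "complex mat"
  assumes X: "X \<in> carrier_mat n n" and v: "v \<in> carrier_vec n" and w: "w \<in> carrier_vec n"
  shows "(X *\<^sub>v (w + t \<cdot>\<^sub>v v)) \<bullet>c (w + t \<cdot>\<^sub>v v) =
    (X *\<^sub>v w) \<bullet>c w + t * ((X *\<^sub>v v) \<bullet>c w) + cnj t * ((X *\<^sub>v w) \<bullet>c v) +
    t * cnj t * ((X *\<^sub>v v) \<bullet>c v)"
proof -
  have "X *\<^sub>v (w + t \<cdot>\<^sub>v v) = X *\<^sub>v w + t \<cdot>\<^sub>v (X *\<^sub>v v)"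
    using assms by (simp add: mult_add_distrib_mat_vec[of _ n n] mult_mat_vec[of _ n n])
  with assms show ?thesis
    by (simp add: scalar_prod_def sum_distrib_left sum.distrib algebra_simps)
qed

text \<open>Both facts come from the form at \<open>w + t v\<close>, regarded as a function of the
  complex number \<open>t\<close>.\<close>

lemma
  assumes X: "positive_operator n X" and v: "v \<in> carrier_vec n" and w: "w \<in> carrier_vec n"
  shows positive_operator_hermitian: "(X *\<^sub>v w) \<bullet>c v = cnj ((X *\<^sub>v v) \<bullet>c w)"
    and positive_operator_null: "(X *\<^sub>v v) \<bullet>c v = 0 \<Longrightarrow> (X *\<^sub>v v) \<bullet>c w = 0"
proof -
  have *: "0 \<le> (X *\<^sub>v w) \<bullet>c w + t * ((X *\<^sub>v v) \<bullet>c w) + cnj t * ((X *\<^sub>v w) \<bullet>c v) +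
      t * cnj t * ((X *\<^sub>v v) \<bullet>c v)" for t
    using X v w by (subst sesquilinear_expand[symmetric]) (auto simp: positive_operator_def)
  have "0 \<le> (X *\<^sub>v w) \<bullet>c w" "0 \<le> (X *\<^sub>v v) \<bullet>c v"
    using X v w by (auto simp: positive_operator_def)
  from nonneg_quadratic_form[OF * this(2,1)]
  show "(X *\<^sub>v w) \<bullet>c v = cnj ((X *\<^sub>v v) \<bullet>c w)"
    and "(X *\<^sub>v v) \<bullet>c v = 0 \<Longrightarrow> (X *\<^sub>v v) \<bullet>c w = 0"
    by blast+
qed

text \<open>Positivity is defined with vectors; this expresses its values on columns through matrix
  products, in which the later arguments are carried out.\<close>

lemma index_adj_mult_mult:
  fixes X :: "complex mat"
  assumes "X \<in> carrier_mat n n" "G \<in> carrier_mat n c" "F \<in> carrier_mat n d" "i < c" "j < d"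
  shows "(adj G * (X * F)) $$ (i, j) = (X *\<^sub>v col F j) \<bullet>c col G i"
proof -
  have "(X *\<^sub>v col F j) $ k = (X * F) $$ (k, j)" if "k < n" for k
    using assms that by (simp add: index_mult_mat)
  with assms show ?thesis
    by (auto simp: index_mult_sum scalar_prod_def atLeast0LessThan mult.commute simp del: index_mult_mat_vec
        intro!: sum.cong)
qed

lemma positive_operator_adj:
  assumes X: "positive_operator n X" shows "adj X = X"
proof (rule eq_matI, goal_cases)
  case (1 i j)
  have dX: "X \<in> carrier_mat n n" using X by simp
  with 1 have ij: "i < n" "j < n" by auto
  have idx: "X $$ (i, j) = (X *\<^sub>v col (1\<^sub>m n) j) \<bullet>c col (1\<^sub>m n) i" if "i < n" "j < n" for i j
    using index_adj_mult_mult[OF dX one_carrier_mat one_carrier_mat that] dX by simp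
  show ?case
    using ij dX positive_operator_hermitian[OF X, of "col (1\<^sub>m n) i" "col (1\<^sub>m n) j"]
    by (simp add: idx)
qed (use positive_operator_dims[OF X] in auto)

text \<open>Each column of \<open>F\<close> is a null vector of the form, and a positive operator
  annihilates its null vectors. Orthonormalisation for a degenerate \<open>X\<close> rests on
  this.\<close>

lemma positive_operator_mult_zero:
  assumes X: "positive_operator n X" and F: "F \<in> carrier_mat n d"
    and zero: "adj F * (X * F) = 0\<^sub>m d d"
  shows "X * F = 0\<^sub>m n d"
proof (rule eq_matI)
  have dX: "X \<in> carrier_mat n n" using X by simp
  fix i j assume "i < dim_row (0\<^sub>m n d :: complex mat)" "j < dim_col (0\<^sub>m n d :: complex mat)"
  then have ij: "i < n" "j < d" by auto
  have v: "col F j \<in> carrier_vec n" and w: "col (1\<^sub>m n) i \<in> carrier_vec n"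
    using F by (auto intro: carrier_vecI)
  have 0: "(X *\<^sub>v col F j) \<bullet>c col F j = 0"
    using index_adj_mult_mult[OF dX F F ij(2) ij(2)] zero ij by simp
  have "(X *\<^sub>v col F j) \<bullet>c col (1\<^sub>m n) i = 0"
    by (rule positive_operator_null[OF X v w 0])
  then show "(X * F) $$ (i, j) = 0\<^sub>m n d $$ (i, j)"
    using index_adj_mult_mult[OF dX one_carrier_mat F ij] ij dX F by simp
qed (use positive_operator_dims[OF X] F in auto)

lemma index_diag_nonneg:
  assumes X: "positive_operator n X" and F: "F \<in> carrier_mat n d" and i: "i < d"
  shows "0 \<le> (adj F * (X * F)) $$ (i, i)"
  using assms index_adj_mult_mult[OF positive_operator_dims[OF X] F F i i]
  by (auto simp: positive_operator_def)

lemma positive_operator_one: "positive_operator n (1\<^sub>m n)"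
  by (auto simp: positive_operator_def complex_nonneg_iff scalar_prod_def intro!: sum_nonneg add_nonneg_nonneg)

lemma msum_in_subspace:
  assumes "finite I" "0\<^sub>m r c \<in> Q" "Q \<subseteq> carrier_mat r c"
    and "\<And>A B. A \<in> Q \<Longrightarrow> B \<in> Q \<Longrightarrow> A + B \<in> Q"
    and "\<And>i. i \<in> I \<Longrightarrow> f i \<in> Q"
  shows "msum r c f I \<in> Q"
  using assms(1,5)
proof (induction I rule: finite_induct)
  case (insert x I)
  then have "msum r c f (insert x I) = f x + msum r c f I"
    using assms(3) by (intro msum_insert) auto
  with insert assms(4) show ?case by simp
qed (use assms in auto)

text \<open>Gram--Schmidt for the form \<open>adj A * (X * B)\<close>, whose values on \<open>Q\<close> are scalar matrices. For
  \<open>d = 1\<close> this is the usual procedure; the case \<open>d > 1\<close> treats isometric copies of \<open>\<complex>\<^sup>d\<close> as vectors.\<close>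

lemma matrix_gram_schmidt:
  assumes X: "positive_operator m X" and d: "d \<ge> 1"
    and Q: "0\<^sub>m m d \<in> Q" "Q \<subseteq> carrier_mat m d"
      "\<And>A B. A \<in> Q \<Longrightarrow> B \<in> Q \<Longrightarrow> A + B \<in> Q" "\<And>A c. A \<in> Q \<Longrightarrow> c \<cdot>\<^sub>m A \<in> Q"
    and form: "\<And>A B. A \<in> Q \<Longrightarrow> B \<in> Q \<Longrightarrow> \<exists>c. adj A * (X * B) = c \<cdot>\<^sub>m 1\<^sub>m d"
    and "finite \<F>" "\<F> \<subseteq> Q"
  shows "\<exists>(r :: nat) G. (\<forall>l<r. G l \<in> Q) \<and>
    (\<forall>k<r. \<forall>l<r. adj (G k) * (X * G l) = (if k = l then 1\<^sub>m d else 0\<^sub>m d d)) \<and>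
    (\<forall>F\<in>\<F>. X * (msum m m (\<lambda>l. G l * adj (G l)) {..<r} * (X * F)) = X * F)"
  using \<open>finite \<F>\<close> \<open>\<F> \<subseteq> Q\<close>
proof (induction \<F> rule: finite_induct)
  case empty
  show ?case by (rule exI[of _ 0]) auto
next
  case (insert F \<F>)
  have FQ: "F \<in> Q" and FsQ: "\<F> \<subseteq> Q" using insert.prems by blast+
  obtain r :: nat and G where *: "\<forall>l<r. G l \<in> Q"
    "\<forall>k<r. \<forall>l<r. adj (G k) * (X * G l) = (if k = l then 1\<^sub>m d else 0\<^sub>m d d)"
    "\<forall>F\<in>\<F>. X * (msum m m (\<lambda>l. G l * adj (G l)) {..<r} * (X * F)) = X * F"
    using insert.IH[OF FsQ] by blast
  have GQ: "\<And>l. l < r \<Longrightarrow> G l \<in> Q"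
    and orth: "\<And>k l. k < r \<Longrightarrow> l < r \<Longrightarrow> adj (G k) * (X * G l) = (if k = l then 1\<^sub>m d else 0\<^sub>m d d)"
    and span: "\<And>F. F \<in> \<F> \<Longrightarrow> X * (msum m m (\<lambda>l. G l * adj (G l)) {..<r} * (X * F)) = X * F"
    using * by blast+
  have GC: "\<And>l. l < r \<Longrightarrow> G l \<in> carrier_mat m d" using GQ Q(2) by auto
  have FC: "F \<in> carrier_mat m d" using FQ Q(2) by auto
  have XC: "X \<in> carrier_mat m m" using X by simp
  have adjX: "adj X = X" using X by (rule positive_operator_adj)
  \<comment> \<open>\<open>T * X\<close> is the orthogonal projection, for the form of
    \<open>X\<close>, onto the span of the columns of the \<open>G l\<close>. As \<open>X\<close>
    may be degenerate, reproduction of a given \<open>F\<close> is claimed only after multiplication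
    by \<open>X\<close>.\<close>
  define T where "T = msum m m (\<lambda>l. G l * adj (G l)) {..<r}"
  have TC: "T \<in> carrier_mat m m" by (simp add: T_def)
  note dims = carrier_matD[OF FC] carrier_matD[OF XC] carrier_matD[OF TC] carrier_matD[OF GC]
  have GG: "(\<lambda>l. G l * adj (G l)) \<in> {..<r} \<rightarrow> carrier_mat m m"
    by (intro funcsetI carrier_matI) (simp_all add: dims)
  have adjT: "adj T = T"
    unfolding T_def by (subst adj_msum[OF GG]) (auto simp: adj_mult dims intro!: msum_cong)
  have TA: "T * A = msum m (dim_col A) (\<lambda>l. G l * (adj (G l) * A)) {..<r}" if "dim_row A = m" for A
    unfolding T_def using that
    by (subst mult_msum_left[OF _ GG]) (auto simp: mult_assoc_dim dims intro!: msum_cong)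
  have GXT: "adj (G k) * (X * (T * A)) = adj (G k) * A" if "dim_row A = m" "k < r" for A k
  proof -
    have "adj (G k) * (X * (T * A)) =
        msum d (dim_col A) (\<lambda>l. adj (G k) * (X * (G l * (adj (G l) * A)))) {..<r}"
    proof -
      have 1: "(\<lambda>l. G l * (adj (G l) * A)) \<in> {..<r} \<rightarrow> carrier_mat m (dim_col A)"
        by (intro funcsetI carrier_matI) (simp_all add: dims)
      have 2: "(\<lambda>l. X * (G l * (adj (G l) * A))) \<in> {..<r} \<rightarrow> carrier_mat m (dim_col A)"
        by (intro funcsetI carrier_matI) (simp_all add: dims)
      have "X * (T * A) = msum m (dim_col A) (\<lambda>l. X * (G l * (adj (G l) * A))) {..<r}"
        using mult_msum_right[OF _ 1, of X] by (simp add: TA[OF that(1)] dims)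
      then show ?thesis
        using mult_msum_right[OF _ 2, of "adj (G k)"] that by (simp add: dims)
    qed
    also have "\<dots> = msum d (dim_col A) (\<lambda>l. if l = k then adj (G k) * A else 0\<^sub>m d (dim_col A)) {..<r}"
    proof (rule msum_cong, rule refl)
      fix l assume l: "l \<in> {..<r}"
      have "adj (G k) * (X * (G l * (adj (G l) * A))) = (adj (G k) * (X * G l)) * (adj (G l) * A)"
        using l that by (simp add: mult_assoc_dim dims)
      then show "adj (G k) * (X * (G l * (adj (G l) * A))) =
          (if l = k then adj (G k) * A else 0\<^sub>m d (dim_col A))"
        using l that by (simp add: orth dims)
    qed
    also have "\<dots> = adj (G k) * A"
      using that by (subst msum_delta[of _ k]) (auto simp: dims)
    finally show ?thesis .
  qed
  have scal: "\<exists>c. adj (G l) * (X * F) = c \<cdot>\<^sub>m 1\<^sub>m d" if "l < r" for l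
    using form GQ FQ that by blast
  \<comment> \<open>The residual of \<open>F\<close>, orthogonal to all \<open>G l\<close>. It stays
    in \<open>Q\<close> because the \<open>adj (G l) * (X * F)\<close> are scalar, which makes
    \<open>T * (X * F)\<close> a linear combination of the \<open>G l\<close>.\<close>
  define F' where "F' = F - T * (X * F)"
  have F'C: "F' \<in> carrier_mat m d" by (rule carrier_matI) (simp_all add: F'_def dims)
  note dims = dims carrier_matD[OF F'C]
  have "T * (X * F) \<in> Q"
  proof (subst TA)
    show "dim_row (X * F) = m" by (simp add: dims)
    have "msum m d (\<lambda>l. G l * (adj (G l) * (X * F))) {..<r} \<in> Q"
    proof (rule msum_in_subspace[OF _ Q(1,2,3)])
      fix l assume "l \<in> {..<r}"
      then obtain c where "adj (G l) * (X * F) = c \<cdot>\<^sub>m 1\<^sub>m d" and l: "l < r" using scal by auto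
      then have "G l * (adj (G l) * (X * F)) = c \<cdot>\<^sub>m G l" by (simp add: mult_smult_right dims)
      then show "G l * (adj (G l) * (X * F)) \<in> Q" using Q(4) GQ l by simp
    qed auto
    then show "msum m (dim_col (X * F)) (\<lambda>l. G l * (adj (G l) * (X * F))) {..<r} \<in> Q"
      by (simp add: dims)
  qed
  then have F'Q: "F' \<in> Q"
  proof -
    assume *: "T * (X * F) \<in> Q"
    have "F' = F + (- 1) \<cdot>\<^sub>m (T * (X * F))" unfolding F'_def by (rule eq_matI) (auto simp: dims)
    with * FQ Q(3,4) show ?thesis by simp
  qed
  have GXF': "adj (G l) * (X * F') = 0\<^sub>m d d" if "l < r" for l
    using that by (simp add: F'_def mult_minus_right dims GXT) (rule eq_matI, auto simp: dims)
  have TXF': "T * (X * F') = 0\<^sub>m m d"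
  proof -
    have "T * (X * F') = msum m d (\<lambda>l. G l * (adj (G l) * (X * F'))) {..<r}"
      by (subst TA) (simp_all add: dims)
    also have "\<dots> = msum m d (\<lambda>l. 0\<^sub>m m d) {..<r}"
      by (rule msum_cong) (simp_all add: GXF' dims)
    finally show ?thesis by simp
  qed
  have F'XTA: "adj F' * (X * (T * A)) = 0\<^sub>m d (dim_col A)" if "dim_row A = m" for A
  proof -
    have "adj F' * (X * (T * A)) = adj (T * (X * F')) * A"
      using that by (simp add: adj_mult adjX adjT dims mult_assoc_dim)
    then show ?thesis using that by (simp add: TXF')
  qed
  have F_eq: "F = F' + T * (X * F)"
    unfolding F'_def by (rule eq_matI) (auto simp: dims)
  obtain c where c: "adj F' * (X * F') = c \<cdot>\<^sub>m 1\<^sub>m d" using form[OF F'Q F'Q] by blast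
  \<comment> \<open>The entry \<open>(0, 0)\<close> exists because \<open>d\<close> is at least
    1.\<close>
  have cnn: "0 \<le> c"
    using index_diag_nonneg[OF X F'C, of 0] d by (simp add: c)
  show ?case
  proof (cases "c = 0")
    \<comment> \<open>A null residual is annihilated by \<open>X\<close>, so the old family already
      reproduces \<open>F\<close>.\<close>
    case True
    then have "X * F' = 0\<^sub>m m d"
      using c by (intro positive_operator_mult_zero[OF X F'C]) auto
    moreover have "X * F' = X * F - X * (T * (X * F))"
      by (simp add: F'_def mult_minus_right dims)
    ultimately have 0: "X * F - X * (T * (X * F)) = 0\<^sub>m m d" by simp
    have "X * (T * (X * F)) = X * F"
    proof (rule eq_matI, goal_cases)
      case (1 i j)
      then have "(X * F - X * (T * (X * F))) $$ (i, j) = 0" unfolding 0 by (simp add: dims)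
      with 1 show ?case by simp
    qed (auto simp: dims)
    then have "\<forall>A\<in>insert F \<F>. X * (T * (X * A)) = X * A"
      using span by (simp add: T_def)
    then show ?thesis
      unfolding T_def by (intro exI[of _ r] exI[of _ G] conjI allI impI) (simp_all add: GQ orth)
  next
    case False
    define s where "s = complex_of_real (sqrt (Re c))"
    have ss: "s * s = c"
      using cnn by (simp add: s_def complex_nonneg_iff complex_eq_iff)
    have s: "s \<noteq> 0" using False ss by auto
    have cs: "cnj s = s" by (simp add: s_def)
    define H where "H = (1 / s) \<cdot>\<^sub>m F'"
    have HC: "H \<in> carrier_mat m d" using F'C by (simp add: H_def)
    note dims = dims carrier_matD[OF HC]
    have HQ: "H \<in> Q" using F'Q Q(4) by (simp add: H_def)
    have HXH: "adj H * (X * H) = 1\<^sub>m d"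
      using s cs by (simp add: H_def adj_smult mult_smult_left mult_smult_right dims c smult_smult_mat ss[symmetric])
    have GXH: "adj (G l) * (X * H) = 0\<^sub>m d d" if "l < r" for l
      using that by (simp add: H_def mult_smult_right dims GXF')
    have HXG: "adj H * (X * G l) = 0\<^sub>m d d" if "l < r" for l
    proof -
      have "adj H * (X * G l) = adj (adj (G l) * (X * H))"
        using that by (simp add: adj_mult adjX dims mult_assoc_dim)
      then show ?thesis using that by (simp add: GXH)
    qed
    have HXTA: "adj H * (X * (T * A)) = 0\<^sub>m d (dim_col A)" if "dim_row A = m" for A
      using that by (simp add: H_def adj_smult mult_smult_left dims F'XTA)
    define G' where "G' = G(r := H)"
    have T': "msum m m (\<lambda>l. G' l * adj (G' l)) {..<Suc r} = H * adj H + T"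
    proof -
      have "msum m m (\<lambda>l. G' l * adj (G' l)) {..<r} = T"
        unfolding T_def by (rule msum_cong) (auto simp: G'_def)
      moreover have "msum m m (\<lambda>l. G' l * adj (G' l)) (insert r {..<r}) =
          G' r * adj (G' r) + msum m m (\<lambda>l. G' l * adj (G' l)) {..<r}"
        by (rule msum_insert) (auto simp: G'_def dims intro!: carrier_matI)
      ultimately show ?thesis by (simp add: lessThan_Suc G'_def)
    qed
    have T'A: "X * ((H * adj H + T) * (X * A)) = X * (H * (adj H * (X * A))) + X * (T * (X * A))"
      if "A \<in> carrier_mat m d" for A
    proof -
      have "(H * adj H + T) * (X * A) = H * adj H * (X * A) + T * (X * A)"
        using that HC TC XC by (intro add_mult_distrib_mat[of _ m m _ _ d]) auto
      moreover have "X * (H * adj H * (X * A) + T * (X * A)) = X * (H * adj H * (X * A)) + X * (T * (X * A))"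
        using that HC TC XC by (intro mult_add_distrib_mat[of _ m m _ d]) auto
      ultimately show ?thesis
        using that by (simp add: mult_assoc_dim dims carrier_matD[OF that])
    qed
    \<comment> \<open>For \<open>A = F\<close> the new summand supplies exactly the residual. For an
      earlier \<open>A\<close> it contributes nothing: \<open>X * A\<close> equals
      \<open>X * (T * (X * A))\<close>, and \<open>adj H * (X * T)\<close> vanishes.\<close>
    have "X * ((H * adj H + T) * (X * A)) = X * A" if A: "A \<in> insert F \<F>" for A
    proof (cases "A = F")
      case True
      have "X * F = X * F' + X * (T * (X * F))"
        by (subst F_eq, rule mult_add_distrib_mat[of _ m m _ d]) (use F'C XC TC FC in auto)
      then have "adj H * (X * F) = adj H * (X * F')"
        using mult_add_distrib_mat[of "adj H" d m "X * F'" d "X * (T * (X * F))"]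
          F'C XC TC FC HC by (simp add: HXTA dims)
      also have "\<dots> = s \<cdot>\<^sub>m 1\<^sub>m d"
        using s cs by (simp add: H_def adj_smult mult_smult_left dims c smult_smult_mat ss[symmetric])
      finally have "H * (adj H * (X * F)) = F'"
        using s by (simp add: mult_smult_right dims) (simp add: H_def smult_smult_mat)
      with True \<open>X * F = X * F' + X * (T * (X * F))\<close> show ?thesis by (simp add: T'A[OF FC])
    next
      case False
      with A have AF: "A \<in> \<F>" by simp
      then have AC: "A \<in> carrier_mat m d" using FsQ Q(2) by auto
      have XA: "X * (T * (X * A)) = X * A" using span[OF AF] by (simp add: T_def)
      have "adj H * (X * A) = 0\<^sub>m d d"
        using HXTA[of "X * A"] AC by (simp add: XA dims)
      with XA show ?thesis by (simp add: T'A[OF AC] dims carrier_matD[OF AC])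
    qed
    moreover have "\<forall>k<Suc r. \<forall>l<Suc r. adj (G' k) * (X * G' l) = (if k = l then 1\<^sub>m d else 0\<^sub>m d d)"
      by (simp add: G'_def less_Suc_eq orth GXH HXG HXH)
    moreover have "\<forall>l<Suc r. G' l \<in> Q" using GQ HQ by (auto simp: G'_def less_Suc_eq)
    ultimately show ?thesis
      unfolding T'[symmetric] by (intro exI[of _ "Suc r"] exI[of _ G'] conjI ballI) simp_all
  qed
qed

section \<open>Kraus representations\<close>

lemma mat_hom_iff:
  "f \<in> LinearCombinations.module_hom class_ring (cmat_space n) (cmat_space m) \<longleftrightarrow>
    (\<forall>X\<in>carrier_mat n n. f X \<in> carrier_mat m m) \<and>
    (\<forall>X\<in>carrier_mat n n. \<forall>Y\<in>carrier_mat n n. f (X + Y) = f X + f Y) \<and>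
    (\<forall>c. \<forall>X\<in>carrier_mat n n. f (c \<cdot>\<^sub>m X) = c \<cdot>\<^sub>m f X)"
  by (auto simp: LinearCombinations.module_hom_def module_mat_simps class_ring_simps Pi_def)

lemma mat_hom_msum:
  assumes f: "f \<in> LinearCombinations.module_hom class_ring (cmat_space n) (cmat_space m)"
    and "finite I" "\<And>i. i \<in> I \<Longrightarrow> h i \<in> carrier_mat n n"
  shows "f (msum n n h I) = msum m m (\<lambda>i. f (h i)) I"
  using assms(2,3)
proof (induction I rule: finite_induct)
  case empty
  have "f (0 \<cdot>\<^sub>m 0\<^sub>m n n) = 0 \<cdot>\<^sub>m f (0\<^sub>m n n)" and "f (0\<^sub>m n n) \<in> carrier_mat m m"
    using f unfolding mat_hom_iff by (blast intro: zero_carrier_mat)+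
  then show ?case by simp
next
  case (insert x I)
  then show ?case
    using f by (simp add: mat_hom_iff msum_insert)
qed

lemma mat_hom_eqI:
  assumes f: "f \<in> LinearCombinations.module_hom class_ring (cmat_space n) (cmat_space m)"
    and g: "g \<in> LinearCombinations.module_hom class_ring (cmat_space n) (cmat_space m)"
    and eq: "\<And>i j. i < n \<Longrightarrow> j < n \<Longrightarrow> f (munit n i j) = g (munit n i j)"
    and X: "X \<in> carrier_mat n n"
  shows "f X = g X"
proof -
  have *: "h X = msum m m (\<lambda>p. case p of (i, j) \<Rightarrow> X $$ (i, j) \<cdot>\<^sub>m h (munit n i j)) ({..<n} \<times> {..<n})"
    if h: "h \<in> LinearCombinations.module_hom class_ring (cmat_space n) (cmat_space m)" for h
  proof -
    have "h X = h (msum n n (\<lambda>(i, j). X $$ (i, j) \<cdot>\<^sub>m munit n i j) ({..<n} \<times> {..<n}))"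
      using mat_munit_expansion[OF X] by simp
    also have "\<dots> = msum m m (\<lambda>p. h (case p of (i, j) \<Rightarrow> X $$ (i, j) \<cdot>\<^sub>m munit n i j)) ({..<n} \<times> {..<n})"
      by (rule mat_hom_msum[OF h]) auto
    also have "\<dots> = msum m m (\<lambda>p. case p of (i, j) \<Rightarrow> X $$ (i, j) \<cdot>\<^sub>m h (munit n i j)) ({..<n} \<times> {..<n})"
      using h by (intro msum_cong) (auto simp: mat_hom_iff)
    finally show ?thesis .
  qed
  show ?thesis
    unfolding *[OF f] *[OF g] using eq by (intro msum_cong) auto
qed

text \<open>The index type is left free: a composition is indexed by pairs, and the decoder by a
  dependent sum.\<close>

definition kraus_map :: "nat \<Rightarrow> ('i \<Rightarrow> complex mat) \<Rightarrow> 'i set \<Rightarrow> complex mat \<Rightarrow> complex mat" where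
  "kraus_map m K I X = msum m m (\<lambda>i. K i * (X * adj (K i))) I"

lemma kraus_map_carrier [simp]: "kraus_map m K I X \<in> carrier_mat m m"
  by (simp add: kraus_map_def)

lemma kraus_map_hom:
  assumes K: "K \<in> I \<rightarrow> carrier_mat m n"
  shows "kraus_map m K I \<in> LinearCombinations.module_hom class_ring (cmat_space n) (cmat_space m)"
  unfolding mat_hom_iff
proof (intro conjI ballI allI)
  note dims = carrier_matD[OF funcset_mem[OF K]]
  fix X Y :: "complex mat" assume X: "X \<in> carrier_mat n n" and Y: "Y \<in> carrier_mat n n"
  have C: "(\<lambda>i. K i * (Z * adj (K i))) \<in> I \<rightarrow> carrier_mat m m" if "Z \<in> carrier_mat n n" for Z
    using that by (intro funcsetI carrier_matI) (simp_all add: dims)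
  show "kraus_map m K I (X + Y) = kraus_map m K I X + kraus_map m K I Y"
    unfolding kraus_map_def msum_add[OF C[OF X] C[OF Y], symmetric]
  proof (rule msum_cong, rule refl)
    fix i assume i: "i \<in> I"
    have "(X + Y) * adj (K i) = X * adj (K i) + Y * adj (K i)"
      using X Y funcset_mem[OF K i] by (intro add_mult_distrib_mat) auto
    moreover have "K i * (X * adj (K i) + Y * adj (K i)) = K i * (X * adj (K i)) + K i * (Y * adj (K i))"
      using X Y funcset_mem[OF K i] by (intro mult_add_distrib_mat[of _ m n _ m]) auto
    ultimately show "K i * ((X + Y) * adj (K i)) = K i * (X * adj (K i)) + K i * (Y * adj (K i))" by simp
  qed
  show "kraus_map m K I (c \<cdot>\<^sub>m X) = c \<cdot>\<^sub>m kraus_map m K I X" for c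
    unfolding kraus_map_def smult_msum[OF C[OF X]]
    using X by (intro msum_cong) (simp_all add: mult_smult_left mult_smult_right dims)
qed auto

lemma mat_trace_msum_eq:
  assumes "f \<in> I \<rightarrow> carrier_mat n n"
  shows "mat_trace (msum n n f I) = (\<Sum>i\<in>I. mat_trace (f i))"
  unfolding mat_trace_msum using assms by (intro sum.cong) (auto simp: mat_trace_def)

text \<open>Cyclicity of the trace, term by term. The sum on the right is the Heisenberg picture,
  from which the adjoint map and the criterion for trace preservation are read off.\<close>

lemma mat_trace_mult_kraus_map:
  assumes K: "K \<in> I \<rightarrow> carrier_mat m n"
    and X: "X \<in> carrier_mat n n" and Y: "Y \<in> carrier_mat m m"
  shows "mat_trace (Y * kraus_map m K I X) = mat_trace (msum n n (\<lambda>i. adj (K i) * (Y * K i)) I * X)"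
proof -
  note dims = carrier_matD[OF funcset_mem[OF K]] carrier_matD[OF X] carrier_matD[OF Y]
  have C: "(\<lambda>i. K i * (X * adj (K i))) \<in> I \<rightarrow> carrier_mat m m"
    "(\<lambda>i. adj (K i) * (Y * K i)) \<in> I \<rightarrow> carrier_mat n n"
    "(\<lambda>i. Y * (K i * (X * adj (K i)))) \<in> I \<rightarrow> carrier_mat m m"
    "(\<lambda>i. adj (K i) * (Y * K i) * X) \<in> I \<rightarrow> carrier_mat n n"
    by (intro funcsetI carrier_matI; simp add: dims)+
  have "mat_trace (Y * kraus_map m K I X) = (\<Sum>i\<in>I. mat_trace (Y * (K i * (X * adj (K i)))))"
    unfolding kraus_map_def mult_msum_right[OF carrier_matD(2)[OF Y] C(1)]
    by (simp add: dims mat_trace_msum_eq[OF C(3)])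
  also have "\<dots> = (\<Sum>i\<in>I. mat_trace (adj (K i) * (Y * K i) * X))"
  proof (rule sum.cong, rule refl)
    fix i assume i: "i \<in> I"
    have "mat_trace ((Y * (K i * X)) * adj (K i)) = mat_trace (adj (K i) * (Y * (K i * X)))"
      using i by (intro mat_trace_mult_commute[of _ m n] carrier_matI) (simp_all add: dims)
    then show "mat_trace (Y * (K i * (X * adj (K i)))) = mat_trace (adj (K i) * (Y * K i) * X)"
      using i by (simp add: mult_assoc_dim dims)
  qed
  also have "\<dots> = mat_trace (msum n n (\<lambda>i. adj (K i) * (Y * K i)) I * X)"
    unfolding mult_msum_left[OF carrier_matD(1)[OF X] C(2)]
    by (simp add: dims mat_trace_msum_eq[OF C(4)])
  finally show ?thesis .
qed

lemma adjoint_map_kraus: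
  assumes K: "K \<in> I \<rightarrow> carrier_mat m n"
    and \<Phi>: "\<And>X. X \<in> carrier_mat n n \<Longrightarrow> \<Phi> X = kraus_map m K I X"
    and Y: "Y \<in> carrier_mat m m"
  shows "adjoint_map n m \<Phi> Y = msum n n (\<lambda>i. adj (K i) * (Y * K i)) I"
  unfolding adjoint_map_def
proof (rule the_equality)
  show "msum n n (\<lambda>i. adj (K i) * (Y * K i)) I \<in> carrier_mat n n \<and>
    (\<forall>X\<in>carrier_mat n n. mat_trace (Y * \<Phi> X) = mat_trace (msum n n (\<lambda>i. adj (K i) * (Y * K i)) I * X))"
    using mat_trace_mult_kraus_map[OF K _ Y] by (simp add: \<Phi>)
next
  fix Z assume Z: "Z \<in> carrier_mat n n \<and> (\<forall>X\<in>carrier_mat n n. mat_trace (Y * \<Phi> X) = mat_trace (Z * X))"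
  then show "Z = msum n n (\<lambda>i. adj (K i) * (Y * K i)) I"
    using mat_trace_mult_kraus_map[OF K _ Y] by (intro mat_eqI_trace[of _ n]) (auto simp: \<Phi>)
qed

text \<open>The duality at the identity turns the trace of the image into a trace against the sum of
  the \<open>adj (K i) * K i\<close>; nondegeneracy does the rest.\<close>

lemma trace_preserving_kraus:
  assumes K: "K \<in> I \<rightarrow> carrier_mat m n"
  shows "(\<forall>X\<in>carrier_mat n n. mat_trace (kraus_map m K I X) = mat_trace X) \<longleftrightarrow>
    msum n n (\<lambda>i. adj (K i) * K i) I = 1\<^sub>m n"
proof -
  have 1: "msum n n (\<lambda>i. adj (K i) * (1\<^sub>m m * K i)) I = msum n n (\<lambda>i. adj (K i) * K i) I"
    by (rule msum_cong) (auto simp: carrier_matD[OF funcset_mem[OF K]])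
  have 2: "mat_trace (kraus_map m K I X) = mat_trace (msum n n (\<lambda>i. adj (K i) * K i) I * X)"
    if "X \<in> carrier_mat n n" for X
    using mat_trace_mult_kraus_map[OF K that one_carrier_mat] by (simp add: 1 kraus_map_def)
  show ?thesis
  proof
    assume "\<forall>X\<in>carrier_mat n n. mat_trace (kraus_map m K I X) = mat_trace X"
    then show "msum n n (\<lambda>i. adj (K i) * K i) I = 1\<^sub>m n"
      by (intro mat_eqI_trace[of _ n]) (auto simp: 2[symmetric])
  qed (auto simp: 2)
qed

section \<open>Positivity of conjugations, sums and ampliations\<close>

lemma positive_operator_iff:
  "positive_operator n X \<longleftrightarrow> X \<in> carrier_mat n n \<and>
    (\<forall>F\<in>carrier_mat n 1. 0 \<le> (adj F * (X * F)) $$ (0, 0))"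
proof (intro iffI conjI ballI)
  assume "positive_operator n X"
  then show "X \<in> carrier_mat n n" and "\<And>F. F \<in> carrier_mat n 1 \<Longrightarrow> 0 \<le> (adj F * (X * F)) $$ (0, 0)"
    using index_diag_nonneg[of n X _ 1 0] by auto
next
  assume *: "X \<in> carrier_mat n n \<and> (\<forall>F\<in>carrier_mat n 1. 0 \<le> (adj F * (X * F)) $$ (0, 0))"
  show "positive_operator n X"
    unfolding positive_operator_def
  proof (intro conjI ballI)
    fix v :: "complex vec" assume v: "v \<in> carrier_vec n"
    define F where "F = mat n 1 (\<lambda>(i, j). v $ i)"
    have F: "F \<in> carrier_mat n 1" and "col F 0 = v" using v by (auto simp: F_def)
    with * show "0 \<le> (X *\<^sub>v v) \<bullet>c v"
      using index_adj_mult_mult[of X n F 1 F 1 0 0] by auto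
  qed (use * in simp)
qed

lemma positive_operator_conjugate:
  assumes X: "positive_operator n X" and B: "B \<in> carrier_mat m n"
  shows "positive_operator m (B * (X * adj B))"
  unfolding positive_operator_iff
proof (intro conjI ballI)
  have XC: "X \<in> carrier_mat n n" using X by simp
  note dims = carrier_matD[OF B] carrier_matD[OF XC]
  show "B * (X * adj B) \<in> carrier_mat m m" by (intro carrier_matI) (simp_all add: dims)
  fix F :: "complex mat" assume F: "F \<in> carrier_mat m 1"
  have "adj F * (B * (X * adj B) * F) = adj (adj B * F) * (X * (adj B * F))"
    by (simp add: adj_mult mult_assoc_dim dims carrier_matD[OF F])
  moreover have "adj B * F \<in> carrier_mat n 1" by (intro carrier_matI) (simp_all add: dims carrier_matD[OF F])
  ultimately show "0 \<le> (adj F * (B * (X * adj B) * F)) $$ (0, 0)"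
    using X by (simp add: positive_operator_iff)
qed

lemma positive_operator_msum:
  assumes f: "\<And>i. i \<in> I \<Longrightarrow> positive_operator n (f i)"
  shows "positive_operator n (msum n n f I)"
  unfolding positive_operator_iff
proof (intro conjI ballI)
  fix F :: "complex mat" assume F: "F \<in> carrier_mat n 1"
  have f': "f \<in> I \<rightarrow> carrier_mat n n" using f by (auto simp: positive_operator_def)
  have C: "(\<lambda>i. f i * F) \<in> I \<rightarrow> carrier_mat n 1"
    by (intro funcsetI carrier_matI)
      (simp_all add: carrier_matD[OF F] carrier_matD[OF funcset_mem[OF f']])
  have "adj F * (msum n n f I * F) = msum 1 1 (\<lambda>i. adj F * (f i * F)) I"
    using F mult_msum_right[OF _ C, of "adj F"] by (simp add: mult_msum_left[OF _ f'] carrier_matD[OF F])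
  then show "0 \<le> (adj F * (msum n n f I * F)) $$ (0, 0)"
    using f F by (auto simp: positive_operator_iff intro!: sum_nonneg)
qed simp

text \<open>The indices below \<open>r * n\<close> with quotient \<open>i\<close> form one block,
  parametrised by the remainder.\<close>

lemma sum_div_eq:
  fixes f :: "nat \<Rightarrow> 'a::comm_monoid_add"
  assumes "i < r"
  shows "(\<Sum>s<r * n. if i = s div n then f s else 0) = (\<Sum>a<n. f (i * n + a))"
proof -
  have *: "i * n + a < r * n" if "a < n" for a
  proof -
    have "i * n + a < Suc i * n" using that by simp
    also have "\<dots> \<le> r * n" using assms by (intro mult_le_mono1) simp
    finally show ?thesis .
  qed
  have "(\<Sum>s<r * n. if i = s div n then f s else 0) = (\<Sum>s\<in>{s\<in>{..<r * n}. i = s div n}. f s)"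
    by (rule sum.inter_filter[symmetric]) simp
  also have "\<dots> = (\<Sum>a<n. f (i * n + a))"
    by (rule sum.reindex_bij_witness[of _ "\<lambda>a. i * n + a" "\<lambda>s. s mod n"])
      (auto simp: * intro!: mod_less_divisor intro: Nat.gr0I)
  finally show ?thesis .
qed

text \<open>This is the tensor product of the identity of size \<open>r\<close> with
  \<open>K\<close>, in the index convention of \<open>ampliation\<close>.\<close>

definition ampl_mat :: "nat \<Rightarrow> nat \<Rightarrow> nat \<Rightarrow> complex mat \<Rightarrow> complex mat" where
  "ampl_mat r n m K = mat (r * m) (r * n)
    (\<lambda>(p, q). if p div m = q div n then K $$ (p mod m, q mod n) else 0)"

lemma ampl_mat_carrier [simp]: "ampl_mat r n m K \<in> carrier_mat (r * m) (r * n)"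
  by (simp add: ampl_mat_def)

lemma index_ampl_conjugate:
  assumes K: "K \<in> carrier_mat m n" and X: "X \<in> carrier_mat (r * n) (r * n)"
    and p: "p < r * m" and q: "q < r * m"
  shows "(ampl_mat r n m K * (X * adj (ampl_mat r n m K))) $$ (p, q) =
    (K * (block n X (p div m) (q div m) * adj K)) $$ (p mod m, q mod m)"
proof -
  have m: "m > 0" using p by (cases m) auto
  define i j where "i = p div m" and "j = q div m"
  have ij: "i < r" "j < r" using p q by (auto simp: i_def j_def less_mult_imp_div_less)
  have pq: "p mod m < m" "q mod m < m" using m by auto
  let ?B = "ampl_mat r n m K"
  have "(?B * (X * adj ?B)) $$ (p, q) = (\<Sum>s<r * n. ?B $$ (p, s) * (\<Sum>t<r * n. X $$ (s, t) * cnj (?B $$ (q, t))))"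
    using X p q carrier_matD[OF ampl_mat_carrier[of r n m K]]
    by (simp add: index_mult_sum cong: sum.cong_simp)
  also have "\<dots> = (\<Sum>s<r * n. if i = s div n then K $$ (p mod m, s mod n) *
      (\<Sum>t<r * n. if j = t div n then X $$ (s, t) * cnj (K $$ (q mod m, t mod n)) else 0) else 0)"
    using p q by (intro sum.cong refl) (auto simp: ampl_mat_def i_def j_def intro!: sum.cong)
  also have "\<dots> = (\<Sum>a<n. K $$ (p mod m, a) * (\<Sum>b<n. X $$ (i * n + a, j * n + b) * cnj (K $$ (q mod m, b))))"
    by (simp add: sum_div_eq ij cong: sum.cong_simp)
  also have "\<dots> = (K * (block n X i j * adj K)) $$ (p mod m, q mod m)"
    using K pq by (simp add: index_mult_sum block_def cong: sum.cong_simp)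
  finally show ?thesis by (simp add: i_def j_def)
qed

section \<open>Correctable algebras\<close>

text \<open>The ampliation is again a sum of conjugations, by the amplified Kraus operators, and
  conjugations and sums preserve positivity.\<close>

lemma kraus_map_completely_positive:
  assumes K: "K \<in> I \<rightarrow> carrier_mat m n"
  shows "completely_positive n m (kraus_map m K I)"
  unfolding completely_positive_def
proof (intro allI impI)
  fix r X assume X: "positive_operator (r * n) X"
  then have XC: "X \<in> carrier_mat (r * n) (r * n)" by simp
  have "ampliation r n m (kraus_map m K I) X =
      msum (r * m) (r * m) (\<lambda>l. ampl_mat r n m (K l) * (X * adj (ampl_mat r n m (K l)))) I"
  proof (rule eq_matI, goal_cases)
    case (1 p q)
    then have "p mod m < m" "q mod m < m" by (auto intro!: mod_less_divisor intro: Nat.gr0I)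
    with 1 show ?case
      using index_ampl_conjugate[OF funcset_mem[OF K] XC]
      by (simp add: ampliation_def kraus_map_def cong: sum.cong_simp)
  qed (auto simp: ampliation_def)
  then show "positive_operator (r * m) (ampliation r n m (kraus_map m K I) X)"
    by (simp add: positive_operator_msum positive_operator_conjugate[OF X])
qed

lemma kraus_map_channel:
  assumes K: "K \<in> I \<rightarrow> carrier_mat m n"
    and "msum n n (\<lambda>i. adj (K i) * K i) I = 1\<^sub>m n"
  shows "quantum_channel n m (kraus_map m K I)"
  unfolding quantum_channel_def
  using kraus_map_hom[OF K] kraus_map_completely_positive[OF K] trace_preserving_kraus[OF K] assms(2)
  by blast

section \<open>The Choi matrix and the existence of Kraus operators\<close>

definition unit_col :: "nat \<Rightarrow> nat \<Rightarrow> complex mat" where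
  "unit_col n p = mat n 1 (\<lambda>(a, b). if a = p then 1 else 0)"

lemma unit_col_carrier [simp]: "unit_col n p \<in> carrier_mat n 1"
  by (simp add: unit_col_def)

lemma dim_unit_col [simp]: "dim_row (unit_col n p) = n" "dim_col (unit_col n p) = 1"
  by (simp_all add: unit_col_def)

lemma index_mult_unit_col:
  assumes "dim_col A = n" "a < dim_row A" "p < n"
  shows "(A * unit_col n p) $$ (a, 0) = A $$ (a, p)"
proof -
  have "(A * unit_col n p) $$ (a, 0) = (\<Sum>k<n. if k = p then A $$ (a, k) else 0)"
    using assms unfolding unit_col_def
    by (auto simp: index_mult_sum intro!: sum.cong simp del: sum.delta sum.delta')
  with assms show ?thesis by simp
qed

lemma mat_eqI_unit_col:
  assumes "A \<in> carrier_mat m n" "B \<in> carrier_mat m n"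
    and eq: "\<And>p. p < n \<Longrightarrow> A * unit_col n p = B * unit_col n p"
  shows "A = B"
proof (rule eq_matI)
  fix a p assume "a < dim_row B" "p < dim_col B"
  then show "A $$ (a, p) = B $$ (a, p)"
    using assms index_mult_unit_col[of A n a p] index_mult_unit_col[of B n a p] by auto
qed (use assms in auto)

text \<open>Stands in for the spectral theorem. Orthonormalising the standard basis in the form of
  \<open>J\<close> gives \<open>T\<close> with \<open>J * (T * J) = J\<close>, and expanding
  \<open>T\<close> splits \<open>J\<close> into the terms built from the columns
  \<open>J * G l\<close>.\<close>

lemma positive_operator_decomposition:
  assumes J: "positive_operator n J"
  shows "\<exists>(r :: nat) g. (\<forall>l<r. g l \<in> carrier_mat n 1) \<and> J = msum n n (\<lambda>l. g l * adj (g l)) {..<r}"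
proof -
  have JC: "J \<in> carrier_mat n n" using J by simp
  have "\<exists>(r :: nat) G. (\<forall>l<r. G l \<in> carrier_mat n 1) \<and>
    (\<forall>k<r. \<forall>l<r. adj (G k) * (J * G l) = (if k = l then 1\<^sub>m 1 else 0\<^sub>m 1 1)) \<and>
    (\<forall>F\<in>unit_col n ` {..<n}. J * (msum n n (\<lambda>l. G l * adj (G l)) {..<r} * (J * F)) = J * F)"
  proof (rule matrix_gram_schmidt[OF J])
    fix A B :: "complex mat" assume AB: "A \<in> carrier_mat n 1" "B \<in> carrier_mat n 1"
    have "adj A * (J * B) = (adj A * (J * B)) $$ (0, 0) \<cdot>\<^sub>m 1\<^sub>m 1"
      using AB JC by (intro eq_matI) auto
    then show "\<exists>c. adj A * (J * B) = c \<cdot>\<^sub>m 1\<^sub>m 1" by blast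
  qed auto
  then obtain r :: nat and G where G: "\<And>l. l < r \<Longrightarrow> G l \<in> carrier_mat n 1"
    and span: "\<And>p. p < n \<Longrightarrow> J * (msum n n (\<lambda>l. G l * adj (G l)) {..<r} * (J * unit_col n p)) = J * unit_col n p"
    unfolding ball_simps by blast
  define T where "T = msum n n (\<lambda>l. G l * adj (G l)) {..<r}"
  have TC: "T \<in> carrier_mat n n" by (simp add: T_def)
  note dims = carrier_matD[OF JC] carrier_matD[OF G] carrier_matD[OF TC]
  have JTJ: "J * (T * J) = J"
  proof (rule mat_eqI_unit_col[of _ n n])
    show "J * (T * J) * unit_col n p = J * unit_col n p" if "p < n" for p
      using span[OF that] by (simp add: mult_assoc_dim dims T_def)
  qed (use JC TC in auto)
  have C: "(\<lambda>l. G l * adj (G l)) \<in> {..<r} \<rightarrow> carrier_mat n n"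
    "(\<lambda>l. G l * (adj (G l) * J)) \<in> {..<r} \<rightarrow> carrier_mat n n"
    by (intro funcsetI carrier_matI; simp add: dims)+
  have "T * J = msum n n (\<lambda>l. G l * (adj (G l) * J)) {..<r}"
    using mult_msum_left[OF _ C(1), where A = J] 
    by (auto simp: T_def dims mult_assoc_dim intro!: msum_cong)
  then have "J * (T * J) = msum n n (\<lambda>l. J * (G l * (adj (G l) * J))) {..<r}"
    using mult_msum_right[OF _ C(2), of J] by (simp add: dims)
  also have "\<dots> = msum n n (\<lambda>l. (J * G l) * adj (J * G l)) {..<r}"
    using positive_operator_adj[OF J] by (intro msum_cong) (simp_all add: adj_mult mult_assoc_dim dims)
  finally show ?thesis
    unfolding JTJ using JC G
    by (intro exI[of _ r] exI[of _ "\<lambda>l. J * G l"] conjI allI impI mult_carrier_mat[of _ n n]) auto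
qed

text \<open>The blocks of the Choi matrix \<open>J\<close> are the values of \<open>\<Phi>\<close> at the matrix units.\<close>

lemma kraus_representation_exists:
  assumes \<Phi>: "quantum_channel n m \<Phi>"
  shows "\<exists>(r :: nat) K. (\<forall>l<r. K l \<in> carrier_mat m n) \<and>
    (\<forall>X\<in>carrier_mat n n. \<Phi> X = kraus_map m K {..<r} X)"
proof -
  have hom: "\<Phi> \<in> LinearCombinations.module_hom class_ring (cmat_space n) (cmat_space m)"
    and cp: "completely_positive n m \<Phi>" using \<Phi> by (auto simp: quantum_channel_def)
  \<comment> \<open>The unnormalised maximally entangled vector, the sum of all
    \<open>e_i \<otimes> e_i\<close>: the index \<open>i * n + a\<close> has \<open>i = a\<close>
    exactly if quotient and remainder agree. Hence the blocks of \<open>\<Omega>\<close> are the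
    matrix units.\<close>
  define w :: "complex mat" where "w = mat (n * n) 1 (\<lambda>(p, _). if p div n = p mod n then 1 else 0)"
  have wC: "w \<in> carrier_mat (n * n) 1" by (simp add: w_def)
  define \<Omega> where "\<Omega> = w * (1\<^sub>m 1 * adj w)"
  have pos: "positive_operator (n * n) \<Omega>"
    unfolding \<Omega>_def by (rule positive_operator_conjugate[OF positive_operator_one wC])
  have lt: "i * k + a < l * k" if "i < l" "a < k" for i a l k :: nat
  proof -
    have "i * k + a < Suc i * k" using that by simp
    also have "\<dots> \<le> l * k" using that by (intro mult_le_mono1) simp
    finally show ?thesis .
  qed
  have block: "block n \<Omega> i j = munit n i j" if "i < n" "j < n" for i j
  proof (rule eq_matI)
    fix a b assume "a < dim_row (munit n i j)" "b < dim_col (munit n i j)"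
    then have "a < n" "b < n" by auto
    with that show "block n \<Omega> i j $$ (a, b) = munit n i j $$ (a, b)"
      by (auto simp: block_def \<Omega>_def index_mult_sum w_def lt)
  qed (auto simp: block_def)
  define J where "J = ampliation n n m \<Phi> \<Omega>"
  have "positive_operator (n * m) J"
    using cp pos by (simp add: completely_positive_def J_def)
  then obtain r :: nat and g where g: "\<And>l. l < r \<Longrightarrow> g l \<in> carrier_mat (n * m) 1"
    and Jg: "J = msum (n * m) (n * m) (\<lambda>l. g l * adj (g l)) {..<r}"
    using positive_operator_decomposition by blast
  \<comment> \<open>A column of length \<open>n * m\<close> is folded into a matrix, its
    \<open>i\<close>-th segment of length \<open>m\<close> becoming the \<open>i\<close>-th
    column.\<close>
  define K where "K l = mat m n (\<lambda>(a, i). g l $$ (i * m + a, 0))" for l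
  have K: "K l \<in> carrier_mat m n" for l by (simp add: K_def)
  have units: "\<Phi> (munit n i j) = kraus_map m K {..<r} (munit n i j)" if ij: "i < n" "j < n" for i j
  proof (rule eq_matI)
    fix a b assume "a < dim_row (kraus_map m K {..<r} (munit n i j))"
      "b < dim_col (kraus_map m K {..<r} (munit n i j))"
    then have ab: "a < m" "b < m" by (auto simp: kraus_map_def)
    have lts: "i * m + a < n * m" "j * m + b < n * m" using ij ab lt by auto
    have "J $$ (i * m + a, j * m + b) = \<Phi> (munit n i j) $$ (a, b)"
      using ij ab lts by (simp add: J_def ampliation_def block)
    moreover have "J $$ (i * m + a, j * m + b) = (\<Sum>l<r. K l $$ (a, i) * cnj (K l $$ (b, j)))"
      using ij ab lts unfolding Jg
      by (simp add: index_mult_sum carrier_matD[OF g] K_def cong: sum.cong_simp)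
    moreover have "(K l * (munit n i j * adj (K l))) $$ (a, b) = K l $$ (a, i) * cnj (K l $$ (b, j))" for l
    proof -
      have "(munit n i j * adj (K l)) $$ (k, b) = (if k = i then cnj (K l $$ (b, j)) else 0)" if "k < n" for k
      proof -
        have "(munit n i j * adj (K l)) $$ (k, b) =
            (\<Sum>t<n. if t = j then if k = i then cnj (K l $$ (b, t)) else 0 else 0)"
          using that ab K[of l] by (auto simp: index_mult_sum intro!: sum.cong simp del: sum.delta sum.delta')
        with ij show ?thesis by simp
      qed
      then have "(K l * (munit n i j * adj (K l))) $$ (a, b) =
          (\<Sum>k<n. if k = i then K l $$ (a, k) * cnj (K l $$ (b, j)) else 0)"
        using ab K[of l] by (subst index_mult_sum) (auto intro!: sum.cong simp del: sum.delta sum.delta')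
      with ij show ?thesis by simp
    qed
    ultimately show "\<Phi> (munit n i j) $$ (a, b) = kraus_map m K {..<r} (munit n i j) $$ (a, b)"
      using ab by (simp add: kraus_map_def)
  qed (use hom in \<open>auto simp: mat_hom_iff kraus_map_def\<close>)
  have "\<Phi> X = kraus_map m K {..<r} X" if "X \<in> carrier_mat n n" for X
    using mat_hom_eqI[OF hom kraus_map_hom[of K "{..<r}" m n] units that] K by blast
  with K show ?thesis by blast
qed

section \<open>Isometries and codes\<close>

text \<open>\<open>adj W\<close> is a left inverse of \<open>W\<close>, so the kernel is zero and
  rank-nullity gives the dimension.\<close>

lemma
  assumes W: "W \<in> carrier_mat n k" and WW: "adj W * W = 1\<^sub>m k"
  shows isometry_range_subspace: "hilbert_subspace n (mat_range W)"
    and isometry_range_dim: "hilbert_dim n (mat_range W) = k"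
proof -
  define T where "T v = W *\<^sub>v v" for v
  have hom: "T \<in> LinearCombinations.module_hom class_ring (cvec_space k) (cvec_space n)"
    using W by (auto simp: T_def LinearCombinations.module_hom_def module_vec_simps class_ring_simps
        mult_add_distrib_mat_vec[of _ n k] mult_mat_vec[of _ n k])
  interpret T: linear_map "class_ring :: complex ring" "cvec_space k" "cvec_space n" T
    using hom by (intro linear_map.intro vec_vs mod_hom.intro mod_hom_axioms.intro
        vectorspace.axioms(1)[OF vec_vs])
  have left_inv: "adj W *\<^sub>v T v = v" if "v \<in> carrier_vec k" for v
    using assoc_mult_mat_vec[of "adj W" k n W k v] W that by (simp add: WW T_def)
  have inj: "inj_on T (carrier (cvec_space k))"
    by (rule inj_on_inverseI[of _ "\<lambda>v. adj W *\<^sub>v v"]) (simp add: left_inv module_vec_simps)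
  have im: "T.imT = mat_range W"
    using W by (auto simp: T.im_def mat_range_def T_def module_vec_simps)
  show "hilbert_subspace n (mat_range W)"
    using T.imT_is_subspace by (simp add: im)
  have "vectorspace.dim class_ring (cvec_space k) = k" "vectorspace.fin_dim class_ring (cvec_space k)"
    using vec_space.dim_is_n vec_space.fin_dim by auto
  then show "hilbert_dim n (mat_range W) = k"
    using T.rank_nullity T.inj_imp_dim_ker0[OF inj] by (simp add: im)
qed

text \<open>An idempotent fixes the vectors of its range, here the columns of
  \<open>A\<close>.\<close>

lemma mult_range_absorb:
  assumes P: "P \<in> carrier_mat n n" "P * P = P" and A: "A \<in> carrier_mat n k"
    and range: "mat_range A \<subseteq> mat_range P"
  shows "P * A = A"
proof (rule eq_matI)
  fix i j assume "i < dim_row A" "j < dim_col A"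
  then have ij: "i < n" "j < k" using A by auto
  have "col A j = A *\<^sub>v unit_vec k j" using A ij by (intro eq_vecI) auto
  then have "col A j \<in> mat_range A" using A by (auto simp: mat_range_def)
  with range obtain v where v: "v \<in> carrier_vec n" "col A j = P *\<^sub>v v"
    using P by (auto simp: mat_range_def)
  have "P *\<^sub>v col A j = col A j"
    using assoc_mult_mat_vec[OF P(1) P(1) v(1)] by (simp add: v(2) P(2))
  then have "(P *\<^sub>v col A j) $ i = A $$ (i, j)" using A ij by simp
  then show "(P * A) $$ (i, j) = A $$ (i, j)"
    using A P ij by (simp add: index_mult_mat)
qed (use P A in auto)

lemma mat_range_mult_subset:
  assumes "A \<in> carrier_mat n k" "B \<in> carrier_mat k l"
  shows "mat_range (A * B) \<subseteq> mat_range A"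
  using assms assoc_mult_mat_vec[OF assms] by (auto simp: mat_range_def)

text \<open>Two selfadjoint idempotents with the same range absorb each other, and taking adjoints
  identifies them.\<close>

lemma isometry_onto_projection:
  assumes V: "isometry_onto n k (mat_range P) V"
    and P: "P \<in> carrier_mat n n" "P * P = P" "adj P = P"
  shows "V * adj V = P"
proof -
  have VC: "V \<in> carrier_mat n k" and VV: "adj V * V = 1\<^sub>m k" and range: "mat_range V = mat_range P"
    using V by (auto simp: isometry_onto_def)
  note dims = carrier_matD[OF VC] carrier_matD[OF P(1)]
  have PV: "P * V = V"
    using range by (intro mult_range_absorb[OF P(1,2) VC]) simp
  have VVV: "V * adj V * V = V" by (simp add: mult_assoc_dim dims VV)
  have VVA: "adj V * (V * A) = A" if "dim_row A = k" for A
    using that by (simp add: mult_assoc_dim[symmetric] dims VV)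
  have "mat_range V \<subseteq> mat_range (V * adj V)"
    using mat_range_mult_subset[of "V * adj V" n n V k] VC by (simp add: VVV)
  then have "V * adj V * P = P"
    using VC range by (intro mult_range_absorb[OF _ _ P(1)]) (simp_all add: mult_assoc_dim dims VVA)
  then have "adj P = adj (V * (adj V * P))" by (simp add: mult_assoc_dim dims)
  also have "\<dots> = P * V * adj V" by (simp add: adj_mult dims P(3) mult_assoc_dim)
  finally show ?thesis by (simp add: PV P(3))
qed

definition cols_mat :: "nat \<Rightarrow> nat \<Rightarrow> (nat \<Rightarrow> complex mat) \<Rightarrow> complex mat" where
  "cols_mat n k g = mat n k (\<lambda>(i, a). g a $$ (i, 0))"

lemma cols_mat_carrier [simp]: "cols_mat n k g \<in> carrier_mat n k"
  by (simp add: cols_mat_def)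

text \<open>Turns conditions on families of vectors into one equation for their Gram matrix.\<close>

lemma index_cols_mat_form:
  assumes X: "X \<in> carrier_mat n n" and g: "g a \<in> carrier_mat n 1" and h: "h b \<in> carrier_mat n 1"
    and ab: "a < k" "b < l"
  shows "(adj (cols_mat n k g) * (X * cols_mat n l h)) $$ (a, b) = (adj (g a) * (X * h b)) $$ (0, 0)"
proof -
  note dims = carrier_matD[OF X] carrier_matD[OF g] carrier_matD[OF h]
    carrier_matD[OF cols_mat_carrier[of n k g]] carrier_matD[OF cols_mat_carrier[of n l h]]
  have "(X * cols_mat n l h) $$ (i, b) = (X * h b) $$ (i, 0)" if "i < n" for i
    using that ab by (simp add: index_mult_sum dims) (simp add: cols_mat_def)
  then show ?thesis
    using ab by (simp add: index_mult_sum dims cong: sum.cong_simp) (simp add: cols_mat_def)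
qed

lemma cols_mat_mult_adj:
  assumes g: "g \<in> {..<k} \<rightarrow> carrier_mat n 1"
  shows "cols_mat n k g * adj (cols_mat n k g) = msum n n (\<lambda>a. g a * adj (g a)) {..<k}"
proof (rule eq_matI, goal_cases)
  case (1 i j)
  then show ?case
    by (simp add: index_mult_sum carrier_matD[OF funcset_mem[OF g]]
        carrier_matD[OF cols_mat_carrier[of n k g]] cong: sum.cong_simp) (simp add: cols_mat_def)
qed (auto simp: cols_mat_def)

text \<open>The columns of \<open>P\<close> are orthonormalised inside the set \<open>Q\<close> of
  vectors fixed by \<open>P\<close>. The resulting \<open>T\<close> satisfies
  \<open>T * P = P\<close> by the reproducing identity and \<open>P * T = T\<close> because all
  \<open>G l\<close> lie in \<open>Q\<close>; since both are selfadjoint, they are equal.\<close>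

lemma projection_eq_isometry_mult_adj:
  assumes P: "P \<in> carrier_mat n n" "P * P = P" "adj P = P"
  obtains r W where "W \<in> carrier_mat n r" "adj W * W = 1\<^sub>m r" "W * adj W = P"
    "mat_range W = mat_range P"
proof -
  have Pd: "dim_row P = n" "dim_col P = n" using P by auto
  define Q where "Q = {A \<in> carrier_mat n 1. P * A = A}"
  have "\<exists>(r :: nat) G. (\<forall>l<r. G l \<in> Q) \<and>
    (\<forall>k<r. \<forall>l<r. adj (G k) * (1\<^sub>m n * G l) = (if k = l then 1\<^sub>m 1 else 0\<^sub>m 1 1)) \<and>
    (\<forall>F\<in>(\<lambda>p. P * unit_col n p) ` {..<n}.
      1\<^sub>m n * (msum n n (\<lambda>l. G l * adj (G l)) {..<r} * (1\<^sub>m n * F)) = 1\<^sub>m n * F)"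
  proof (rule matrix_gram_schmidt[OF positive_operator_one])
    fix A B assume AB: "A \<in> Q" "B \<in> Q"
    have "adj A * (1\<^sub>m n * B) = (adj A * (1\<^sub>m n * B)) $$ (0, 0) \<cdot>\<^sub>m 1\<^sub>m 1"
      using AB by (intro eq_matI) (auto simp: Q_def)
    then show "\<exists>c. adj A * (1\<^sub>m n * B) = c \<cdot>\<^sub>m 1\<^sub>m 1" by blast
    show "A + B \<in> Q"
      using AB P(1) mult_add_distrib_mat[of P n n A 1 B] by (auto simp: Q_def)
  next
    fix A c assume "A \<in> Q"
    then show "c \<cdot>\<^sub>m A \<in> Q" using Pd by (auto simp: Q_def mult_smult_right)
  next
    have "P * (P * unit_col n p) = P * unit_col n p" for p
      using P(2) by (simp add: mult_assoc_dim[symmetric] Pd)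
    then show "(\<lambda>p. P * unit_col n p) ` {..<n} \<subseteq> Q"
      by (auto simp: Q_def Pd intro!: carrier_matI)
  qed (use Pd in \<open>auto simp: Q_def\<close>)
  then obtain r :: nat and G where GQ: "\<And>l. l < r \<Longrightarrow> G l \<in> Q"
    and orth: "\<And>k l. k < r \<Longrightarrow> l < r \<Longrightarrow> adj (G k) * (1\<^sub>m n * G l) = (if k = l then 1\<^sub>m 1 else 0\<^sub>m 1 1)"
    and span: "\<And>p. p < n \<Longrightarrow> 1\<^sub>m n * (msum n n (\<lambda>l. G l * adj (G l)) {..<r} * (1\<^sub>m n * (P * unit_col n p))) =
      1\<^sub>m n * (P * unit_col n p)"
    unfolding ball_simps by blast
  have G: "G \<in> {..<r} \<rightarrow> carrier_mat n 1" and PG: "\<And>l. l < r \<Longrightarrow> P * G l = G l"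
    using GQ by (auto simp: Q_def)
  define T where "T = msum n n (\<lambda>l. G l * adj (G l)) {..<r}"
  have TC: "T \<in> carrier_mat n n" by (simp add: T_def)
  have GG: "(\<lambda>l. G l * adj (G l)) \<in> {..<r} \<rightarrow> carrier_mat n n"
    by (intro funcsetI carrier_matI) (simp_all add: carrier_matD[OF funcset_mem[OF G]])
  note dims = Pd carrier_matD[OF TC] carrier_matD[OF funcset_mem[OF G]]
  have TP: "T * P = P"
  proof (rule mat_eqI_unit_col[of _ n n])
    show "T * P * unit_col n p = P * unit_col n p" if "p < n" for p
      using span[OF that] by (simp add: mult_assoc_dim dims T_def)
  qed (use P TC in auto)
  have PT: "P * T = T"
    unfolding T_def using Pd by (subst mult_msum_right[OF _ GG])
      (auto simp: mult_assoc_dim[symmetric] dims PG intro!: msum_cong)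
  have adjT: "adj T = T"
    unfolding T_def adj_msum[OF GG] by (intro msum_cong) (auto simp: adj_mult dims)
  have "T = adj (P * T)" by (simp add: PT adjT)
  also have "\<dots> = T * P" by (simp add: adj_mult dims adjT P(3))
  finally have T: "T = P" by (simp add: TP)
  define W where "W = cols_mat n r G"
  have W: "W \<in> carrier_mat n r" by (simp add: W_def)
  have WW: "W * adj W = P" using cols_mat_mult_adj[OF G] by (simp add: W_def T[symmetric] T_def)
  have iso: "adj W * W = 1\<^sub>m r"
  proof (rule eq_matI)
    fix a b assume "a < dim_row (1\<^sub>m r :: complex mat)" "b < dim_col (1\<^sub>m r :: complex mat)"
    then have ab: "a < r" "b < r" by auto
    then have "(adj W * (1\<^sub>m n * W)) $$ (a, b) = (adj (G a) * (1\<^sub>m n * G b)) $$ (0, 0)"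
      unfolding W_def using G by (intro index_cols_mat_form) auto
    then show "(adj W * W) $$ (a, b) = 1\<^sub>m r $$ (a, b)"
      using ab W by (simp add: orth)
  qed (use W in auto)
  have "P * W = W" using W iso by (simp add: WW[symmetric] mult_assoc_dim)
  then have "mat_range W = mat_range P"
    using mat_range_mult_subset[OF P(1) W] mat_range_mult_subset[OF W, of "adj W" n] W by (auto simp: WW)
  with W iso WW show thesis by (rule that)
qed

section \<open>The operator system as the span of its generators\<close>

text \<open>The operators \<open>K\<close> are those that the choice in the definition picks, so the
  generators \<open>adj (K i) * K j\<close> lie in the system literally. The last property is
  induction over the span: a linear subspace that contains the generators contains the
  system.\<close>

lemma operator_system_kraus:
  assumes \<Phi>: "quantum_channel n m \<Phi>"
  obtains r :: nat and K where "K \<in> {..<r} \<rightarrow> carrier_mat m n"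
    "\<forall>X\<in>carrier_mat n n. \<Phi> X = kraus_map m K {..<r} X"
    "msum n n (\<lambda>i. adj (K i) * K i) {..<r} = 1\<^sub>m n"
    "operator_system n m \<Phi> \<subseteq> carrier_mat n n"
    "\<forall>i<r. \<forall>j<r. adj (K i) * K j \<in> operator_system n m \<Phi>"
    "\<forall>c. \<forall>X\<in>operator_system n m \<Phi>. c \<cdot>\<^sub>m X \<in> operator_system n m \<Phi>"
    "\<forall>A\<in>operator_system n m \<Phi>. \<forall>B\<in>operator_system n m \<Phi>. A + B \<in> operator_system n m \<Phi>"
    "1\<^sub>m n \<in> operator_system n m \<Phi>"
    "\<forall>Q. Q \<subseteq> carrier_mat n n \<longrightarrow> 0\<^sub>m n n \<in> Q \<longrightarrow> (\<forall>A\<in>Q. \<forall>B\<in>Q. A + B \<in> Q) \<longrightarrow>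
      (\<forall>c. \<forall>A\<in>Q. c \<cdot>\<^sub>m A \<in> Q) \<longrightarrow> (\<forall>i<r. \<forall>j<r. adj (K i) * K j \<in> Q) \<longrightarrow>
      operator_system n m \<Phi> \<subseteq> Q"
proof -
  have kraus_iff: "kraus_representation n m \<Phi> Ks \<longleftrightarrow> set Ks \<subseteq> carrier_mat m n \<and>
      (\<forall>X\<in>carrier_mat n n. \<Phi> X = kraus_map m (\<lambda>i. Ks ! i) {..<length Ks} X)" for Ks
  proof -
    have "(\<Oplus>\<^bsub>cmat_space m\<^esub> i \<in> {..<length Ks}. Ks ! i * X * adj (Ks ! i)) =
        kraus_map m (\<lambda>i. Ks ! i) {..<length Ks} X"
      if Ks: "set Ks \<subseteq> carrier_mat m n" and X: "X \<in> carrier_mat n n" for X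
    proof -
      have K: "Ks ! i \<in> carrier_mat m n" if "i < length Ks" for i
        using Ks that nth_mem by blast
      then have "(\<Oplus>\<^bsub>cmat_space m\<^esub> i \<in> {..<length Ks}. Ks ! i * X * adj (Ks ! i)) =
          msum m m (\<lambda>i. Ks ! i * X * adj (Ks ! i)) {..<length Ks}"
        using X by (intro finsum_cmat_space) (auto simp: carrier_matD[OF K] intro!: carrier_matI)
      also have "\<dots> = kraus_map m (\<lambda>i. Ks ! i) {..<length Ks} X"
        unfolding kraus_map_def
        using X by (intro msum_cong) (auto simp: mult_assoc_dim carrier_matD[OF K])
      finally show ?thesis .
    qed
    then show ?thesis by (auto simp: kraus_representation_def)
  qed
  obtain r :: nat and K where K: "\<And>l. l < r \<Longrightarrow> K l \<in> carrier_mat m n"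
    and KX: "\<And>X. X \<in> carrier_mat n n \<Longrightarrow> \<Phi> X = kraus_map m K {..<r} X"
    using kraus_representation_exists[OF \<Phi>] by blast
  have "kraus_map m (\<lambda>i. map K [0..<r] ! i) {..<length (map K [0..<r])} X = kraus_map m K {..<r} X" for X
    unfolding kraus_map_def by (rule msum_cong) simp_all
  then have "kraus_representation n m \<Phi> (map K [0..<r])"
    unfolding kraus_iff using K KX by (auto simp only: set_map set_upt image_subset_iff atLeastLessThan_iff)
  \<comment> \<open>Since some representation exists, the choice selects a genuine one.\<close>
  then have Ks: "kraus_representation n m \<Phi> (SOME Ks. kraus_representation n m \<Phi> Ks)"
    by (rule someI)
  define Ks where "Ks = (SOME Ks. kraus_representation n m \<Phi> Ks)"
  define L where "L i = Ks ! i" for i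
  define s where "s = length Ks"
  have *: "set Ks \<subseteq> carrier_mat m n"
    "\<forall>X\<in>carrier_mat n n. \<Phi> X = kraus_map m (\<lambda>i. Ks ! i) {..<length Ks} X"
    using Ks[folded Ks_def] kraus_iff by blast+
  have L: "L \<in> {..<s} \<rightarrow> carrier_mat m n"
  proof (rule funcsetI)
    fix i assume "i \<in> {..<s}"
    then have "L i \<in> set Ks" by (simp add: L_def s_def)
    with *(1) show "L i \<in> carrier_mat m n" by blast
  qed
  have LX: "\<And>X. X \<in> carrier_mat n n \<Longrightarrow> \<Phi> X = kraus_map m L {..<s} X"
    using *(2) unfolding L_def s_def by blast
  have TP: "msum n n (\<lambda>i. adj (L i) * L i) {..<s} = 1\<^sub>m n"
    using \<Phi> LX trace_preserving_kraus[OF L] by (simp add: quantum_channel_def)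
  interpret M: Module.module "class_ring :: complex ring" "cmat_space n"
    by (rule vectorspace.axioms(1)[OF matrix_vs])
  define gens where "gens = {adj (L i) * L j | i j. i < s \<and> j < s}"
  have gens: "gens \<subseteq> carrier (cmat_space n)"
    by (auto simp: gens_def module_mat_simps carrier_matD[OF funcset_mem[OF L]] intro!: carrier_matI)
  have "set Ks = L ` {..<s}"
    by (auto simp: set_conv_nth L_def s_def)
  then have "{adj K * K' | K K'. K \<in> set Ks \<and> K' \<in> set Ks} = gens"
    by (auto simp: gens_def)
  then have S: "operator_system n m \<Phi> = M.span gens"
    unfolding operator_system_def Let_def Ks_def[symmetric] by (rule arg_cong)
  have sub: "submodule class_ring (M.span gens) (cmat_space n)"
    using gens by (rule M.span_is_submodule)
  have SC: "operator_system n m \<Phi> \<subseteq> carrier_mat n n"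
    using M.span_is_subset2[OF gens] by (simp add: S module_mat_simps)
  have gS: "adj (L i) * L j \<in> operator_system n m \<Phi>" if "i < s" "j < s" for i j
    using M.in_own_span[OF gens] that by (auto simp: S gens_def)
  have sm: "c \<cdot>\<^sub>m X \<in> operator_system n m \<Phi>" if "X \<in> operator_system n m \<Phi>" for c X
    using submodule.smult_closed[OF sub, of c X] that by (simp add: S module_mat_simps class_ring_simps)
  have add: "A + B \<in> operator_system n m \<Phi>"
    if "A \<in> operator_system n m \<Phi>" "B \<in> operator_system n m \<Phi>" for A B
    using submodule.m_closed[OF sub, of A B] that by (simp add: S module_mat_simps)
  \<comment> \<open>Trace preservation exhibits the identity as a sum of generators.\<close>
  have one: "1\<^sub>m n \<in> operator_system n m \<Phi>"
    unfolding TP[symmetric]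
  proof (rule msum_in_subspace)
    show "0\<^sub>m n n \<in> operator_system n m \<Phi>"
      using submodule.zero_closed[OF sub] by (simp add: S module_mat_simps)
  qed (use SC gS add in auto)
  have ind: "operator_system n m \<Phi> \<subseteq> Q"
    if Q: "Q \<subseteq> carrier_mat n n" "0\<^sub>m n n \<in> Q" "\<forall>A\<in>Q. \<forall>B\<in>Q. A + B \<in> Q"
      "\<forall>c. \<forall>A\<in>Q. c \<cdot>\<^sub>m A \<in> Q" "\<forall>i<s. \<forall>j<s. adj (L i) * L j \<in> Q" for Q
  proof -
    have "submodule class_ring Q (cmat_space n)"
      unfolding submodule_def module_mat_simps class_ring_simps
      using M.module_axioms Q(1-4) by (auto simp: class_ring_simps)
    moreover have "gens \<subseteq> Q" using Q(5) by (auto simp: gens_def)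
    ultimately show ?thesis unfolding S by (intro M.span_is_subset)
  qed
  show thesis
    by (rule that[of L s]) (use L LX TP SC gS sm add one ind in \<open>blast+\<close>)
qed

lemma
  assumes \<Phi>: "quantum_channel n m \<Phi>"
  shows operator_system_carrier: "operator_system n m \<Phi> \<subseteq> carrier_mat n n"
    and operator_system_smult: "X \<in> operator_system n m \<Phi> \<Longrightarrow> c \<cdot>\<^sub>m X \<in> operator_system n m \<Phi>"
    and operator_system_add:
      "X \<in> operator_system n m \<Phi> \<Longrightarrow> Y \<in> operator_system n m \<Phi> \<Longrightarrow> X + Y \<in> operator_system n m \<Phi>"
    and operator_system_one: "1\<^sub>m n \<in> operator_system n m \<Phi>"
  by (rule operator_system_kraus[OF \<Phi>]; simp)+

section \<open>Codes described by isometries\<close>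

text \<open>With \<open>P k = W k * adj (W k)\<close>, compression by \<open>P k\<close> and by
  \<open>W k\<close> carries the same information, and the code is the range of \<open>W k\<close>.
  The dimension \<open>d k\<close> becomes the number of columns, so that the conditions are plain
  matrix equations.\<close>

lemma codes_iff_isometries:
  assumes \<Phi>: "quantum_channel n m \<Phi>"
  shows "(\<exists>C P.
       (\<forall>k \<in> I. hilbert_subspace n (C k) \<and> hilbert_dim n (C k) = d k \<and>
                       orthogonal_projection n (C k) (P k)) \<and>
       (\<forall>k \<in> I. {P k * X * P k | X. X \<in> operator_system n m \<Phi>} = {c \<cdot>\<^sub>m P k | c. True}) \<and>
       (\<forall>k \<in> I. \<forall>j \<in> I. k \<noteq> j \<longrightarrow>
          (\<forall>X \<in> operator_system n m \<Phi>. P k * X * P j = 0\<^sub>m n n))) \<longleftrightarrow>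
    (\<exists>W. (\<forall>k\<in>I. W k \<in> carrier_mat n (d k) \<and> adj (W k) * W k = 1\<^sub>m (d k)) \<and>
      (\<forall>k\<in>I. \<forall>X\<in>operator_system n m \<Phi>. \<exists>c. adj (W k) * (X * W k) = c \<cdot>\<^sub>m 1\<^sub>m (d k)) \<and>
      (\<forall>k\<in>I. \<forall>j\<in>I. k \<noteq> j \<longrightarrow>
        (\<forall>X\<in>operator_system n m \<Phi>. adj (W k) * (X * W j) = 0\<^sub>m (d k) (d j))))" (is "?L \<longleftrightarrow> ?R")
proof -
  note SC = operator_system_carrier[OF \<Phi>] and sm = operator_system_smult[OF \<Phi>]
    and one = operator_system_one[OF \<Phi>]
  show ?thesis
  proof
    assume ?L
    then obtain C P where
      CP: "\<forall>k \<in> I. hilbert_subspace n (C k) \<and> hilbert_dim n (C k) = d k \<and> orthogonal_projection n (C k) (P k)"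
      and code': "\<forall>k \<in> I. {P k * X * P k | X. X \<in> operator_system n m \<Phi>} = {c \<cdot>\<^sub>m P k | c. True}"
      and orth': "\<forall>k \<in> I. \<forall>j \<in> I. k \<noteq> j \<longrightarrow> (\<forall>X \<in> operator_system n m \<Phi>. P k * X * P j = 0\<^sub>m n n)"
      by (elim exE conjE)
    have C: "\<And>k. k \<in> I \<Longrightarrow> hilbert_dim n (C k) = d k"
      and P: "\<And>k. k \<in> I \<Longrightarrow> orthogonal_projection n (C k) (P k)"
      using CP by simp_all
    have code: "\<exists>c. P k * X * P k = c \<cdot>\<^sub>m P k" if "k \<in> I" "X \<in> operator_system n m \<Phi>" for k X
    proof -
      have "P k * X * P k \<in> {P k * X * P k | X. X \<in> operator_system n m \<Phi>}" using that by blast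
      then show ?thesis using bspec[OF code' that(1)] by auto
    qed
    have orth: "\<And>k j X. k \<in> I \<Longrightarrow> j \<in> I \<Longrightarrow> k \<noteq> j \<Longrightarrow> X \<in> operator_system n m \<Phi> \<Longrightarrow> P k * X * P j = 0\<^sub>m n n"
      using orth' by simp
    have "\<exists>W. W \<in> carrier_mat n (d k) \<and> adj W * W = 1\<^sub>m (d k) \<and> W * adj W = P k" if k: "k \<in> I" for k
    proof -
      have "P k \<in> carrier_mat n n" "P k * P k = P k" "adj (P k) = P k"
        using P[OF k] by (auto simp: orthogonal_projection_def)
      then obtain r W where W: "W \<in> carrier_mat n r" "adj W * W = 1\<^sub>m r" "W * adj W = P k"
        "mat_range W = mat_range (P k)" by (rule projection_eq_isometry_mult_adj)
      then have "r = d k"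
        using isometry_range_dim[OF W(1,2)] C[OF k] P[OF k] by (simp add: orthogonal_projection_def)
      with W show ?thesis by auto
    qed
    then obtain W where W: "\<And>k. k \<in> I \<Longrightarrow> W k \<in> carrier_mat n (d k)"
      "\<And>k. k \<in> I \<Longrightarrow> adj (W k) * W k = 1\<^sub>m (d k)" "\<And>k. k \<in> I \<Longrightarrow> W k * adj (W k) = P k"
      by metis
    note dims = carrier_matD[OF W(1)] carrier_matD[OF subsetD[OF SC]]
    have WW: "adj (W k) * (W k * A) = A" if "k \<in> I" "dim_row A = d k" for k A
      using that by (simp add: mult_assoc_dim[symmetric] dims W(2))
    have PP: "adj (W k) * (P k * X * P j * W j) = adj (W k) * (X * W j)"
      if "k \<in> I" "j \<in> I" "X \<in> operator_system n m \<Phi>" for k j X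
      using that by (simp add: W(3)[symmetric] mult_assoc_dim dims WW W(2))
    have "\<exists>c. adj (W k) * (X * W k) = c \<cdot>\<^sub>m 1\<^sub>m (d k)" if k: "k \<in> I" and X: "X \<in> operator_system n m \<Phi>" for k X
    proof -
      obtain c where c: "P k * X * P k = c \<cdot>\<^sub>m P k" using code[OF k X] by blast
      have "adj (W k) * (X * W k) = c \<cdot>\<^sub>m 1\<^sub>m (d k)"
        unfolding PP[OF k k X, symmetric] c using k
        by (simp add: W(3)[symmetric] mult_assoc_dim mult_smult_left mult_smult_right dims WW W(2))
      then show ?thesis ..
    qed
    moreover have "adj (W k) * (X * W j) = 0\<^sub>m (d k) (d j)"
      if "k \<in> I" "j \<in> I" "k \<noteq> j" "X \<in> operator_system n m \<Phi>" for k j X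
      unfolding PP[OF that(1,2,4), symmetric] orth[OF that] using that by (simp add: dims)
    ultimately show ?R using W(1,2) by blast
  next
    assume ?R
    then obtain W where
      W': "\<forall>k\<in>I. W k \<in> carrier_mat n (d k) \<and> adj (W k) * W k = 1\<^sub>m (d k)"
      and code': "\<forall>k\<in>I. \<forall>X\<in>operator_system n m \<Phi>. \<exists>c. adj (W k) * (X * W k) = c \<cdot>\<^sub>m 1\<^sub>m (d k)"
      and orth': "\<forall>k\<in>I. \<forall>j\<in>I. k \<noteq> j \<longrightarrow>
        (\<forall>X\<in>operator_system n m \<Phi>. adj (W k) * (X * W j) = 0\<^sub>m (d k) (d j))"
      by (elim exE conjE)
    have W: "\<And>k. k \<in> I \<Longrightarrow> W k \<in> carrier_mat n (d k)"
      "\<And>k. k \<in> I \<Longrightarrow> adj (W k) * W k = 1\<^sub>m (d k)"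
      using W' by simp_all
    have code: "\<And>k X. k \<in> I \<Longrightarrow> X \<in> operator_system n m \<Phi> \<Longrightarrow> \<exists>c. adj (W k) * (X * W k) = c \<cdot>\<^sub>m 1\<^sub>m (d k)"
      using code' by simp
    have orth: "\<And>k j X. k \<in> I \<Longrightarrow> j \<in> I \<Longrightarrow> k \<noteq> j \<Longrightarrow> X \<in> operator_system n m \<Phi> \<Longrightarrow>
        adj (W k) * (X * W j) = 0\<^sub>m (d k) (d j)"
      using orth' by simp
    note dims = carrier_matD[OF W(1)] carrier_matD[OF subsetD[OF SC]]
    have WW: "adj (W k) * (W k * A) = A" if "k \<in> I" "dim_row A = d k" for k A
      using that by (simp add: mult_assoc_dim[symmetric] dims W(2))
    define P where "P k = W k * adj (W k)" for k
    have PXP: "P k * X * P j = W k * (adj (W k) * (X * W j)) * adj (W j)"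
      if "k \<in> I" "j \<in> I" "X \<in> operator_system n m \<Phi>" for k j X
      using that by (simp add: P_def mult_assoc_dim dims)
    have PP: "P k * P k = P k" if "k \<in> I" for k
      using that by (simp add: P_def mult_assoc_dim dims WW)
    have "orthogonal_projection n (mat_range (W k)) (P k)" if k: "k \<in> I" for k
    proof -
      have "P k * W k = W k" using k by (simp add: P_def mult_assoc_dim dims W(2))
      moreover have PC: "P k \<in> carrier_mat n n" using k by (auto simp: P_def dims intro!: carrier_matI)
      ultimately have "mat_range (P k) = mat_range (W k)"
        using mat_range_mult_subset[OF PC W(1)[OF k]] mat_range_mult_subset[OF W(1)[OF k], of "adj (W k)" n] W(1)[OF k]
        by (auto simp: P_def)
      with PC PP[OF k] k show ?thesis by (simp add: orthogonal_projection_def) (simp add: P_def adj_mult dims)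
    qed
    moreover have "{P k * X * P k | X. X \<in> operator_system n m \<Phi>} = {c \<cdot>\<^sub>m P k | c. True}" if k: "k \<in> I" for k
    proof (intro equalityI subsetI)
      fix Y assume "Y \<in> {P k * X * P k | X. X \<in> operator_system n m \<Phi>}"
      then obtain X where X: "X \<in> operator_system n m \<Phi>" and Y: "Y = P k * X * P k" by blast
      obtain c where "adj (W k) * (X * W k) = c \<cdot>\<^sub>m 1\<^sub>m (d k)" using code[OF k X] by blast
      then have "Y = c \<cdot>\<^sub>m P k"
        unfolding Y PXP[OF k k X] using k by (simp add: P_def mult_smult_left mult_smult_right dims)
      then show "Y \<in> {c \<cdot>\<^sub>m P k | c. True}" by blast
    next
      fix Y assume "Y \<in> {c \<cdot>\<^sub>m P k | c. True}"
      then obtain c where "Y = c \<cdot>\<^sub>m P k" by blast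
      \<comment> \<open>Every multiple of \<open>P k\<close> is attained because the operator system
        contains the multiples of the identity.\<close>
      then have "Y = P k * (c \<cdot>\<^sub>m 1\<^sub>m n) * P k"
        using k PP[OF k] by (simp add: mult_smult_left mult_smult_right P_def dims)
      with sm[OF one] show "Y \<in> {P k * X * P k | X. X \<in> operator_system n m \<Phi>}" by blast
    qed
    moreover have "P k * X * P j = 0\<^sub>m n n" if "k \<in> I" "j \<in> I" "k \<noteq> j" "X \<in> operator_system n m \<Phi>" for k j X
      unfolding PXP[OF that(1,2,4)] orth[OF that] using that by (simp add: dims)
    ultimately show ?L
      using isometry_range_subspace[OF W] isometry_range_dim[OF W]
      by (intro exI[of _ "\<lambda>k. mat_range (W k)"] exI[of _ P]) blast
  qed
qed

section \<open>Kraus operators of the corrected channel\<close>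

lemma kraus_map_comp:
  assumes K: "K \<in> I \<rightarrow> carrier_mat m n" and R: "R \<in> J \<rightarrow> carrier_mat p m"
    and X: "X \<in> carrier_mat n n" and fin: "finite I" "finite J"
  shows "kraus_map p R J (kraus_map m K I X) = kraus_map p (\<lambda>(j, i). R j * K i) (J \<times> I) X"
proof -
  note dims = carrier_matD[OF funcset_mem[OF K]] carrier_matD[OF funcset_mem[OF R]] carrier_matD[OF X]
  have 1: "(\<lambda>i. K i * (X * adj (K i))) \<in> I \<rightarrow> carrier_mat m m"
    by (intro funcsetI carrier_matI) (simp_all add: dims)
  have "R j * (msum m m (\<lambda>i. K i * (X * adj (K i))) I * adj (R j)) =
      msum p p (\<lambda>i. R j * K i * (X * adj (R j * K i))) I" if j: "j \<in> J" for j
  proof -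
    have 2: "(\<lambda>i. K i * (X * adj (K i)) * adj (R j)) \<in> I \<rightarrow> carrier_mat m p"
      using j by (intro funcsetI carrier_matI) (simp_all add: dims)
    have "R j * (msum m m (\<lambda>i. K i * (X * adj (K i))) I * adj (R j)) =
        msum p p (\<lambda>i. R j * (K i * (X * adj (K i)) * adj (R j))) I"
      using j mult_msum_left[OF _ 1, of "adj (R j)"] mult_msum_right[OF _ 2, of "R j"] by (simp add: dims)
    also have "\<dots> = msum p p (\<lambda>i. R j * K i * (X * adj (R j * K i))) I"
      using j by (intro msum_cong) (simp_all add: adj_mult mult_assoc_dim dims)
    finally show ?thesis .
  qed
  then have "kraus_map p R J (kraus_map m K I X) =
      msum p p (\<lambda>j. msum p p (\<lambda>i. R j * K i * (X * adj (R j * K i))) I) J"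
    unfolding kraus_map_def by (intro msum_cong) simp_all
  also have "\<dots> = msum p p (\<lambda>(j, i). R j * K i * (X * adj (R j * K i))) (J \<times> I)"
    using fin by (intro msum_Sigma)
  also have "\<dots> = kraus_map p (\<lambda>(j, i). R j * K i) (J \<times> I) X"
    unfolding kraus_map_def by (rule msum_cong) (simp_all add: case_prod_unfold)
  finally show ?thesis .
qed

lemma restrict_channel_comp_kraus:
  assumes K: "K \<in> I \<rightarrow> carrier_mat m n" and R: "R \<in> J \<rightarrow> carrier_mat p m"
    and V: "V \<in> carrier_mat n d" and Y: "Y \<in> carrier_mat d d" and fin: "finite I" "finite J"
    and \<Phi>: "\<forall>X\<in>carrier_mat n n. \<Phi> X = kraus_map m K I X"
    and D: "\<forall>X\<in>carrier_mat m m. D X = kraus_map p R J X"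
  shows "(D \<circ> restrict_channel V \<Phi>) Y = kraus_map p (\<lambda>(j, i). R j * (K i * V)) (J \<times> I) Y"
proof -
  note dims = carrier_matD[OF funcset_mem[OF K]] carrier_matD[OF V] carrier_matD[OF Y]
  have KV: "(\<lambda>i. K i * V) \<in> I \<rightarrow> carrier_mat m d"
    by (intro funcsetI carrier_matI) (simp_all add: dims)
  have "V * Y * adj V \<in> carrier_mat n n" by (intro carrier_matI) (simp_all add: dims)
  then have "restrict_channel V \<Phi> Y = kraus_map m K I (V * Y * adj V)"
    using \<Phi> by (simp add: restrict_channel_def)
  also have "\<dots> = kraus_map m (\<lambda>i. K i * V) I Y"
    unfolding kraus_map_def by (intro msum_cong) (simp_all add: adj_mult mult_assoc_dim dims)
  finally have "(D \<circ> restrict_channel V \<Phi>) Y = kraus_map p R J (kraus_map m (\<lambda>i. K i * V) I Y)"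
    using D by simp
  also have "\<dots> = kraus_map p (\<lambda>(j, i). R j * (K i * V)) (J \<times> I) Y"
    using Y fin by (rule kraus_map_comp[OF KV R])
  finally show ?thesis .
qed

text \<open>\<open>\<Sum>i. [X, L i]\<^sup>* [X, L i]\<close> is a combination of the values of the unital map \<open>Y \<mapsto> \<Sum>i. (L i)\<^sup>* Y (L i)\<close>
  at \<open>1\<close>, \<open>X\<close>, \<open>X\<^sup>*\<close> and \<open>X\<^sup>* X\<close>, and vanishes when these are fixed.\<close>

lemma kraus_commute_fixed:
  assumes L: "L \<in> I \<rightarrow> carrier_mat n n" and "finite I" and X: "X \<in> carrier_mat n n"
    and fixed: "msum n n (\<lambda>i. adj (L i) * (1\<^sub>m n * L i)) I = 1\<^sub>m n"
      "msum n n (\<lambda>i. adj (L i) * (X * L i)) I = X"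
      "msum n n (\<lambda>i. adj (L i) * (adj X * L i)) I = adj X"
      "msum n n (\<lambda>i. adj (L i) * ((adj X * X) * L i)) I = adj X * X"
    and i: "i \<in> I"
  shows "X * L i = L i * X"
proof -
  note dims = carrier_matD[OF funcset_mem[OF L]] carrier_matD[OF X]
  define f where "f i = X * L i - L i * X" for i
  have f: "f \<in> I \<rightarrow> carrier_mat n n"
    unfolding f_def by (intro funcsetI carrier_matI) (simp_all add: dims)
  define a where "a i = adj (L i) * ((adj X * X) * L i)" for i
  define b where "b i = adj (L i) * (adj X * L i)" for i
  define c where "c i = adj (L i) * (X * L i)" for i
  define e where "e i = adj (L i) * (1\<^sub>m n * L i)" for i
  have C: "a \<in> I \<rightarrow> carrier_mat n n" "b \<in> I \<rightarrow> carrier_mat n n" "c \<in> I \<rightarrow> carrier_mat n n"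
    "e \<in> I \<rightarrow> carrier_mat n n"
    unfolding a_def b_def c_def e_def by (intro funcsetI carrier_matI; simp add: dims)+
  note dims' = dims carrier_matD[OF funcset_mem[OF C(1)]] carrier_matD[OF funcset_mem[OF C(2)]]
    carrier_matD[OF funcset_mem[OF C(3)]] carrier_matD[OF funcset_mem[OF C(4)]]
  have C': "(\<lambda>i. adj X * c i) \<in> I \<rightarrow> carrier_mat n n" "(\<lambda>i. b i * X) \<in> I \<rightarrow> carrier_mat n n"
    "(\<lambda>i. e i * X) \<in> I \<rightarrow> carrier_mat n n"
    "(\<lambda>i. adj X * (e i * X)) \<in> I \<rightarrow> carrier_mat n n"
    "(\<lambda>i. a i - adj X * c i) \<in> I \<rightarrow> carrier_mat n n"
    "(\<lambda>i. b i * X - adj X * (e i * X)) \<in> I \<rightarrow> carrier_mat n n"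
    by (intro funcsetI carrier_matI; simp add: dims')+
  have "msum n n (\<lambda>i. adj (f i) * f i) I =
      msum n n (\<lambda>i. (a i - adj X * c i) - (b i * X - adj X * (e i * X))) I"
  proof (rule msum_cong, rule refl)
    fix i assume i: "i \<in> I"
    have "adj (f i) = adj (L i) * adj X - adj X * adj (L i)"
      using i by (simp add: f_def adj_minus adj_mult dims)
    then have "adj (f i) * f i = (adj (L i) * adj X - adj X * adj (L i)) * (X * L i) -
        (adj (L i) * adj X - adj X * adj (L i)) * (L i * X)"
      using i by (simp add: f_def mult_minus_right dims)
    also have "\<dots> = (a i - adj X * c i) - (b i * X - adj X * (e i * X))"
      using i by (simp add: mult_minus_left dims mult_assoc_dim a_def b_def c_def e_def)
    finally show "adj (f i) * f i = (a i - adj X * c i) - (b i * X - adj X * (e i * X))" .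
  qed
  also have "\<dots> = (msum n n a I - adj X * msum n n c I) -
      (msum n n b I * X - adj X * (msum n n e I * X))"
    using mult_msum_right[OF _ C(3), of "adj X"] mult_msum_left[OF _ C(2), of X]
      mult_msum_left[OF _ C(4), of X] mult_msum_right[OF _ C'(3), of "adj X"]
    by (simp add: msum_minus[OF C'(5,6)] msum_minus[OF C(1) C'(1)] msum_minus[OF C'(2,4)] dims)
  \<comment> \<open>With the four values inserted, each of the two brackets is a difference of two
    copies of \<open>adj X * X\<close>.\<close>
  also have "\<dots> = 0\<^sub>m n n"
    unfolding a_def b_def c_def e_def fixed by (rule eq_matI) (simp_all add: dims)
  finally have "f i = 0\<^sub>m n n" using sum_adj_mult_self_zero[OF f \<open>finite I\<close> _ i] by simp
  then have 0: "X * L i - L i * X = 0\<^sub>m n n" by (simp add: f_def)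
  show ?thesis
  proof (rule eq_matI)
    fix j k assume "j < dim_row (L i * X)" "k < dim_col (L i * X)"
    then have "(X * L i - L i * X) $$ (j, k) = (X * L i) $$ (j, k) - (L i * X) $$ (j, k)"
      and "j < n" "k < n"
      using i by (simp_all add: dims)
    then show "(X * L i) $$ (j, k) = (L i * X) $$ (j, k)" by (simp add: 0)
  qed (use i in \<open>simp_all add: dims\<close>)
qed

text \<open>As \<open>P\<close> is the unit of \<open>A\<close>, the last property says that
  \<open>P * T * P\<close> commutes with \<open>X\<close>. Compression by \<open>V\<close> makes the
  algebra unital, as the commutation of Kraus operators demands; the result is carried back through
  \<open>V * adj V = P\<close>.\<close>

lemma correctable_commute:
  assumes \<Phi>: "quantum_channel n m \<Phi>" and corr: "correctable n m \<Phi> A"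
  obtains P where "unit_projection A P" "P \<in> carrier_mat n n" "A \<subseteq> carrier_mat n n" "adj P = P"
    "\<forall>T\<in>operator_system n m \<Phi>. \<forall>X\<in>A. P * (T * X) = X * (T * P)"
proof -
  from corr obtain P d V D where sub: "star_subalgebra n A" and unit: "unit_projection A P"
    and V: "isometry_onto n d (mat_range P) V" and D: "quantum_channel m d D"
    and fixed: "\<forall>X\<in>A. adjoint_map d d (D \<circ> restrict_channel V \<Phi>) (adj V * X * V) = adj V * X * V"
    unfolding correctable_def by blast
  have A: "A \<subseteq> carrier_mat n n"
    using sub by (auto simp: star_subalgebra_def submodule_def module_mat_simps)
  have mult: "\<And>X Y. X \<in> A \<Longrightarrow> Y \<in> A \<Longrightarrow> X * Y \<in> A" and star: "\<And>X. X \<in> A \<Longrightarrow> adj X \<in> A"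
    using sub by (auto simp: star_subalgebra_def)
  have PA: "P \<in> A" and PX: "\<And>X. X \<in> A \<Longrightarrow> P * X = X" and XP: "\<And>X. X \<in> A \<Longrightarrow> X * P = X"
    using unit by (auto simp: unit_projection_def)
  have PC: "P \<in> carrier_mat n n" using A PA by blast
  have VC: "V \<in> carrier_mat n d" and VV: "adj V * V = 1\<^sub>m d" using V by (auto simp: isometry_onto_def)
  note dims = carrier_matD[OF VC] carrier_matD[OF PC] carrier_matD[OF subsetD[OF A]]
  \<comment> \<open>\<open>P\<close> is a unit for \<open>adj P\<close> as well, so
    \<open>adj P\<close> equals the selfadjoint operator \<open>P * adj P\<close>.\<close>
  have "adj (P * adj P) = P * adj P" by (simp add: adj_mult dims)
  then have adjP: "adj P = P" using PX[OF star[OF PA]] by simp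
  have VVP: "V * adj V = P"
    using V PC PX[OF PA] adjP by (rule isometry_onto_projection)
  have PV: "P * V = V" by (simp add: VVP[symmetric] mult_assoc_dim dims VV)
  have VP: "adj V * P = adj V" by (simp add: VVP[symmetric] mult_assoc_dim[symmetric] dims VV)
  obtain r :: nat and K where K: "K \<in> {..<r} \<rightarrow> carrier_mat m n"
    and \<Phi>K: "\<forall>X\<in>carrier_mat n n. \<Phi> X = kraus_map m K {..<r} X"
    and SC: "operator_system n m \<Phi> \<subseteq> carrier_mat n n"
    and ind: "\<forall>Q. Q \<subseteq> carrier_mat n n \<longrightarrow> 0\<^sub>m n n \<in> Q \<longrightarrow> (\<forall>A\<in>Q. \<forall>B\<in>Q. A + B \<in> Q) \<longrightarrow>
      (\<forall>c. \<forall>A\<in>Q. c \<cdot>\<^sub>m A \<in> Q) \<longrightarrow> (\<forall>i<r. \<forall>j<r. adj (K i) * K j \<in> Q) \<longrightarrow>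
      operator_system n m \<Phi> \<subseteq> Q"
    by (rule operator_system_kraus[OF \<Phi>])
  obtain s :: nat and R where R: "R \<in> {..<s} \<rightarrow> carrier_mat d m"
    and DR: "\<forall>X\<in>carrier_mat m m. D X = kraus_map d R {..<s} X"
    and RR: "msum m m (\<lambda>i. adj (R i) * R i) {..<s} = 1\<^sub>m m"
    by (rule operator_system_kraus[OF D])
  define L where "L p = (case p of (j, i) \<Rightarrow> R j * (K i * V))" for p
  let ?I = "{..<s} \<times> {..<r}"
  note dims = dims carrier_matD[OF funcset_mem[OF K]] carrier_matD[OF funcset_mem[OF R]]
  have L: "L \<in> ?I \<rightarrow> carrier_mat d d"
    unfolding L_def by (intro funcsetI carrier_matI) (auto simp: dims)
  have comp: "(D \<circ> restrict_channel V \<Phi>) Y = kraus_map d L ?I Y" if Y: "Y \<in> carrier_mat d d" for Y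
    using restrict_channel_comp_kraus[OF K R VC Y _ _ \<Phi>K DR] by (simp add: L_def[abs_def])
  define B where "B X = adj V * (X * V)" for X
  have BC: "B X \<in> carrier_mat d d" if "X \<in> carrier_mat n n" for X
    using that by (intro carrier_matI) (simp_all add: B_def dims)
  have fixB: "msum d d (\<lambda>i. adj (L i) * (B X * L i)) ?I = B X" if X: "X \<in> A" for X
  proof -
    have XC: "X \<in> carrier_mat n n" using X A by blast
    have "adj V * X * V = B X" using X by (simp add: B_def mult_assoc_dim dims)
    then show ?thesis
      using bspec[OF fixed X] adjoint_map_kraus[OF L comp BC[OF XC]] by simp
  qed
  \<comment> \<open>Compression is multiplicative on \<open>A\<close> because
    \<open>V * adj V\<close> is the unit of \<open>A\<close>. Together with the values at adjoints
    and at \<open>P\<close>, this supplies the four fixed points behind commutation.\<close>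
  have B_mult: "B X * B Y = B (X * Y)" if "X \<in> A" "Y \<in> A" for X Y
  proof -
    have "B X * B Y = adj V * (X * (V * adj V) * (Y * V))"
      using that by (simp add: B_def mult_assoc_dim dims)
    then show ?thesis using that by (simp add: VVP XP B_def mult_assoc_dim dims)
  qed
  have B_adj: "adj (B X) = B (adj X)" if "X \<in> A" for X
    using that by (simp add: B_def adj_mult mult_assoc_dim dims)
  have B_P: "B P = 1\<^sub>m d" by (simp add: B_def PV VV)
  have comm: "B X * L p = L p * B X" if X: "X \<in> A" and p: "p \<in> ?I" for X p
  proof (rule kraus_commute_fixed[OF L _ _ _ _ _ _ p])
    show "B X \<in> carrier_mat d d" using X A by (intro BC) blast
    show "msum d d (\<lambda>i. adj (L i) * (1\<^sub>m d * L i)) ?I = 1\<^sub>m d"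
      using fixB[OF PA] by (simp add: B_P)
    show "msum d d (\<lambda>i. adj (L i) * (B X * L i)) ?I = B X" by (rule fixB[OF X])
    show "msum d d (\<lambda>i. adj (L i) * (adj (B X) * L i)) ?I = adj (B X)"
      unfolding B_adj[OF X] by (rule fixB[OF star[OF X]])
    show "msum d d (\<lambda>i. adj (L i) * ((adj (B X) * B X) * L i)) ?I = adj (B X) * B X"
      unfolding B_adj[OF X] B_mult[OF star[OF X] X] by (rule fixB[OF mult[OF star[OF X] X]])
  qed simp
  have dL: "dim_row (L p) = d" "dim_col (L p) = d" if "p \<in> ?I" for p
    using funcset_mem[OF L that] by auto
  have dB: "dim_row (B X) = d" "dim_col (B X) = d" for X by (simp_all add: B_def dims)
  \<comment> \<open>\<open>A\<close> is closed under adjoints, so the adjoint of the relation at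
    \<open>adj X\<close> is the relation for \<open>adj (L p)\<close> at \<open>X\<close>.\<close>
  have comm': "B X * adj (L p) = adj (L p) * B X" if X: "X \<in> A" and p: "p \<in> ?I" for X p
  proof -
    have "adj (B (adj X) * L p) = adj (L p * B (adj X))" by (simp only: comm[OF star[OF X] p])
    then show ?thesis
      using p X by (simp add: adj_mult dL dB B_adj star)
  qed
  have gen: "P * ((adj (K i) * K j) * X) = X * ((adj (K i) * K j) * P)"
    if X: "X \<in> A" and ij: "i < r" "j < r" for X i j
  proof -
    define W where "W = adj V * ((adj (K i) * K j) * V)"
    \<comment> \<open>The completeness relation of the decoder is inserted between
      \<open>adj (K i)\<close> and \<open>K j\<close>; this splits the compressed generator into
      products of operators that commute with the compressed algebra.\<close>
    have W: "W = msum d d (\<lambda>l. adj (L (l, i)) * L (l, j)) {..<s}"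
    proof -
      have 1: "(\<lambda>l. adj (R l) * R l) \<in> {..<s} \<rightarrow> carrier_mat m m"
        by (intro funcsetI carrier_matI) (simp_all add: dims)
      have 2: "(\<lambda>l. adj (R l) * R l * (K j * V)) \<in> {..<s} \<rightarrow> carrier_mat m d"
        using ij by (intro funcsetI carrier_matI) (simp_all add: dims)
      have "W = adj V * adj (K i) * (msum m m (\<lambda>i. adj (R i) * R i) {..<s} * (K j * V))"
        using ij by (simp add: W_def RR mult_assoc_dim dims)
      also have "\<dots> = msum d d (\<lambda>l. adj V * adj (K i) * (adj (R l) * R l * (K j * V))) {..<s}"
        using ij mult_msum_left[OF _ 1, of "K j * V"] mult_msum_right[OF _ 2, of "adj V * adj (K i)"]
        by (simp add: dims)
      also have "\<dots> = msum d d (\<lambda>l. adj (L (l, i)) * L (l, j)) {..<s}"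
        using ij by (intro msum_cong) (simp_all add: L_def adj_mult mult_assoc_dim dims)
      finally show ?thesis .
    qed
    have LL: "(\<lambda>l. adj (L (l, i)) * L (l, j)) \<in> {..<s} \<rightarrow> carrier_mat d d"
      using ij by (intro funcsetI carrier_matI) (simp_all add: dL)
    have WB: "W * B X = B X * W"
      unfolding W using ij mult_msum_left[OF _ LL, of "B X"] mult_msum_right[OF _ LL, of "B X"]
    proof (simp add: dB, intro msum_cong refl)
      fix l assume l: "l \<in> {..<s}"
      have "adj (L (l, i)) * L (l, j) * B X = adj (L (l, i)) * (B X * L (l, j))"
        using comm[OF X, of "(l, j)"] l ij by (simp add: mult_assoc_dim dL dB)
      also have "\<dots> = adj (L (l, i)) * B X * L (l, j)" using l ij by (simp add: mult_assoc_dim dL dB)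
      also have "\<dots> = B X * (adj (L (l, i)) * L (l, j))"
        using comm'[OF X, of "(l, i)", symmetric] l ij by (simp add: mult_assoc_dim dL dB)
      finally show "adj (L (l, i)) * L (l, j) * B X = B X * (adj (L (l, i)) * L (l, j))" .
    qed
    have "V * (W * B X) * adj V = (V * adj V) * ((adj (K i) * K j) * ((V * adj V) * X * (V * adj V)))"
      using X ij by (simp add: W_def B_def mult_assoc_dim dims)
    then have 1: "V * (W * B X) * adj V = P * ((adj (K i) * K j) * X)"
      using X by (simp add: VVP PX XP)
    have "V * (B X * W) * adj V = ((V * adj V) * X * (V * adj V)) * ((adj (K i) * K j) * (V * adj V))"
      using X ij by (simp add: W_def B_def mult_assoc_dim dims)
    then have 2: "V * (B X * W) * adj V = X * ((adj (K i) * K j) * P)"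
      using X by (simp add: VVP PX XP)
    show ?thesis using 1 2 by (simp add: WB)
  qed
  \<comment> \<open>The property is linear in \<open>T\<close>, so it passes from the generators to
    their span.\<close>
  define Q where "Q = {T \<in> carrier_mat n n. \<forall>X\<in>A. P * (T * X) = X * (T * P)}"
  have "operator_system n m \<Phi> \<subseteq> Q"
  proof (rule ind[rule_format])
    show "Q \<subseteq> carrier_mat n n" by (auto simp: Q_def)
    show "0\<^sub>m n n \<in> Q" by (simp add: Q_def dims)
    show "T + U \<in> Q" if "T \<in> Q" "U \<in> Q" for T U
    proof -
      have TU: "T \<in> carrier_mat n n" "U \<in> carrier_mat n n" using that by (simp_all add: Q_def)
      have "P * ((T + U) * X) = X * ((T + U) * P)" if X: "X \<in> A" for X
      proof -
        have XC: "X \<in> carrier_mat n n" using X A by blast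
        have "P * ((T + U) * X) = P * (T * X) + P * (U * X)"
          using TU PC XC by (simp add: add_mult_distrib_mat[of T n n U X n] mult_add_distrib_mat[of P n n _ n])
        also have "\<dots> = X * (T * P) + X * (U * P)"
          using \<open>T \<in> Q\<close> \<open>U \<in> Q\<close> X by (simp add: Q_def)
        also have "\<dots> = X * ((T + U) * P)"
          using TU PC XC by (simp add: add_mult_distrib_mat[of T n n U P n] mult_add_distrib_mat[of X n n _ n])
        finally show ?thesis .
      qed
      with TU show ?thesis by (simp add: Q_def)
    qed
    show "c \<cdot>\<^sub>m T \<in> Q" if "T \<in> Q" for c T
    proof -
      have T: "T \<in> carrier_mat n n" "\<forall>X\<in>A. P * (T * X) = X * (T * P)" using that by (simp_all add: Q_def)
      then show ?thesis
        by (simp add: Q_def mult_smult_left mult_smult_right dims carrier_matD[OF T(1)])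
    qed
    show "adj (K i) * K j \<in> Q" if "i < r" "j < r" for i j
    proof -
      have "adj (K i) * K j \<in> carrier_mat n n" using that by (intro carrier_matI) (simp_all add: dims)
      then show ?thesis using gen that by (simp add: Q_def)
    qed
  qed
  then have "\<forall>T\<in>operator_system n m \<Phi>. \<forall>X\<in>A. P * (T * X) = X * (T * P)"
    by (auto simp: Q_def)
  with unit PC A adjP show thesis by (rule that)
qed

section \<open>From transmission to codes\<close>

lemma star_hom_iff:
  "f \<in> star_hom A B \<longleftrightarrow>
    (\<forall>x\<in>carrier A. f x \<in> carrier B) \<and>
    (\<forall>x\<in>carrier A. \<forall>y\<in>carrier A. f (x \<oplus>\<^bsub>A\<^esub> y) = f x \<oplus>\<^bsub>B\<^esub> f y) \<and>
    (\<forall>c. \<forall>x\<in>carrier A. f (c \<odot>\<^bsub>A\<^esub> x) = c \<odot>\<^bsub>B\<^esub> f x) \<and>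
    (\<forall>x\<in>carrier A. \<forall>y\<in>carrier A. f (x \<otimes>\<^bsub>A\<^esub> y) = f x \<otimes>\<^bsub>B\<^esub> f y) \<and>
    (\<forall>x\<in>carrier A. f (star A x) = star B (f x))"
  by (auto simp: star_hom_def LinearCombinations.module_hom_def class_ring_simps Pi_def)

lemma mat_star_algebra_simps [simp]:
  "carrier (mat_star_algebra n) = carrier_mat n n"
  "x \<otimes>\<^bsub>mat_star_algebra n\<^esub> y = x * y"
  "x \<oplus>\<^bsub>mat_star_algebra n\<^esub> y = x + y"
  "c \<odot>\<^bsub>mat_star_algebra n\<^esub> x = c \<cdot>\<^sub>m x"
  "star (mat_star_algebra n) x = adj x"
  by (simp_all add: mat_star_algebra_def)

lemma direct_sum_simps [simp]:
  "carrier (direct_sum_mat_star_algebra N d) = (\<Pi>\<^sub>E k\<in>{1..N}. carrier_mat (d k) (d k))"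
  "x \<otimes>\<^bsub>direct_sum_mat_star_algebra N d\<^esub> y = (\<lambda>k\<in>{1..N}. x k * y k)"
  "x \<oplus>\<^bsub>direct_sum_mat_star_algebra N d\<^esub> y = (\<lambda>k\<in>{1..N}. x k + y k)"
  "c \<odot>\<^bsub>direct_sum_mat_star_algebra N d\<^esub> x = (\<lambda>k\<in>{1..N}. c \<cdot>\<^sub>m x k)"
  "star (direct_sum_mat_star_algebra N d) x = (\<lambda>k\<in>{1..N}. adj (x k))"
  by (simp_all add: direct_sum_mat_star_algebra_def)

text \<open>The matrix unit \<open>(a, b)\<close> of the summand \<open>k\<close>, restricted to
  \<open>{1..N}\<close> because the carrier of the direct sum is extensional.\<close>

definition dunit :: "nat \<Rightarrow> (nat \<Rightarrow> nat) \<Rightarrow> nat \<Rightarrow> nat \<Rightarrow> nat \<Rightarrow> nat \<Rightarrow> complex mat" where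
  "dunit N d k a b = (\<lambda>j\<in>{1..N}. if j = k then munit (d k) a b else 0\<^sub>m (d j) (d j))"

definition dzero :: "nat \<Rightarrow> (nat \<Rightarrow> nat) \<Rightarrow> nat \<Rightarrow> complex mat" where
  "dzero N d = (\<lambda>j\<in>{1..N}. 0\<^sub>m (d j) (d j))"

lemma dunit_carrier: "dunit N d k a b \<in> (\<Pi>\<^sub>E k\<in>{1..N}. carrier_mat (d k) (d k))"
  by (auto simp: dunit_def)

lemma dzero_carrier: "dzero N d \<in> (\<Pi>\<^sub>E k\<in>{1..N}. carrier_mat (d k) (d k))"
  by (auto simp: dzero_def)

lemma dunit_mult:
  assumes "b < d k"
  shows "(\<lambda>l\<in>{1..N}. dunit N d k a b l * dunit N d j c e l) =
    (if k = j \<and> b = c then dunit N d k a e else dzero N d)"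
proof (cases "k = j \<and> b = c")
  case True
  then have "(\<lambda>l\<in>{1..N}. dunit N d k a b l * dunit N d j c e l) = dunit N d k a e"
    unfolding dunit_def using assms by (intro restrict_ext) (simp add: munit_mult)
  with True show ?thesis by simp
next
  case False
  then have "(\<lambda>l\<in>{1..N}. dunit N d k a b l * dunit N d j c e l) = dzero N d"
    unfolding dunit_def dzero_def using assms by (intro restrict_ext) (simp add: munit_mult)
  with False show ?thesis by (simp del: de_Morgan_conj) 
qed

lemma dunit_adj: "(\<lambda>l\<in>{1..N}. adj (dunit N d k a b l)) = dunit N d k b a"
  unfolding dunit_def by (rule restrict_ext) (simp add: adj_munit)

text \<open>Moving \<open>E k 0 a\<close> past \<open>T\<close> brings it next to
  \<open>E j b 0\<close>. The product vanishes unless \<open>k = j\<close> and \<open>a = b\<close>,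
  and otherwise leaves a value independent of \<open>a\<close>. So the compression to one code has
  equal diagonal entries and no others, and the mixed ones vanish.\<close>

lemma transmittable_imp_isometries:
  assumes \<Phi>: "quantum_channel n m \<Phi>" and d: "\<forall>k\<in>{1..N}. 1 \<le> d k"
    and transm: "transmittable n m \<Phi> (direct_sum_mat_star_algebra N d)"
  shows "\<exists>W. (\<forall>k\<in>{1..N}. W k \<in> carrier_mat n (d k) \<and> adj (W k) * W k = 1\<^sub>m (d k)) \<and>
      (\<forall>k\<in>{1..N}. \<forall>X\<in>operator_system n m \<Phi>. \<exists>c. adj (W k) * (X * W k) = c \<cdot>\<^sub>m 1\<^sub>m (d k)) \<and>
      (\<forall>k\<in>{1..N}. \<forall>j\<in>{1..N}. k \<noteq> j \<longrightarrow>
        (\<forall>X\<in>operator_system n m \<Phi>. adj (W k) * (X * W j) = 0\<^sub>m (d k) (d j)))"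
proof -
  let ?S = "direct_sum_mat_star_algebra N d"
  let ?C = "\<Pi>\<^sub>E k\<in>{1..N}. carrier_mat (d k) (d k)"
  obtain \<pi> where \<pi>: "\<pi> \<in> star_hom ?S (mat_star_algebra n)" and inj: "inj_on \<pi> ?C"
    and corr: "correctable n m \<Phi> (\<pi> ` ?C)"
    using transm by (auto simp: transmittable_def)
  have \<pi>C: "\<And>x. x \<in> ?C \<Longrightarrow> \<pi> x \<in> carrier_mat n n"
    and \<pi>s: "\<And>c x. x \<in> ?C \<Longrightarrow> \<pi> (\<lambda>k\<in>{1..N}. c \<cdot>\<^sub>m x k) = c \<cdot>\<^sub>m \<pi> x"
    and \<pi>m: "\<And>x y. x \<in> ?C \<Longrightarrow> y \<in> ?C \<Longrightarrow> \<pi> (\<lambda>k\<in>{1..N}. x k * y k) = \<pi> x * \<pi> y"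
    and \<pi>a: "\<And>x. x \<in> ?C \<Longrightarrow> \<pi> (\<lambda>k\<in>{1..N}. adj (x k)) = adj (\<pi> x)"
    using \<pi> unfolding star_hom_iff mat_star_algebra_simps direct_sum_simps by blast+
  define E where "E k a b = \<pi> (dunit N d k a b)" for k a b
  have EC: "E k a b \<in> carrier_mat n n" for k a b
    unfolding E_def by (rule \<pi>C[OF dunit_carrier])
  have zero: "\<pi> (dzero N d) = 0\<^sub>m n n"
  proof -
    have eq: "(\<lambda>k\<in>{1..N}. 0 \<cdot>\<^sub>m dzero N d k) = dzero N d"
      unfolding dzero_def by (rule restrict_ext) simp
    have "\<pi> (dzero N d) = 0 \<cdot>\<^sub>m \<pi> (dzero N d)"
      by (rule trans[OF arg_cong[OF eq[symmetric], of \<pi>] \<pi>s[OF dzero_carrier]])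
    also have "\<dots> = 0\<^sub>m n n" using carrier_matD[OF \<pi>C[OF dzero_carrier]] by simp
    finally show ?thesis .
  qed
  have Em: "E k a b * E j c e = (if k = j \<and> b = c then E k a e else 0\<^sub>m n n)" if "b < d k" for k a b j c e
    unfolding E_def \<pi>m[OF dunit_carrier dunit_carrier, symmetric] dunit_mult[where d = d and k = k and b = b, OF that]
    by (simp only: if_distrib[of \<pi>] zero)
  have Ea: "adj (E k a b) = E k b a" for k a b
    unfolding E_def \<pi>a[OF dunit_carrier, symmetric] dunit_adj ..
  obtain P where unit: "unit_projection (\<pi> ` ?C) P" and PC: "P \<in> carrier_mat n n"
    and PT: "\<forall>T\<in>operator_system n m \<Phi>. \<forall>X\<in>\<pi> ` ?C. P * (T * X) = X * (T * P)" and adjP: "adj P = P"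
    by (rule correctable_commute[OF \<Phi> corr])
  have Eim: "E k a b \<in> \<pi> ` ?C" for k a b
    unfolding E_def by (rule imageI[OF dunit_carrier])
  have PE: "P * E k a b = E k a b" "E k a b * P = E k a b" for k a b
    using unit Eim[of k a b] unfolding unit_projection_def by blast+
  have SC: "T \<in> carrier_mat n n" if "T \<in> operator_system n m \<Phi>" for T
    using operator_system_carrier[OF \<Phi>] that by blast
  note dims = carrier_matD[OF PC] carrier_matD[OF EC] carrier_matD[OF SC]
  have ETE: "E k 0 a * (T * E j b 0) = (if k = j \<and> a = b then P * (T * E k 0 0) else 0\<^sub>m n n)"
    if "T \<in> operator_system n m \<Phi>" "a < d k" for T k a j b
  proof -
    have "E k 0 a * (T * E j b 0) = E k 0 a * (T * P) * E j b 0"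
      using that by (simp add: mult_assoc_dim dims PE)
    also have "\<dots> = P * (T * E k 0 a) * E j b 0"
      using bspec[OF bspec[OF PT that(1)] Eim[of k 0 a]] by (simp only:)
    also have "\<dots> = P * (T * (E k 0 a * E j b 0))" using that by (simp add: mult_assoc_dim dims)
    also have "\<dots> = (if k = j \<and> a = b then P * (T * E k 0 0) else 0\<^sub>m n n)"
      unfolding Em[OF that(2)] using that by (simp add: dims)
    finally show ?thesis .
  qed
  \<comment> \<open>The vector is the first column of an isometry onto the range of
    \<open>E k 0 0\<close>. This projection is nonzero because \<open>\<pi>\<close> is injective and
    \<open>d k\<close> is positive, so there is a first column.\<close>
  have "\<exists>u. u \<in> carrier_mat n 1 \<and> adj u * u = 1\<^sub>m 1 \<and> E k 0 0 * u = u" if k: "k \<in> {1..N}" for k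
  proof -
    have dk: "0 < d k" using d k by force
    have "E k 0 0 * E k 0 0 = E k 0 0" using Em[OF dk] by simp
    then obtain r W where W: "W \<in> carrier_mat n r" "adj W * W = 1\<^sub>m r" "W * adj W = E k 0 0"
      "mat_range W = mat_range (E k 0 0)"
      by (rule projection_eq_isometry_mult_adj[OF EC _ Ea])
    have "dunit N d k 0 0 \<noteq> dzero N d"
    proof
      assume "dunit N d k 0 0 = dzero N d"
      then have "dunit N d k 0 0 k $$ (0, 0) = dzero N d k $$ (0, 0)" by simp
      then show False using k dk by (simp add: dunit_def dzero_def)
    qed
    then have E0: "E k 0 0 \<noteq> 0\<^sub>m n n"
      using inj_onD[OF inj _ dunit_carrier dzero_carrier] unfolding E_def zero[symmetric] by blast
    have "r \<noteq> 0"
    proof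
      assume "r = 0"
      then have "W * adj W = 0\<^sub>m n n" using W(1) by (intro eq_matI) (simp_all add: index_mult_sum)
      with W(3) E0 show False by simp
    qed
    define u where "u = W * unit_col r 0"
    note dW = carrier_matD[OF W(1)]
    have "adj (unit_col r 0) * unit_col r 0 = 1\<^sub>m 1"
      using \<open>r \<noteq> 0\<close> by (intro eq_matI) (simp_all add: index_mult_unit_col, simp add: unit_col_def)
    moreover have "adj u * u = adj (unit_col r 0) * ((adj W * W) * unit_col r 0)"
      by (simp add: u_def adj_mult mult_assoc_dim dW)
    moreover have "E k 0 0 * u = W * ((adj W * W) * unit_col r 0)"
      by (simp add: u_def W(3)[symmetric] mult_assoc_dim dW)
    moreover have "u \<in> carrier_mat n 1" by (intro carrier_matI) (simp_all add: u_def dW)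
    ultimately show ?thesis
      by (intro exI[of _ u]) (simp add: W(2) u_def[symmetric])
  qed
  then obtain u where uC: "\<And>k. k \<in> {1..N} \<Longrightarrow> u k \<in> carrier_mat n 1"
    and uu: "\<And>k. k \<in> {1..N} \<Longrightarrow> adj (u k) * u k = 1\<^sub>m 1"
    and Eu: "\<And>k. k \<in> {1..N} \<Longrightarrow> E k 0 0 * u k = u k"
    by metis
  have uP: "adj (u k) * P = adj (u k)" if k: "k \<in> {1..N}" for k
  proof -
    have "P * u k = P * (E k 0 0 * u k)" by (simp add: Eu[OF k])
    also have "\<dots> = (P * E k 0 0) * u k" by (simp add: mult_assoc_dim dims carrier_matD[OF uC[OF k]])
    finally have "P * u k = u k" by (simp add: PE Eu[OF k])
    then have "adj (P * u k) = adj (u k)" by simp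
    then show ?thesis by (simp add: adj_mult dims carrier_matD[OF uC[OF k]] adjP)
  qed
  define W where "W k = cols_mat n (d k) (\<lambda>a. E k a 0 * u k)" for k
  define c where "c k T = (adj (u k) * (T * u k)) $$ (0, 0)" for k T
  have form: "(adj (W k) * (T * W j)) $$ (a, b) = (if k = j \<and> a = b then c k T else 0)"
    if T: "T \<in> operator_system n m \<Phi>" and k: "k \<in> {1..N}" and j: "j \<in> {1..N}"
      and a: "a < d k" and b: "b < d j" for T k j a b
  proof -
    note dims' = dims carrier_matD[OF uC[OF k]] carrier_matD[OF uC[OF j]]
    have "(adj (W k) * (T * W j)) $$ (a, b) = (adj (E k a 0 * u k) * (T * (E j b 0 * u j))) $$ (0, 0)"
      unfolding W_def using SC[OF T] a b by (intro index_cols_mat_form carrier_matI) (simp_all add: dims')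
    also have "adj (E k a 0 * u k) * (T * (E j b 0 * u j)) = adj (u k) * ((E k 0 a * (T * E j b 0)) * u j)"
      using T by (simp add: adj_mult Ea mult_assoc_dim dims')
    also have "\<dots> $$ (0, 0) = (if k = j \<and> a = b then c k T else 0)"
    proof (cases "k = j \<and> a = b")
      case True
      have "adj (u k) * ((P * (T * E k 0 0)) * u k) = (adj (u k) * P) * (T * (E k 0 0 * u k))"
        using T by (simp add: mult_assoc_dim dims')
      then show ?thesis
        unfolding ETE[OF T a] using True k by (simp add: uP Eu c_def)
    next
      case False
      then have "E k 0 a * (T * E j b 0) = 0\<^sub>m n n" unfolding ETE[OF T a] by (simp only: if_False)
      with False show ?thesis by (simp only: if_False) (simp add: dims')
    qed
    finally show ?thesis .
  qed
  have WC: "W k \<in> carrier_mat n (d k)" for k by (simp add: W_def)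
  note dW = carrier_matD[OF WC]
  have code: "adj (W k) * (T * W k) = c k T \<cdot>\<^sub>m 1\<^sub>m (d k)"
    if "k \<in> {1..N}" "T \<in> operator_system n m \<Phi>" for k T
    using that by (intro eq_matI) (simp_all add: form dW)
  have orth: "adj (W k) * (T * W j) = 0\<^sub>m (d k) (d j)"
    if "k \<in> {1..N}" "j \<in> {1..N}" "k \<noteq> j" "T \<in> operator_system n m \<Phi>" for k j T
    using that by (intro eq_matI) (simp_all add: form dW)
  \<comment> \<open>The code condition at the identity operator, where the scalar is the squared
    norm of \<open>u k\<close>.\<close>
  have iso: "adj (W k) * W k = 1\<^sub>m (d k)" if k: "k \<in> {1..N}" for k
  proof -
    have "c k (1\<^sub>m n) = 1" using uu[OF k] uC[OF k] by (simp add: c_def)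
    then show ?thesis
      using code[OF k operator_system_one[OF \<Phi>]] by (simp add: dW)
  qed
  show ?thesis
  proof (intro exI[of _ W] conjI)
    show "\<forall>k\<in>{1..N}. W k \<in> carrier_mat n (d k) \<and> adj (W k) * W k = 1\<^sub>m (d k)"
      by (intro ballI conjI WC iso)
    show "\<forall>k\<in>{1..N}. \<forall>X\<in>operator_system n m \<Phi>. \<exists>c. adj (W k) * (X * W k) = c \<cdot>\<^sub>m 1\<^sub>m (d k)"
      by (intro ballI exI, rule code)
    show "\<forall>k\<in>{1..N}. \<forall>j\<in>{1..N}. k \<noteq> j \<longrightarrow>
        (\<forall>X\<in>operator_system n m \<Phi>. adj (W k) * (X * W j) = 0\<^sub>m (d k) (d j))"
      by (intro ballI impI, rule orth)
  qed
qed

section \<open>From codes to transmission\<close>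

lemma sum_unit_col_mult_adj: "msum n n (\<lambda>l. unit_col n l * adj (unit_col n l)) {..<n} = 1\<^sub>m n"
proof (rule eq_matI)
  fix i j assume "i < dim_row (1\<^sub>m n :: complex mat)" "j < dim_col (1\<^sub>m n :: complex mat)"
  then have ij: "i < n" "j < n" by simp_all
  then have "(\<Sum>l<n. (unit_col n l * adj (unit_col n l)) $$ (i, j)) =
      (\<Sum>l<n. if l = i then if i = j then 1 else 0 else 0)"
    by (intro sum.cong refl) (simp add: index_mult_sum, simp add: unit_col_def)
  with ij show "msum n n (\<lambda>l. unit_col n l * adj (unit_col n l)) {..<n} $$ (i, j) = 1\<^sub>m n $$ (i, j)"
    by simp
qed simp_all

lemma adj_unit_col_mult_self: "l < n \<Longrightarrow> adj (unit_col n l) * unit_col n l = 1\<^sub>m 1"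
  by (intro eq_matI) (simp_all add: index_mult_unit_col, simp add: unit_col_def)

section \<open>The block-diagonal embedding along orthogonal isometries\<close>

locale orthogonal_isometries =
  fixes n :: nat and I :: "nat set" and d :: "nat \<Rightarrow> nat" and W :: "nat \<Rightarrow> complex mat"
  assumes fin: "finite I"
    and WC: "k \<in> I \<Longrightarrow> W k \<in> carrier_mat n (d k)"
    and WW: "k \<in> I \<Longrightarrow> adj (W k) * W k = 1\<^sub>m (d k)"
    and WW0: "k \<in> I \<Longrightarrow> j \<in> I \<Longrightarrow> k \<noteq> j \<Longrightarrow> adj (W k) * W j = 0\<^sub>m (d k) (d j)"
begin

text \<open>It acts as \<open>x k\<close> on the \<open>k\<close>-th range and vanishes on the
  complement of all ranges, so it is unital only if these fill the space.\<close>

definition emb :: "(nat \<Rightarrow> complex mat) \<Rightarrow> complex mat" where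
  "emb x = msum n n (\<lambda>k. W k * (x k * adj (W k))) I"

text \<open>Unlike the carrier of the direct sum, this imposes nothing outside \<open>I\<close>, so
  pointwise operations stay inside without being restricted.\<close>

definition dcarrier :: "(nat \<Rightarrow> complex mat) set" where
  "dcarrier = {x. \<forall>k\<in>I. x k \<in> carrier_mat (d k) (d k)}"

lemma emb_carrier [simp]: "emb x \<in> carrier_mat n n"
  by (simp add: emb_def)

lemma dim_emb [simp]: "dim_row (emb x) = n" "dim_col (emb x) = n"
  by (simp_all add: emb_def)

lemma dim_W [simp]: "k \<in> I \<Longrightarrow> dim_row (W k) = n" "k \<in> I \<Longrightarrow> dim_col (W k) = d k"
  using WC by auto

lemma dim_dcarrier:
  "x \<in> dcarrier \<Longrightarrow> k \<in> I \<Longrightarrow> dim_row (x k) = d k" "x \<in> dcarrier \<Longrightarrow> k \<in> I \<Longrightarrow> dim_col (x k) = d k"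
  by (auto simp: dcarrier_def)

lemma emb_cong: "(\<And>k. k \<in> I \<Longrightarrow> x k = y k) \<Longrightarrow> emb x = emb y"
  unfolding emb_def by (rule msum_cong) simp_all

lemma emb_summand: "x \<in> dcarrier \<Longrightarrow> (\<lambda>k. W k * (x k * adj (W k))) \<in> I \<rightarrow> carrier_mat n n"
  by (intro funcsetI carrier_matI) (simp_all add: dim_dcarrier)

lemma WWA: "k \<in> I \<Longrightarrow> dim_row A = d k \<Longrightarrow> adj (W k) * (W k * A) = A"
  by (simp add: mult_assoc_dim[symmetric] WW)

text \<open>Orthogonality of the ranges removes all summands but the \<open>k\<close>-th.
  Multiplicativity, injectivity and commutation follow from this intertwining relation and its
  adjoint.\<close>

lemma emb_mult_W:
  assumes x: "x \<in> dcarrier" and k: "k \<in> I"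
  shows "emb x * W k = W k * x k"
proof -
  have "emb x * W k = msum n (d k) (\<lambda>j. W j * (x j * adj (W j)) * W k) I"
    using mult_msum_left[OF _ emb_summand[OF x], of "W k"] k by (simp add: emb_def)
  also have "\<dots> = W k * (x k * adj (W k)) * W k"
  proof (rule msum_delta[OF fin k])
    show "W k * (x k * adj (W k)) * W k \<in> carrier_mat n (d k)"
      using x k by (intro carrier_matI) (simp_all add: dim_dcarrier)
    fix j assume j: "j \<in> I" "j \<noteq> k"
    then show "W j * (x j * adj (W j)) * W k = 0\<^sub>m n (d k)"
      using x k by (simp add: mult_assoc_dim dim_dcarrier WW0)
  qed
  also have "\<dots> = W k * x k" using x k by (simp add: mult_assoc_dim dim_dcarrier WW)
  finally show ?thesis .
qed

lemma emb_adj: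
  assumes x: "x \<in> dcarrier"
  shows "emb (\<lambda>k. adj (x k)) = adj (emb x)"
  unfolding emb_def adj_msum[OF emb_summand[OF x]]
  using x by (intro msum_cong) (simp_all add: adj_mult mult_assoc_dim dim_dcarrier)

lemma W_mult_emb:
  assumes x: "x \<in> dcarrier" and k: "k \<in> I"
  shows "adj (W k) * emb x = x k * adj (W k)"
proof -
  have x': "(\<lambda>k. adj (x k)) \<in> dcarrier" using x by (auto simp: dcarrier_def)
  have "adj (adj (emb x) * W k) = adj (W k * adj (x k))"
    using emb_mult_W[OF x' k] by (simp add: emb_adj[OF x])
  then show ?thesis using x k by (simp add: adj_mult dim_dcarrier)
qed

lemma emb_mult:
  assumes x: "x \<in> dcarrier" and y: "y \<in> dcarrier"
  shows "emb (\<lambda>k. x k * y k) = emb x * emb y"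
proof -
  have "emb x * emb y = msum n n (\<lambda>k. emb x * (W k * (y k * adj (W k)))) I"
    using mult_msum_right[OF _ emb_summand[OF y], of "emb x"] by (simp add: emb_def[of y])
  also have "\<dots> = emb (\<lambda>k. x k * y k)"
    unfolding emb_def[of "\<lambda>k. x k * y k"]
  proof (rule msum_cong, rule refl)
    fix k assume k: "k \<in> I"
    have "emb x * (W k * (y k * adj (W k))) = (emb x * W k) * (y k * adj (W k))"
      using k y by (simp add: mult_assoc_dim dim_dcarrier)
    then show "emb x * (W k * (y k * adj (W k))) = W k * (x k * y k * adj (W k))"
      using k x y by (simp add: emb_mult_W mult_assoc_dim dim_dcarrier)
  qed
  finally show ?thesis by (rule sym)
qed

lemma emb_add:
  assumes x: "x \<in> dcarrier" and y: "y \<in> dcarrier"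
  shows "emb (\<lambda>k. x k + y k) = emb x + emb y"
  unfolding emb_def msum_add[OF emb_summand[OF x] emb_summand[OF y], symmetric]
proof (rule msum_cong, rule refl)
  fix k assume k: "k \<in> I"
  have C: "x k \<in> carrier_mat (d k) (d k)" "y k \<in> carrier_mat (d k) (d k)" "adj (W k) \<in> carrier_mat (d k) n"
    using x y k WC[OF k] by (auto simp: dcarrier_def)
  show "W k * ((x k + y k) * adj (W k)) = W k * (x k * adj (W k)) + W k * (y k * adj (W k))"
    using C WC[OF k] by (simp add: add_mult_distrib_mat[OF C(1,2,3)] mult_add_distrib_mat[of "W k" n "d k" _ n])
qed

lemma emb_smult:
  assumes x: "x \<in> dcarrier"
  shows "emb (\<lambda>k. c \<cdot>\<^sub>m x k) = c \<cdot>\<^sub>m emb x"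
  unfolding emb_def smult_msum[OF emb_summand[OF x]]
  using x by (intro msum_cong) (simp_all add: mult_smult_left mult_smult_right dim_dcarrier)

lemma emb_inj:
  assumes x: "x \<in> dcarrier" and y: "y \<in> dcarrier" and eq: "emb x = emb y" and k: "k \<in> I"
  shows "x k = y k"
proof -
  have *: "adj (W k) * (emb z * W k) = z k" if "z \<in> dcarrier" for z
    using that k by (simp add: emb_mult_W WWA dim_dcarrier)
  show ?thesis using *[OF x] *[OF y] eq by simp
qed

definition proj :: "complex mat" where "proj = emb (\<lambda>k. 1\<^sub>m (d k))"

lemma one_dcarrier: "(\<lambda>k. 1\<^sub>m (d k)) \<in> dcarrier"
  by (simp add: dcarrier_def)

lemma proj_mult_W: "k \<in> I \<Longrightarrow> proj * W k = W k"
  unfolding proj_def by (simp add: emb_mult_W[OF one_dcarrier])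

lemma proj_mult_emb:
  assumes x: "x \<in> dcarrier"
  shows "proj * emb x = emb x" and "emb x * proj = emb x"
  unfolding proj_def emb_mult[OF one_dcarrier x, symmetric] emb_mult[OF x one_dcarrier, symmetric]
  using x by (auto intro!: emb_cong simp: dim_dcarrier)

lemma proj_eq: "proj = msum n n (\<lambda>k. W k * adj (W k)) I"
  unfolding proj_def emb_def by (rule msum_cong) simp_all

lemma proj_projection: "proj \<in> carrier_mat n n" "proj * proj = proj" "adj proj = proj"
  using proj_mult_emb(1)[OF one_dcarrier] emb_adj[OF one_dcarrier] by (simp_all add: proj_def)

text \<open>\<open>W k * adj (W k)\<close> is the image of the unit of the summand \<open>k\<close>,
  which is central.\<close>

lemma emb_commute:
  assumes x: "x \<in> dcarrier" and k: "k \<in> I"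
  shows "W k * adj (W k) * emb x = emb x * (W k * adj (W k))"
proof -
  have "W k * adj (W k) * emb x = W k * (x k * adj (W k))"
    using x k by (simp add: mult_assoc_dim W_mult_emb)
  also have "\<dots> = emb x * W k * adj (W k)"
    using x k by (simp add: emb_mult_W mult_assoc_dim dim_dcarrier)
  also have "\<dots> = emb x * (W k * adj (W k))"
    using k by (simp add: mult_assoc_dim)
  finally show ?thesis .
qed

lemma proj_mult_W_mult:
  "k \<in> I \<Longrightarrow> dim_row A = d k \<Longrightarrow> proj * (W k * A) = W k * A"
  by (simp add: mult_assoc_dim[symmetric] proj_mult_W carrier_matD[OF proj_projection(1)])

end

text \<open>The \<open>G k l\<close> have mutually orthogonal ranges, so the pair
  \<open>(k, l)\<close> of a code and an error can be identified without disturbing the state;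
  \<open>W k * adj (G k l)\<close> then undoes the error.\<close>

lemma isometries_imp_transmittable:
  assumes \<Phi>: "quantum_channel n m \<Phi>" and N: "1 \<le> N" and d: "\<forall>k\<in>{1..N}. 1 \<le> d k"
    and WC: "\<And>k. k \<in> {1..N} \<Longrightarrow> W k \<in> carrier_mat n (d k)"
    and WW: "\<And>k. k \<in> {1..N} \<Longrightarrow> adj (W k) * W k = 1\<^sub>m (d k)"
    and code: "\<And>k X. k \<in> {1..N} \<Longrightarrow> X \<in> operator_system n m \<Phi> \<Longrightarrow>
      \<exists>c. adj (W k) * (X * W k) = c \<cdot>\<^sub>m 1\<^sub>m (d k)"
    and orth: "\<And>k j X. k \<in> {1..N} \<Longrightarrow> j \<in> {1..N} \<Longrightarrow> k \<noteq> j \<Longrightarrow> X \<in> operator_system n m \<Phi> \<Longrightarrow>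
      adj (W k) * (X * W j) = 0\<^sub>m (d k) (d j)"
  shows "transmittable n m \<Phi> (direct_sum_mat_star_algebra N d)"
proof -
  define I where "I = {1..N}"
  have finI: "finite I" by (simp add: I_def)
  note WC = WC[folded I_def] and WW = WW[folded I_def] and code = code[folded I_def]
    and orth = orth[folded I_def]
  obtain r :: nat and K where K: "K \<in> {..<r} \<rightarrow> carrier_mat m n"
    and \<Phi>K: "\<forall>X\<in>carrier_mat n n. \<Phi> X = kraus_map m K {..<r} X"
    and KS: "\<forall>i<r. \<forall>j<r. adj (K i) * K j \<in> operator_system n m \<Phi>"
    by (rule operator_system_kraus[OF \<Phi>])
  note dims = carrier_matD[OF WC] carrier_matD[OF funcset_mem[OF K]]
  interpret orthogonal_isometries n I d W
  proof
    show "adj (W k) * W j = 0\<^sub>m (d k) (d j)" if "k \<in> I" "j \<in> I" "k \<noteq> j" for k j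
      using orth[OF that operator_system_one[OF \<Phi>]] that by (simp add: dims)
  qed (use WC WW finI in simp_all)

  \<comment> \<open>Orthonormalisation leaves the list of Kraus operators for their linear
    combinations. As \<open>adj (Z a) * Z b\<close> remains in the operator system, the code
    conditions still apply.\<close>
  define Z where "Z c = msum m n (\<lambda>i. c i \<cdot>\<^sub>m K i) {..<r}" for c :: "nat \<Rightarrow> complex"
  have ZC: "Z c \<in> carrier_mat m n" for c by (simp add: Z_def)
  note dimZ = carrier_matD[OF ZC]
  have cK: "(\<lambda>i. c i \<cdot>\<^sub>m K i) \<in> {..<r} \<rightarrow> carrier_mat m n" for c
    by (intro funcsetI carrier_matI) (simp_all add: dims)
  have ZZ: "adj (Z a) * Z b \<in> operator_system n m \<Phi>" for a b
  proof -
    have 1: "(\<lambda>i. cnj (a i) \<cdot>\<^sub>m adj (K i)) \<in> {..<r} \<rightarrow> carrier_mat n m"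
      by (intro funcsetI carrier_matI) (simp_all add: dims)
    have zero: "0\<^sub>m n n \<in> operator_system n m \<Phi>"
      using operator_system_smult[OF \<Phi> operator_system_one[OF \<Phi>], of 0] by simp
    have "adj (Z a) = msum n m (\<lambda>i. cnj (a i) \<cdot>\<^sub>m adj (K i)) {..<r}"
      unfolding Z_def adj_msum[OF cK] by (simp add: adj_smult)
    then have "adj (Z a) * Z b = msum n n (\<lambda>i. cnj (a i) \<cdot>\<^sub>m adj (K i) * Z b) {..<r}"
      using mult_msum_left[OF _ 1, of "Z b"] by (simp add: dimZ)
    also have "\<dots> = msum n n (\<lambda>i. msum n n (\<lambda>j. cnj (a i) \<cdot>\<^sub>m adj (K i) * (b j \<cdot>\<^sub>m K j)) {..<r}) {..<r}"
    proof (rule msum_cong, rule refl)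
      fix i assume "i \<in> {..<r}"
      then show "cnj (a i) \<cdot>\<^sub>m adj (K i) * Z b =
          msum n n (\<lambda>j. cnj (a i) \<cdot>\<^sub>m adj (K i) * (b j \<cdot>\<^sub>m K j)) {..<r}"
        using mult_msum_right[OF _ cK, of "cnj (a i) \<cdot>\<^sub>m adj (K i)" b] by (simp add: Z_def dims)
    qed
    also have "\<dots> \<in> operator_system n m \<Phi>"
    proof (intro msum_in_subspace[OF _ zero operator_system_carrier[OF \<Phi>] operator_system_add[OF \<Phi>]])
      fix i j assume ij: "i \<in> {..<r}" "j \<in> {..<r}"
      have "cnj (a i) \<cdot>\<^sub>m adj (K i) * (b j \<cdot>\<^sub>m K j) = (cnj (a i) * b j) \<cdot>\<^sub>m (adj (K i) * K j)"
        using ij by (simp add: mult_smult_left mult_smult_right smult_smult_mat dims mult.commute)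
      then show "cnj (a i) \<cdot>\<^sub>m adj (K i) * (b j \<cdot>\<^sub>m K j) \<in> operator_system n m \<Phi>"
        using operator_system_smult[OF \<Phi>, of "adj (K i) * K j"] KS ij by simp
    qed simp_all
    finally show ?thesis .
  qed
  have Z_add: "Z a + Z b = Z (\<lambda>i. a i + b i)" for a b
    unfolding Z_def msum_add[OF cK cK, symmetric]
    by (rule msum_cong) (simp_all add: add_smult_distrib_right_mat[OF funcset_mem[OF K]])
  have Z_smult: "a \<cdot>\<^sub>m Z b = Z (\<lambda>i. a * b i)" for a b
    unfolding Z_def smult_msum[OF cK] by (simp add: smult_smult_mat)
  have Z_zero: "Z (\<lambda>i. 0) = 0\<^sub>m m n"
  proof -
    have "Z (\<lambda>i. 0) = msum m n (\<lambda>i. 0\<^sub>m m n) {..<r}"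
      unfolding Z_def by (rule msum_cong) (simp_all add: dims)
    then show ?thesis by simp
  qed
  have Z_K: "Z (\<lambda>j. if j = i then 1 else 0) = K i" if "i < r" for i
    unfolding Z_def using that by (subst msum_delta[of _ i]) (simp_all add: dims funcset_mem[OF K])
  have Z_form: "adj (Z a * W k) * (Z b * W j) = adj (W k) * ((adj (Z a) * Z b) * W j)"
    if "k \<in> I" "j \<in> I" for a b k j
    using that by (simp add: adj_mult mult_assoc_dim dimZ)

  define Q where "Q k = {Z c * W k | c. True}" for k
  have Q_orth: "adj A * B = 0\<^sub>m (d k) (d j)" if "A \<in> Q k" "B \<in> Q j" "k \<in> I" "j \<in> I" "k \<noteq> j" for A B k j
    using that orth[OF that(3-5) ZZ] by (auto simp: Q_def Z_form)
  have Q_code: "\<exists>c. adj A * B = c \<cdot>\<^sub>m 1\<^sub>m (d k)" if "A \<in> Q k" "B \<in> Q k" "k \<in> I" for A B k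
    using that code[OF that(3) ZZ] by (auto simp: Q_def Z_form)
  have QC: "Q k \<subseteq> carrier_mat m (d k)" if "k \<in> I" for k
    using that WC[OF that] ZC by (auto simp: Q_def intro!: mult_carrier_mat)
  have KQ: "K i * W k \<in> Q k" if "i < r" for i k
    unfolding Q_def using Z_K[OF that] by (intro CollectI exI[of _ "\<lambda>j. if j = i then 1 else 0"]) simp

  define gs where "gs k s G \<longleftrightarrow> (\<forall>l<s. G l \<in> Q k) \<and>
    (\<forall>l<s. \<forall>l'<s. adj (G l) * (1\<^sub>m m * G l') = (if l = l' then 1\<^sub>m (d k) else 0\<^sub>m (d k) (d k))) \<and>
    (\<forall>F\<in>(\<lambda>i. K i * W k) ` {..<r}.
      1\<^sub>m m * (msum m m (\<lambda>l. G l * adj (G l)) {..<s} * (1\<^sub>m m * F)) = 1\<^sub>m m * F)"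
    for k and s :: nat and G
  have "\<exists>s G. gs k s G" if k: "k \<in> I" for k
    unfolding gs_def
  proof (rule matrix_gram_schmidt[OF positive_operator_one])
    show "1 \<le> d k" using d k by (simp add: I_def)
    show "0\<^sub>m m (d k) \<in> Q k"
      unfolding Q_def using Z_zero k by (intro CollectI exI[of _ "\<lambda>i. 0"]) simp
    show "Q k \<subseteq> carrier_mat m (d k)" by (rule QC[OF k])
    show "A + B \<in> Q k" if AB: "A \<in> Q k" "B \<in> Q k" for A B
    proof -
      obtain a b where "A = Z a * W k" "B = Z b * W k" using AB by (auto simp: Q_def)
      then have "A + B = (Z a + Z b) * W k"
        using add_mult_distrib_mat[OF ZC ZC WC[OF k]] by simp
      then show ?thesis by (auto simp: Q_def Z_add)
    qed
    show "c \<cdot>\<^sub>m A \<in> Q k" if A: "A \<in> Q k" for A c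
    proof -
      obtain a where "A = Z a * W k" using A by (auto simp: Q_def)
      then have "c \<cdot>\<^sub>m A = (c \<cdot>\<^sub>m Z a) * W k" using k by (simp add: mult_smult_left dimZ)
      then show ?thesis by (auto simp: Q_def Z_smult)
    qed
    show "\<exists>c. adj A * (1\<^sub>m m * B) = c \<cdot>\<^sub>m 1\<^sub>m (d k)" if "A \<in> Q k" "B \<in> Q k" for A B
      using Q_code[OF that k] subsetD[OF QC[OF k] that(2)] by simp
    show "(\<lambda>i. K i * W k) ` {..<r} \<subseteq> Q k" using KQ by auto
  qed simp
  \<comment> \<open>The length \<open>s\<close> depends on \<open>k\<close>, so it is chosen
    together with the family as one pair.\<close>
  then have ex: "\<forall>k\<in>I. \<exists>p. gs k (fst p) (snd p)" by (simp only: split_paired_Ex fst_conv snd_conv) blast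
  obtain p where p: "\<forall>k\<in>I. gs k (fst (p k)) (snd (p k))" using bchoice[OF ex] by blast
  define s where "s k = fst (p k)" for k
  define G where "G k = snd (p k)" for k
  have gs: "gs k (s k) (G k)" if "k \<in> I" for k using p that by (simp add: s_def G_def)
  have GQ: "G k l \<in> Q k" if "k \<in> I" "l < s k" for k l
    using gs[OF that(1)] that(2) unfolding gs_def by blast
  have GC: "G k l \<in> carrier_mat m (d k)" if "k \<in> I" "l < s k" for k l
    using GQ[OF that] QC[OF that(1)] by blast
  note dimG = carrier_matD[OF GC]
  define T where "T k = msum m m (\<lambda>l. G k l * adj (G k l)) {..<s k}" for k
  have TC: "T k \<in> carrier_mat m m" for k by (simp add: T_def)
  note dimT = carrier_matD[OF TC]
  have TK: "T k * (K i * W k) = K i * W k" if "k \<in> I" "i < r" for k i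
  proof -
    have "1\<^sub>m m * (T k * (1\<^sub>m m * (K i * W k))) = 1\<^sub>m m * (K i * W k)"
      using gs[OF that(1)] that(2) unfolding gs_def T_def[of k, symmetric] by blast
    with that show ?thesis by (simp add: dims dimT)
  qed
  have GG: "(\<lambda>l. G k l * adj (G k l)) \<in> {..<s k} \<rightarrow> carrier_mat m m" if "k \<in> I" for k
    using that by (intro funcsetI carrier_matI) (simp_all add: dimG)
  have T0: "T k * A = 0\<^sub>m m (d j)" if "k \<in> I" "j \<in> I" "k \<noteq> j" "A \<in> Q j" for k j A
  proof -
    have A: "A \<in> carrier_mat m (d j)" using QC that by blast
    have "T k * A = msum m (d j) (\<lambda>l. G k l * adj (G k l) * A) {..<s k}"
      using mult_msum_left[OF _ GG[OF that(1)], of A] A by (simp add: T_def)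
    also have "\<dots> = msum m (d j) (\<lambda>l. 0\<^sub>m m (d j)) {..<s k}"
    proof (rule msum_cong, rule refl)
      fix l assume "l \<in> {..<s k}"
      then show "G k l * adj (G k l) * A = 0\<^sub>m m (d j)"
        using that Q_orth[OF GQ that(4), of k l] A by (simp add: mult_assoc_dim dimG)
    qed
    finally show ?thesis by simp
  qed
  \<comment> \<open>The projection onto all that the errors make of the codes. It fixes each
    \<open>K i * W k\<close>: \<open>T k\<close> reproduces it, and the other \<open>T j\<close>
    annihilate \<open>Q k\<close>.\<close>
  define Qp where "Qp = msum m m T I"
  have QpC: "Qp \<in> carrier_mat m m" by (simp add: Qp_def)
  note dimQp = carrier_matD[OF QpC]
  have TI: "T \<in> I \<rightarrow> carrier_mat m m" using TC by blast
  have adjT: "adj (T k) = T k" if "k \<in> I" for k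
    unfolding T_def adj_msum[OF GG[OF that]] using that by (intro msum_cong) (simp_all add: adj_mult dimG)
  have adjQp: "adj Qp = Qp"
    unfolding Qp_def adj_msum[OF TI] by (rule msum_cong) (simp_all add: adjT)
  have QpK: "Qp * (K i * W k) = K i * W k" if "k \<in> I" "i < r" for k i
  proof -
    have "Qp * (K i * W k) = msum m (d k) (\<lambda>j. T j * (K i * W k)) I"
      using mult_msum_left[OF _ TI, of "K i * W k"] that by (simp add: Qp_def dims)
    also have "\<dots> = T k * (K i * W k)"
      using that KQ by (intro msum_delta finI) (auto simp: dims dimT T0 intro!: carrier_matI)
    also have "\<dots> = K i * W k" by (rule TK[OF that])
    finally show ?thesis .
  qed
  have QpZ: "Qp * (Z c * W k) = Z c * W k" if k: "k \<in> I" for c k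
  proof -
    have 1: "(\<lambda>i. c i \<cdot>\<^sub>m K i * W k) \<in> {..<r} \<rightarrow> carrier_mat m (d k)"
      using k by (intro funcsetI carrier_matI) (simp_all add: dims)
    have ZW: "Z c * W k = msum m (d k) (\<lambda>i. c i \<cdot>\<^sub>m K i * W k) {..<r}"
      using mult_msum_left[OF _ cK, of "W k" c] k by (simp add: Z_def)
    have "Qp * (Z c * W k) = msum m (d k) (\<lambda>i. Qp * (c i \<cdot>\<^sub>m K i * W k)) {..<r}"
      unfolding ZW using mult_msum_right[OF _ 1, of Qp] by (simp add: dimQp)
    also have "\<dots> = msum m (d k) (\<lambda>i. c i \<cdot>\<^sub>m K i * W k) {..<r}"
      using k by (intro msum_cong) (simp_all add: mult_smult_left mult_smult_right dims dimQp QpK)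
    finally show ?thesis by (simp add: ZW)
  qed
  have QpG: "Qp * G k l = G k l" if "k \<in> I" "l < s k" for k l
    using GQ[OF that] QpZ[OF that(1)] by (auto simp: Q_def)
  have QpT: "Qp * T k = T k" if k: "k \<in> I" for k
  proof -
    have "Qp * T k = msum m m (\<lambda>l. Qp * (G k l * adj (G k l))) {..<s k}"
      using mult_msum_right[OF _ GG[OF k], of Qp] by (simp add: T_def dimQp)
    also have "\<dots> = T k"
      unfolding T_def using k
      by (intro msum_cong) (simp_all add: mult_assoc_dim[symmetric] dimQp dimG QpG)
    finally show ?thesis .
  qed
  have QpQp: "Qp * Qp = Qp"
  proof -
    have "Qp * Qp = msum m m (\<lambda>k. Qp * T k) I"
      using mult_msum_right[OF _ TI, of Qp] by (simp add: Qp_def)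
    also have "\<dots> = msum m m T I" by (rule msum_cong) (simp_all add: QpT)
    finally show ?thesis by (simp only: Qp_def[symmetric])
  qed

  obtain D V where VC: "V \<in> carrier_mat n D" and VV: "adj V * V = 1\<^sub>m D" and VVP: "V * adj V = proj"
    and rangeV: "mat_range V = mat_range proj"
    by (rule projection_eq_isometry_mult_adj[OF proj_projection])
  note dimV = carrier_matD[OF VC] carrier_matD[OF proj_projection(1)]
  have pV: "proj * V = V" by (simp add: VVP[symmetric] mult_assoc_dim dimV VV)
  have Vp: "adj V * proj = adj V" by (simp add: VVP[symmetric] mult_assoc_dim[symmetric] dimV VV)
  have VVA: "V * (adj V * A) = proj * A" if "dim_row A = n" for A
    using that by (simp add: VVP[symmetric] mult_assoc_dim dimV)
  have one_I: "1 \<in> I" using N by (simp add: I_def)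
  \<comment> \<open>The completion of the decoder sends the complement to
    \<open>unit_col D 0\<close>, a unit vector only for positive \<open>D\<close>; the first code,
    being nonzero, ensures this.\<close>
  have D0: "0 < D"
  proof (rule ccontr)
    assume "\<not> 0 < D"
    then have "proj = 0\<^sub>m n n" unfolding VVP[symmetric]
      by (intro eq_matI) (simp_all add: index_mult_sum dimV)
    then have "W 1 = 0\<^sub>m n (d 1)" using proj_mult_W[OF one_I] one_I by simp
    then have "(1\<^sub>m (d 1) :: complex mat) = 0\<^sub>m (d 1) (d 1)" using WW[OF one_I] by simp
    then have "(1\<^sub>m (d 1) :: complex mat) $$ (0, 0) = 0\<^sub>m (d 1) (d 1) $$ (0, 0)" by simp
    moreover have "0 < d 1" using d N by force
    ultimately show False by simp
  qed

  text \<open>The index \<open>0\<close>, which no code has, is used for Kraus operators that complete the decoder to a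
    trace-preserving map: they send the complement of the range of \<open>Qp\<close> to a fixed vector.\<close>
  define R0 where "R0 l = unit_col D 0 * (adj (unit_col m l) * (1\<^sub>m m - Qp))" for l
  define R1 where "R1 k l = adj V * (W k * adj (G k l))" for k l
  define R where "R = (\<lambda>(k, l). if k = 0 then R0 l else R1 k l)"
  define t where "t k = (if k = 0 then m else s k)" for k
  define J where "J = (SIGMA k:{0..N}. {..<t k})"
  have finJ: "finite J" by (simp add: J_def)
  have I0: "{0..N} = insert 0 I" by (auto simp: I_def)
  have I_pos: "k \<noteq> 0" if "k \<in> I" for k using that by (simp add: I_def)
  have R0C: "R0 l \<in> carrier_mat D m" for l
    by (intro carrier_matI) (simp_all add: R0_def dimQp)
  have R1C: "R1 k l \<in> carrier_mat D m" if "k \<in> I" "l < s k" for k l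
    using that by (intro carrier_matI) (simp_all add: R1_def dimV dimG)
  have RJ: "R \<in> J \<rightarrow> carrier_mat D m"
    using R0C R1C by (auto simp: R_def J_def t_def I0)
  have RR: "msum m m (\<lambda>q. adj (R q) * R q) J = 1\<^sub>m m"
  proof -
    have R0R0: "msum m m (\<lambda>l. adj (R0 l) * R0 l) {..<m} = 1\<^sub>m m - Qp"
    proof -
      let ?q = "1\<^sub>m m - Qp"
      have q: "dim_row ?q = m" "dim_col ?q = m" by (simp_all add: dimQp)
      have adjq: "adj ?q = ?q" by (simp add: adj_minus dimQp adjQp)
      have 1: "(\<lambda>l. unit_col m l * adj (unit_col m l)) \<in> {..<m} \<rightarrow> carrier_mat m m"
        by (intro funcsetI carrier_matI) simp_all
      have 2: "(\<lambda>l. unit_col m l * adj (unit_col m l) * ?q) \<in> {..<m} \<rightarrow> carrier_mat m m"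
        by (intro funcsetI carrier_matI) (simp_all add: dimQp)
      have "adj (R0 l) * R0 l = ?q * (unit_col m l * adj (unit_col m l) * ?q)" for l
      proof -
        have "adj (R0 l) * R0 l = ?q * (unit_col m l * ((adj (unit_col D 0) * unit_col D 0) * (adj (unit_col m l) * ?q)))"
          unfolding R0_def by (simp add: adj_mult adjq q mult_assoc_dim del: index_minus_mat)
        then show ?thesis
          by (simp add: adj_unit_col_mult_self[OF D0] mult_assoc_dim q del: index_minus_mat)
      qed
      then have "msum m m (\<lambda>l. adj (R0 l) * R0 l) {..<m} =
          msum m m (\<lambda>l. ?q * (unit_col m l * adj (unit_col m l) * ?q)) {..<m}"
        by (simp only:)
      also have "\<dots> = ?q * (msum m m (\<lambda>l. unit_col m l * adj (unit_col m l)) {..<m} * ?q)"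
        using mult_msum_right[OF _ 2, of ?q] mult_msum_left[OF _ 1, of ?q] by (simp add: q del: index_minus_mat)
      also have "\<dots> = ?q * ?q" by (simp add: sum_unit_col_mult_adj q del: index_minus_mat)
      also have "\<dots> = ?q"
        by (rule eq_matI) (simp_all add: mult_minus_left mult_minus_right dimQp QpQp)
      finally show ?thesis .
    qed
    \<comment> \<open>\<open>V * adj V\<close> absorbs \<open>W k\<close> and
      \<open>adj (W k) * W k\<close> is the identity, so only the projection onto the range of
      \<open>G k l\<close> remains.\<close>
    have R1R1: "adj (R1 k l) * R1 k l = G k l * adj (G k l)" if "k \<in> I" "l < s k" for k l
      using that by (simp add: R1_def adj_mult mult_assoc_dim dimV dimG VVA WWA proj_mult_W_mult)
    have "msum m m (\<lambda>q. adj (R q) * R q) J =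
        msum m m (\<lambda>k. msum m m (\<lambda>l. adj (R (k, l)) * R (k, l)) {..<t k}) {0..N}"
      unfolding J_def by (subst msum_Sigma) (auto intro!: msum_cong)
    also have "\<dots> = msum m m (\<lambda>l. adj (R (0, l)) * R (0, l)) {..<t 0} +
        msum m m (\<lambda>k. msum m m (\<lambda>l. adj (R (k, l)) * R (k, l)) {..<t k}) I"
      unfolding I0 using finI by (intro msum_insert) (simp_all add: I_def)
    also have "msum m m (\<lambda>l. adj (R (0, l)) * R (0, l)) {..<t 0} = 1\<^sub>m m - Qp"
      using R0R0 by (simp add: R_def t_def)
    also have "msum m m (\<lambda>k. msum m m (\<lambda>l. adj (R (k, l)) * R (k, l)) {..<t k}) I = Qp"
      unfolding Qp_def
    proof (rule msum_cong, rule refl)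
      fix k assume k: "k \<in> I"
      show "msum m m (\<lambda>l. adj (R (k, l)) * R (k, l)) {..<t k} = T k"
        unfolding T_def using k I_pos[OF k] by (intro msum_cong) (simp_all add: R_def t_def R1R1)
    qed
    also have "1\<^sub>m m - Qp + Qp = 1\<^sub>m m" by (rule eq_matI) (simp_all add: dimQp)
    finally show ?thesis .
  qed
  define \<D> where "\<D> = kraus_map D R J"
  have \<D>: "quantum_channel m D \<D>" unfolding \<D>_def by (rule kraus_map_channel[OF RJ RR])

  define L where "L = (\<lambda>(q, i). R q * (K i * V))"
  have comp: "(\<D> \<circ> restrict_channel V \<Phi>) Y = kraus_map D L (J \<times> {..<r}) Y" if "Y \<in> carrier_mat D D" for Y
    unfolding L_def using that finJ \<Phi>K by (intro restrict_channel_comp_kraus[OF K RJ VC]) (simp_all add: \<D>_def)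
  have LC: "L \<in> J \<times> {..<r} \<rightarrow> carrier_mat D D"
    unfolding L_def by (intro funcsetI carrier_matI)
      (auto simp: dims dimV carrier_matD[OF funcset_mem[OF RJ]])
  \<comment> \<open>Read off from trace preservation of the embedding by \<open>V\<close>, the
    channel and the decoder in turn.\<close>
  have LL: "msum D D (\<lambda>p. adj (L p) * L p) (J \<times> {..<r}) = 1\<^sub>m D"
  proof (rule iffD1[OF trace_preserving_kraus[OF LC]], intro ballI)
    fix X :: "complex mat" assume X: "X \<in> carrier_mat D D"
    have VX: "V * X * adj V \<in> carrier_mat n n" using X by (intro carrier_matI) (simp_all add: dimV)
    have "\<Phi> (V * X * adj V) \<in> carrier_mat m m" using \<Phi>K VX by simp
    then have "mat_trace (kraus_map D L (J \<times> {..<r}) X) = mat_trace (\<Phi> (V * X * adj V))"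
      using \<D> by (simp add: comp[OF X, symmetric] quantum_channel_def restrict_channel_def)
    also have "\<dots> = mat_trace (V * X * adj V)" using \<Phi> VX by (simp add: quantum_channel_def)
    also have "\<dots> = mat_trace (adj V * (V * X))"
      using X VC by (intro mat_trace_mult_commute[of _ n D]) auto
    also have "adj V * (V * X) = X"
      using X by (simp add: mult_assoc_dim[symmetric] dimV VV)
    finally show "mat_trace (kraus_map D L (J \<times> {..<r}) X) = mat_trace X" .
  qed

  have WWI: "(\<lambda>k. W k * adj (W k)) \<in> I \<rightarrow> carrier_mat n n"
    by (intro funcsetI carrier_matI) simp_all
  have KpV: "A * (K i * V) = msum (dim_row A) D (\<lambda>j. A * (K i * (W j * (adj (W j) * V)))) I"
    if i: "i < r" and A: "dim_col A = m" for A i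
  proof -
    have 1: "(\<lambda>j. W j * adj (W j) * V) \<in> I \<rightarrow> carrier_mat n D"
      by (intro funcsetI carrier_matI) (simp_all add: dimV)
    have "A * (K i * V) = A * K i * (proj * V)" using i A by (simp add: pV mult_assoc_dim dims dimV)
    also have "\<dots> = A * K i * msum n D (\<lambda>j. W j * adj (W j) * V) I"
      using mult_msum_left[OF _ WWI, of V] by (simp add: proj_eq dimV)
    also have "\<dots> = msum (dim_row A) D (\<lambda>j. A * K i * (W j * adj (W j) * V)) I"
      using mult_msum_right[OF _ 1, of "A * K i"] i by (simp add: dims)
    also have "\<dots> = msum (dim_row A) D (\<lambda>j. A * (K i * (W j * (adj (W j) * V)))) I"
      using i A by (intro msum_cong) (simp_all add: mult_assoc_dim dims dimV)
    finally show ?thesis .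
  qed
  \<comment> \<open>The completion never acts on what comes from the codes: \<open>V\<close> is the
    sum of the \<open>W j * adj (W j) * V\<close>, and \<open>Qp\<close> fixes every
    \<open>K i * W j\<close>.\<close>
  have L0: "R0 l * (K i * V) = 0\<^sub>m D D" if i: "i < r" for l i
  proof -
    have "(1\<^sub>m m - Qp) * (K i * V) = 0\<^sub>m m D"
    proof -
      have "(1\<^sub>m m - Qp) * (K i * V) =
          msum m D (\<lambda>j. (1\<^sub>m m - Qp) * (K i * (W j * (adj (W j) * V)))) I"
        using KpV[OF i, of "1\<^sub>m m - Qp"] by (simp add: dimQp)
      also have "\<dots> = msum m D (\<lambda>j. 0\<^sub>m m D) I"
      proof (rule msum_cong, rule refl)
        fix j assume j: "j \<in> I"
        have "(1\<^sub>m m - Qp) * (K i * W j) = 0\<^sub>m m (d j)"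
          using i j by (simp add: mult_minus_left dimQp dims QpK) (rule eq_matI, simp_all add: dims)
        then have "(1\<^sub>m m - Qp) * (K i * W j) * (adj (W j) * V) = 0\<^sub>m m D"
          using j by (simp add: dimV)
        then show "(1\<^sub>m m - Qp) * (K i * (W j * (adj (W j) * V))) = 0\<^sub>m m D"
          using i j by (simp add: mult_assoc_dim dimQp dims dimV)
      qed
      finally show ?thesis by simp
    qed
    moreover have "R0 l * (K i * V) = unit_col D 0 * (adj (unit_col m l) * ((1\<^sub>m m - Qp) * (K i * V)))"
      using i by (simp add: R0_def mult_assoc_dim dimQp dims dimV)
    ultimately show ?thesis by simp
  qed
  \<comment> \<open>When \<open>V\<close> is expanded over the codes, orthogonality leaves only code
    \<open>k\<close>, and the code condition makes the inner factor scalar. A multiple of a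
    compressed central projection remains.\<close>
  have L1: "\<exists>c. R1 k l * (K i * V) = c \<cdot>\<^sub>m (adj V * (W k * adj (W k) * V))"
    if k: "k \<in> I" and l: "l < s k" and i: "i < r" for k l i
  proof -
    obtain c where c: "adj (G k l) * (K i * W k) = c \<cdot>\<^sub>m 1\<^sub>m (d k)"
      using Q_code[OF GQ[OF k l] KQ[OF i] k] by blast
    have summand: "R1 k l * (K i * (W j * (adj (W j) * V))) =
        adj V * (W k * ((adj (G k l) * (K i * W j)) * (adj (W j) * V)))" if j: "j \<in> I" for j
      using j k l i by (simp add: R1_def mult_assoc_dim dimV dimG dims)
    have "R1 k l * (K i * V) = msum D D (\<lambda>j. R1 k l * (K i * (W j * (adj (W j) * V)))) I"
      using KpV[OF i, of "R1 k l"] carrier_matD[OF R1C[OF k l]] by simp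
    also have "\<dots> = R1 k l * (K i * (W k * (adj (W k) * V)))"
    proof (rule msum_delta[OF finI k])
      show "R1 k l * (K i * (W k * (adj (W k) * V))) \<in> carrier_mat D D"
        using k i by (intro carrier_matI) (simp_all add: carrier_matD[OF R1C[OF k l]] dimV dims)
      fix j assume j: "j \<in> I" "j \<noteq> k"
      have "adj (G k l) * (K i * W j) = 0\<^sub>m (d k) (d j)"
        using j k by (intro Q_orth[OF GQ[OF k l] KQ[OF i]]) simp_all
      then show "R1 k l * (K i * (W j * (adj (W j) * V))) = 0\<^sub>m D D"
        using j k by (simp add: summand dimV)
    qed
    also have "\<dots> = c \<cdot>\<^sub>m (adj V * (W k * adj (W k) * V))"
      using k by (simp add: summand c mult_smult_left mult_smult_right mult_assoc_dim dimV)
    finally show ?thesis by blast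
  qed
  have LY: "L p * (adj V * emb x * V) = (adj V * emb x * V) * L p"
    if x: "x \<in> dcarrier" and p: "p \<in> J \<times> {..<r}" for x p
  proof -
    obtain k l i where pe: "p = ((k, l), i)" and kl: "(k, l) \<in> J" and i: "i < r"
      using p by (cases p) auto
    show ?thesis
    proof (cases "k = 0")
      case True
      then have "L p = 0\<^sub>m D D" using L0[OF i] by (simp add: L_def pe R_def)
      then show ?thesis by (simp add: dimV)
    next
      case False
      then have k: "k \<in> I" and l: "l < s k" using kl by (auto simp: J_def t_def I_def)
      obtain c where "R1 k l * (K i * V) = c \<cdot>\<^sub>m (adj V * (W k * adj (W k) * V))" using L1[OF k l i] by blast
      then have Lp: "L p = c \<cdot>\<^sub>m (adj V * (W k * adj (W k) * V))" using False by (simp add: L_def pe R_def)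
      have "adj V * (W k * adj (W k) * V) * (adj V * emb x * V) = adj V * (W k * adj (W k) * (proj * emb x) * V)"
        using k by (simp add: mult_assoc_dim dimV VVA)
      also have "\<dots> = adj V * (emb x * (W k * adj (W k)) * V)"
        using proj_mult_emb(1)[OF x] emb_commute[OF x k] by simp
      also have "\<dots> = (adj V * emb x * V) * (adj V * (W k * adj (W k) * V))"
        using k by (simp add: mult_assoc_dim dimV VVA proj_mult_W_mult)
      finally show ?thesis
        using k by (simp add: Lp mult_smult_left mult_smult_right dimV)
    qed
  qed
  \<comment> \<open>Commutation pulls the compressed element out of the sum, which is then the
    identity.\<close>
  have fixed: "adjoint_map D D (\<D> \<circ> restrict_channel V \<Phi>) (adj V * emb x * V) = adj V * emb x * V"
    if x: "x \<in> dcarrier" for x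
  proof -
    define Y where "Y = adj V * emb x * V"
    have YC: "Y \<in> carrier_mat D D" by (intro carrier_matI) (simp_all add: Y_def dimV)
    have 1: "(\<lambda>p. adj (L p) * L p) \<in> J \<times> {..<r} \<rightarrow> carrier_mat D D"
      by (intro funcsetI carrier_matI) (simp_all add: carrier_matD[OF funcset_mem[OF LC]])
    have "adjoint_map D D (\<D> \<circ> restrict_channel V \<Phi>) Y = msum D D (\<lambda>p. adj (L p) * (Y * L p)) (J \<times> {..<r})"
      using comp YC by (intro adjoint_map_kraus[OF LC]) auto
    also have "\<dots> = msum D D (\<lambda>p. adj (L p) * L p * Y) (J \<times> {..<r})"
    proof (rule msum_cong, rule refl)
      fix p assume p: "p \<in> J \<times> {..<r}"
      show "adj (L p) * (Y * L p) = adj (L p) * L p * Y"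
        using LY[OF x p, folded Y_def] carrier_matD[OF funcset_mem[OF LC p]] carrier_matD[OF YC]
        by (simp add: mult_assoc_dim)
    qed
    also have "\<dots> = msum D D (\<lambda>p. adj (L p) * L p) (J \<times> {..<r}) * Y"
      using mult_msum_left[OF _ 1, of Y] YC by simp
    also have "\<dots> = Y" using YC by (simp add: LL)
    finally show ?thesis by (simp add: Y_def)
  qed

  let ?S = "direct_sum_mat_star_algebra N d"
  let ?C = "\<Pi>\<^sub>E k\<in>I. carrier_mat (d k) (d k)"
  have CS: "carrier ?S = ?C" by (simp add: I_def)
  have dC: "x \<in> dcarrier" if "x \<in> ?C" for x using that by (auto simp: dcarrier_def)
  \<comment> \<open>\<open>emb\<close> evaluates its argument only on \<open>I\<close>, so the
    extensional form of the operations makes no difference.\<close>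
  have emb_restrict: "emb (\<lambda>k\<in>I. f k) = emb f" for f by (rule emb_cong) simp
  have ops: "f \<in> dcarrier \<Longrightarrow> (\<lambda>k\<in>I. f k) \<in> ?C" for f by (auto simp: dcarrier_def)
  have hom: "emb \<in> star_hom ?S (mat_star_algebra n)"
    unfolding star_hom_iff CS mat_star_algebra_simps direct_sum_simps I_def[symmetric] emb_restrict
    by (intro conjI ballI allI emb_carrier emb_add emb_smult emb_mult emb_adj dC)
  have inj: "inj_on emb ?C"
  proof (rule inj_onI)
    fix x y assume "x \<in> ?C" "y \<in> ?C" "emb x = emb y"
    then show "x = y" using emb_inj[OF dC dC] by (intro PiE_ext[of x I _ y]) auto
  qed
  have in_image: "emb f \<in> emb ` ?C" if "f \<in> dcarrier" for f
    unfolding emb_restrict[of f, symmetric] by (rule imageI[OF ops[OF that]])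
  have im_add: "\<forall>A\<in>emb ` ?C. \<forall>B\<in>emb ` ?C. A + B \<in> emb ` ?C"
  proof (intro ballI)
    fix A B assume "A \<in> emb ` ?C" "B \<in> emb ` ?C"
    then obtain x y where xy: "x \<in> dcarrier" "y \<in> dcarrier" "A = emb x" "B = emb y" using dC by blast
    then have "(\<lambda>k. x k + y k) \<in> dcarrier" by (simp add: dcarrier_def)
    from in_image[OF this] show "A + B \<in> emb ` ?C" by (simp only: xy(3,4) emb_add[OF xy(1,2)])
  qed
  have im_smult: "\<forall>c. \<forall>A\<in>emb ` ?C. c \<cdot>\<^sub>m A \<in> emb ` ?C"
  proof (intro ballI allI)
    fix c A assume "A \<in> emb ` ?C"
    then obtain x where x: "x \<in> dcarrier" "A = emb x" using dC by blast
    then have "(\<lambda>k. c \<cdot>\<^sub>m x k) \<in> dcarrier" by (simp add: dcarrier_def)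
    from in_image[OF this] show "c \<cdot>\<^sub>m A \<in> emb ` ?C" by (simp only: x(2) emb_smult[OF x(1)])
  qed
  have im_mult: "\<forall>A\<in>emb ` ?C. \<forall>B\<in>emb ` ?C. A * B \<in> emb ` ?C"
  proof (intro ballI)
    fix A B assume "A \<in> emb ` ?C" "B \<in> emb ` ?C"
    then obtain x y where xy: "x \<in> dcarrier" "y \<in> dcarrier" "A = emb x" "B = emb y" using dC by blast
    then have "(\<lambda>k. x k * y k) \<in> dcarrier" unfolding dcarrier_def by (blast intro: mult_carrier_mat)
    from in_image[OF this] show "A * B \<in> emb ` ?C" by (simp only: xy(3,4) emb_mult[OF xy(1,2)])
  qed
  have im_adj: "\<forall>A\<in>emb ` ?C. adj A \<in> emb ` ?C"
  proof (intro ballI)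
    fix A assume "A \<in> emb ` ?C"
    then obtain x where x: "x \<in> dcarrier" "A = emb x" using dC by blast
    then have "(\<lambda>k. adj (x k)) \<in> dcarrier" by (simp add: dcarrier_def)
    from in_image[OF this] show "adj A \<in> emb ` ?C" by (simp only: x(2) emb_adj[OF x(1)])
  qed
  have im_proj: "proj \<in> emb ` ?C" unfolding proj_def by (rule in_image[OF one_dcarrier])
  have "0 \<cdot>\<^sub>m proj \<in> emb ` ?C" using im_smult im_proj by blast
  then have im_zero: "0\<^sub>m n n \<in> emb ` ?C" by (simp add: dimV)
  have "submodule class_ring (emb ` ?C) (cmat_space n)"
    unfolding submodule_def module_mat_simps class_ring_simps
    using vectorspace.axioms(1)[OF matrix_vs[of n n, where ?'a = complex]] im_add im_smult im_zero
    by (auto simp: class_ring_simps)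
  then have "star_subalgebra n (emb ` ?C)"
    unfolding star_subalgebra_def using im_mult im_adj by blast
  moreover have "unit_projection (emb ` ?C) proj"
    unfolding unit_projection_def using im_proj proj_mult_emb[OF dC] by blast
  moreover have "isometry_onto n D (mat_range proj) V"
    using VC VV rangeV by (simp add: isometry_onto_def)
  moreover have "\<forall>X\<in>emb ` ?C. adjoint_map D D (\<D> \<circ> restrict_channel V \<Phi>) (adj V * X * V) = adj V * X * V"
    using fixed[OF dC] by blast
  ultimately have "correctable n m \<Phi> (emb ` ?C)"
    unfolding correctable_def using \<D> by blast
  then show ?thesis
    unfolding transmittable_def CS using hom inj by blast
qed

section \<open>Invariance under isomorphism\<close>

lemma star_hom_comp:
  "f \<in> star_hom A B \<Longrightarrow> g \<in> star_hom B C \<Longrightarrow> g \<circ> f \<in> star_hom A C"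
  by (simp add: star_hom_iff)

text \<open>The inverse at a sum or product in \<open>B\<close> is known once the corresponding
  element is in the carrier of \<open>A\<close>; the axioms of \<open>A\<close> provide this
  closure.\<close>

lemma star_hom_inv_into:
  assumes A: "star_algebra A" and f: "f \<in> star_hom A B" and bij: "bij_betw f (carrier A) (carrier B)"
  shows "inv_into (carrier A) f \<in> star_hom B A"
proof -
  interpret star_algebra A by (rule A)
  let ?g = "inv_into (carrier A) f"
  have g: "?g x \<in> carrier A" "f (?g x) = x" if "x \<in> carrier B" for x
    using bij that by (auto simp: bij_betw_def intro: inv_into_into f_inv_into_f)
  have eq: "?g y = x" if "x \<in> carrier A" "y = f x" for x y
    using bij that by (simp add: bij_betw_def inv_into_f_f)
  show ?thesis
    unfolding star_hom_iff
  proof (intro conjI ballI allI)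
    fix x y c assume x: "x \<in> carrier B" and y: "y \<in> carrier B"
    show "?g x \<in> carrier A" by (rule g(1)[OF x])
    show "?g (x \<oplus>\<^bsub>B\<^esub> y) = ?g x \<oplus>\<^bsub>A\<^esub> ?g y"
      using f g[OF x] g[OF y] by (intro eq a_closed) (simp_all add: star_hom_iff)
    show "?g (x \<otimes>\<^bsub>B\<^esub> y) = ?g x \<otimes>\<^bsub>A\<^esub> ?g y"
      using f g[OF x] g[OF y] by (intro eq m_closed) (simp_all add: star_hom_iff)
    show "?g (c \<odot>\<^bsub>B\<^esub> x) = c \<odot>\<^bsub>A\<^esub> ?g x"
      using f g[OF x] by (intro eq smult_closed) (simp_all add: star_hom_iff class_ring_simps)
    show "?g (star B x) = star A (?g x)"
      using f g[OF x] by (intro eq star_closed) (simp_all add: star_hom_iff)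
  qed
qed

text \<open>Precomposition with a bijection keeps the image of the representation, and
  correctability depends on the image alone.\<close>

lemma transmittable_image:
  assumes g: "g \<in> star_hom B A" and bij: "bij_betw g (carrier B) (carrier A)"
    and A: "transmittable n m \<Phi> A"
  shows "transmittable n m \<Phi> B"
proof -
  obtain \<pi> where \<pi>: "\<pi> \<in> star_hom A (mat_star_algebra n)" "inj_on \<pi> (carrier A)"
    "correctable n m \<Phi> (\<pi> ` carrier A)"
    using A unfolding transmittable_def by blast
  have im: "g ` carrier B = carrier A" and "inj_on g (carrier B)" using bij by (auto simp: bij_betw_def)
  then have "inj_on (\<pi> \<circ> g) (carrier B)" using \<pi>(2) by (intro comp_inj_on) simp_all
  moreover have "(\<pi> \<circ> g) ` carrier B = \<pi> ` carrier A" by (simp only: image_comp[symmetric] im)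
  ultimately show ?thesis
    unfolding transmittable_def using star_hom_comp[OF g \<pi>(1)] \<pi>(3)
    by (intro bexI[of _ "\<pi> \<circ> g"] conjI) simp_all
qed

lemma transmittable_star_isomorphic:
  assumes A: "star_algebra A" and iso: "star_isomorphic A B"
  shows "transmittable n m \<Phi> A \<longleftrightarrow> transmittable n m \<Phi> B"
proof -
  obtain f where f: "f \<in> star_hom A B" and bij: "bij_betw f (carrier A) (carrier B)"
    using iso by (auto simp: star_isomorphic_def)
  show ?thesis
    using transmittable_image[OF f bij]
      transmittable_image[OF star_hom_inv_into[OF A f bij] bij_betw_inv_into[OF bij]] by blast
qed

theorem lemma3p5:
  fixes n m N :: nat and d :: "nat \<Rightarrow> nat"
    and \<Phi> :: "complex mat \<Rightarrow> complex mat"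
    and A :: "('a, 'm) star_algebra_scheme"
  assumes channel: "quantum_channel n m \<Phi>"
    and algebra: "star_algebra A"
    and N: "N \<ge> 1" and d: "\<forall>k \<in> {1..N}. d k \<ge> 1"
    and decomposition: "star_isomorphic A (direct_sum_mat_star_algebra N d)"
  shows "transmittable n m \<Phi> A \<longleftrightarrow>
    (\<exists>C P.
       (\<forall>k \<in> {1..N}. hilbert_subspace n (C k) \<and> hilbert_dim n (C k) = d k \<and>
                       orthogonal_projection n (C k) (P k)) \<and>
       (\<forall>k \<in> {1..N}. {P k * X * P k | X. X \<in> operator_system n m \<Phi>} = {c \<cdot>\<^sub>m P k | c. True}) \<and>
       (\<forall>k \<in> {1..N}. \<forall>j \<in> {1..N}. k \<noteq> j \<longrightarrow>
          (\<forall>X \<in> operator_system n m \<Phi>. P k * X * P j = 0\<^sub>m n n)))"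
proof -
  let ?S = "direct_sum_mat_star_algebra N d"
  let ?isometries = "\<exists>W. (\<forall>k\<in>{1..N}. W k \<in> carrier_mat n (d k) \<and> adj (W k) * W k = 1\<^sub>m (d k)) \<and>
      (\<forall>k\<in>{1..N}. \<forall>X\<in>operator_system n m \<Phi>. \<exists>c. adj (W k) * (X * W k) = c \<cdot>\<^sub>m 1\<^sub>m (d k)) \<and>
      (\<forall>k\<in>{1..N}. \<forall>j\<in>{1..N}. k \<noteq> j \<longrightarrow>
        (\<forall>X\<in>operator_system n m \<Phi>. adj (W k) * (X * W j) = 0\<^sub>m (d k) (d j)))"
  \<comment> \<open>Matrix units and the block-diagonal embedding live in the concrete direct sum,
    for which the abstract algebra is exchanged.\<close>
  have "transmittable n m \<Phi> A \<longleftrightarrow> transmittable n m \<Phi> ?S"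
    by (rule transmittable_star_isomorphic[OF algebra decomposition])
  also have "\<dots> \<longleftrightarrow> ?isometries"
  proof
    assume "transmittable n m \<Phi> ?S"
    then show ?isometries by (rule transmittable_imp_isometries[OF channel d])
  next
    assume ?isometries
    then obtain W where 1: "\<forall>k\<in>{1..N}. W k \<in> carrier_mat n (d k) \<and> adj (W k) * W k = 1\<^sub>m (d k)"
      and 2: "\<forall>k\<in>{1..N}. \<forall>X\<in>operator_system n m \<Phi>. \<exists>c. adj (W k) * (X * W k) = c \<cdot>\<^sub>m 1\<^sub>m (d k)"
      and 3: "\<forall>k\<in>{1..N}. \<forall>j\<in>{1..N}. k \<noteq> j \<longrightarrow>
        (\<forall>X\<in>operator_system n m \<Phi>. adj (W k) * (X * W j) = 0\<^sub>m (d k) (d j))"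
      by (elim exE conjE)
    show "transmittable n m \<Phi> ?S"
    proof (rule isometries_imp_transmittable[OF channel N d])
      fix k assume k: "k \<in> {1..N}"
      show "W k \<in> carrier_mat n (d k)" "adj (W k) * W k = 1\<^sub>m (d k)"
        using bspec[OF 1 k] by simp_all
      fix X assume X: "X \<in> operator_system n m \<Phi>"
      show "\<exists>c. adj (W k) * (X * W k) = c \<cdot>\<^sub>m 1\<^sub>m (d k)" by (rule bspec[OF bspec[OF 2 k] X])
      fix j assume "j \<in> {1..N}" "k \<noteq> j"
      then show "adj (W k) * (X * W j) = 0\<^sub>m (d k) (d j)"
        using bspec[OF mp[OF bspec[OF bspec[OF 3 k]]] X] by blast
    qed
  qed
  finally show ?thesis unfolding codes_iff_isometries[OF channel, symmetric] .
qed

end
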